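(* Let $\alpha>1$ and let $n\geq 3$ be an integer. There exists an odd $\frac{2\pi}{n}$-periodic function $f_\alpha\in C^{1/\alpha}(\mathbb{T})$ whose $n$-th Fourier coefficient does not vanish, $\widehat{(f_\alpha)}_n\neq 0$, and which solves $$\alpha\,\mathcal{S}f_\alpha\,\partial_x f_\alpha=f_\alpha\,\partial_x\mathcal{S}f_\alpha$$ (in the weak sense given in the context). It is given by $f_\alpha(x)=\widetilde g_\alpha(nx)$, where $\widetilde g_\alpha$ is the odd extension to $\mathbb{T}$ of $g_\alpha:=-v_\alpha^{1/\alpha}$ on $[0,\pi]$, and $v_\alpha\in C([0,\pi])$ is the only nonnegative solution, other than $0$, of $$v(x)=-\mathcal{S}_n\big(v^{1/\alpha}\big)(x)\qquad\text{for every }x\in[0,\pi].$$ Moreover, if $f\in L^2(\mathbb{T})$ is an odd $\frac{2\pi}{n}$-periodic solution of $\alpha\,\mathcal{S}f\,\partial_x f=f\,\partial_x\mathcal{S}f$ (in the same weak sense), and $\mathcal{S}f$ does not vanish on $\left(0,\frac{\pi}{n}\right)$, then $f$ is a multiple of $f_\alpha$.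
   Context: $\mathbb{T}=\mathbb{R}/2\pi\mathbb{Z}$, identified with $(-\pi,\pi]$; $\widehat{f}_k$ are Fourier coefficients on $\mathbb{T}$. $\mathcal{S}$ acts on $f\in L^2(\mathbb{T})$ with $\widehat{f}_k=0$ for $|k|\leq 2$ (in particular odd $\frac{2\pi}{n}$-periodic $f$, $n\ge3$) as the Fourier multiplier $$\widehat{(\mathcal{S}f)}_k=-\frac{1}{|k|}\,\frac{k^2-1}{k^2-4}\,\widehat{f}_k,\quad |k|\geq 3,\qquad \widehat{(\mathcal Sf)}_k=0,\ |k|\le 2.$$ $\mathcal{S}_n$ acts on mean-zero $w\in L^2(\mathbb{T})$ as the Fourier multiplier $$\widehat{(\mathcal{S}_n w)}_k=-\frac{1}{|k|}\,\frac{n^2k^2-1}{n^2k^2-4}\,\widehat{w}_k,\qquad k\neq 0,$$ with zero mean. It maps odd functions to odd functions. On a function $w$ on $[0,\pi]$, $\mathcal{S}_n$ acts by applying it to the odd extension of $w$ to $\mathbb{T}$ and restricting the result to $[0,\pi]$. Weak sense: for $f\in L^2(\mathbb{T})$, "$\alpha\,\mathcal{S}f\,\partial_x f=f\,\partial_x\mathcal{S}f$" means $$-\alpha\int_{-\pi}^{\pi} f\,\mathcal{S}f\,\partial_x\psi\,dx=(\alpha+1)\int_{-\pi}^{\pi} f\,\partial_x(\mathcal{S}f)\,\psi\,dx\qquad\text{for every }\psi\in C^\infty(\mathbb{T}).$$ *)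

theory Defs
  imports "HOL-Analysis.Analysis"
begin

text \<open>
  Functions on the circle \<open>\<real>/2\<pi>\<int>\<close> are \<open>2\<pi>\<close>-periodic functions on \<^typ>\<open>real\<close>; they are
  real-valued. Elements of \<open>L\<^sup>2\<close> are represented by Lebesgue measurable functions.
\<close>

definition L2_circle :: "(real \<Rightarrow> real) \<Rightarrow> bool" where
  "L2_circle f \<longleftrightarrow>
     f \<in> borel_measurable lebesgue \<and> (\<forall>x. f (x + 2 * pi) = f x) \<and>
     set_integrable lebesgue {-pi..pi} (\<lambda>x. (f x)\<^sup>2)"

definition smooth_circle :: "(real \<Rightarrow> real) \<Rightarrow> bool" where
  "smooth_circle \<psi> \<longleftrightarrow>
     (\<forall>x. \<psi> (x + 2 * pi) = \<psi> x) \<and> (\<forall>j x. (deriv ^^ j) \<psi> differentiable at x)"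

definition holder_circle :: "real \<Rightarrow> (real \<Rightarrow> real) \<Rightarrow> bool" where
  "holder_circle \<beta> f \<longleftrightarrow>
     (\<forall>x. f (x + 2 * pi) = f x) \<and> (\<exists>C. \<forall>x y. \<bar>f x - f y\<bar> \<le> C * \<bar>x - y\<bar> powr \<beta>)"

definition fourier_coeff :: "(real \<Rightarrow> real) \<Rightarrow> int \<Rightarrow> complex" where
  "fourier_coeff f k =
     (LINT x:{-pi..pi}|lebesgue. complex_of_real (f x) * cis (- (of_int k * x))) / (2 * pi)"

text \<open>
  The Fourier multiplier with symbol \<open>m\<close>. For \<open>f \<in> L\<^sup>2\<close> and \<open>m k = O(1/\<bar>k\<bar>)\<close>, as in both uses
  below, the series converges absolutely and uniformly (Cauchy-Schwarz), so this is the continuous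
  representative of the multiplier applied to \<open>f\<close>. For real-valued \<open>f\<close> and an even real symbol
  the sum is real, so \<^const>\<open>Re\<close> only changes the type.
\<close>

definition fourier_multiplier :: "(int \<Rightarrow> real) \<Rightarrow> (real \<Rightarrow> real) \<Rightarrow> real \<Rightarrow> real" where
  "fourier_multiplier m f x =
     Re (\<Sum>\<^sub>\<infinity>k\<in>UNIV. complex_of_real (m k) * fourier_coeff f k * cis (of_int k * x))"

definition S_op :: "(real \<Rightarrow> real) \<Rightarrow> real \<Rightarrow> real" where
  "S_op = fourier_multiplier
     (\<lambda>k. if \<bar>k\<bar> \<le> 2 then 0
          else - (1 / \<bar>real_of_int k\<bar>) * (((of_int k)\<^sup>2 - 1) / ((of_int k)\<^sup>2 - 4)))"

definition Sn_op :: "nat \<Rightarrow> (real \<Rightarrow> real) \<Rightarrow> real \<Rightarrow> real" where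
  "Sn_op n = fourier_multiplier
     (\<lambda>k. if k = 0 then 0
          else - (1 / \<bar>real_of_int k\<bar>) *
            (((real n)\<^sup>2 * (of_int k)\<^sup>2 - 1) / ((real n)\<^sup>2 * (of_int k)\<^sup>2 - 4)))"

text \<open>The representative of \<open>x\<close> modulo \<open>2\<pi>\<close> in \<open>(-\<pi>, \<pi>]\<close>.\<close>

definition circle_rep :: "real \<Rightarrow> real" where
  "circle_rep x = x - 2 * pi * of_int \<lceil>(x - pi) / (2 * pi)\<rceil>"

text \<open>
  The odd extension to the circle of a function on \<open>[0, \<pi>]\<close>. An odd function on the circle vanishes
  at \<open>0\<close> and at \<open>\<pi>\<close>, so the values of \<open>w\<close> at these two points are not used.
\<close>

definition odd_ext :: "(real \<Rightarrow> real) \<Rightarrow> real \<Rightarrow> real" where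
  "odd_ext w x =
     (let y = circle_rep x in
      if 0 < y \<and> y < pi then w y
      else if - pi < y \<and> y < 0 then - w (- y)
      else 0)"

text \<open>The action of \<^const>\<open>Sn_op\<close> on functions on \<open>[0, \<pi>]\<close>; only the values on \<open>[0, \<pi>]\<close> are meant.\<close>

definition Sn_half :: "nat \<Rightarrow> (real \<Rightarrow> real) \<Rightarrow> real \<Rightarrow> real" where
  "Sn_half n w = Sn_op n (odd_ext w)"

definition weak_deriv_circle :: "(real \<Rightarrow> real) \<Rightarrow> (real \<Rightarrow> real) \<Rightarrow> bool" where
  "weak_deriv_circle u D \<longleftrightarrow> L2_circle D \<and>
     (\<forall>\<psi>. smooth_circle \<psi> \<longrightarrow>
        (LINT x:{-pi..pi}|lebesgue. u x * deriv \<psi> x) =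
        - (LINT x:{-pi..pi}|lebesgue. D x * \<psi> x))"

text \<open>
  The weak form of \<open>\<alpha> S f \<partial>\<^sub>x f = f \<partial>\<^sub>x S f\<close>. The function \<open>D\<close> is \<open>\<partial>\<^sub>x S f\<close>, which exists in
  \<open>L\<^sup>2\<close> for every \<open>f \<in> L\<^sup>2\<close> and is unique up to null sets.
\<close>

definition weak_solution :: "real \<Rightarrow> (real \<Rightarrow> real) \<Rightarrow> bool" where
  "weak_solution \<alpha> f \<longleftrightarrow> L2_circle f \<and>
     (\<exists>D. weak_deriv_circle (S_op f) D \<and>
        (\<forall>\<psi>. smooth_circle \<psi> \<longrightarrow>
           - \<alpha> * (LINT x:{-pi..pi}|lebesgue. f x * S_op f x * deriv \<psi> x) =
           (\<alpha> + 1) * (LINT x:{-pi..pi}|lebesgue. f x * D x * \<psi> x)))"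

text \<open>
  Nonnegative solutions on \<open>[0, \<pi>]\<close> of \<open>v = - S\<^sub>n (v\<^bsup>1/\<alpha>\<^esup>)\<close>, other than \<open>0\<close>. Square integrability of
  \<open>v\<^bsup>1/\<alpha>\<^esup>\<close> is what is needed for the right-hand side to be defined.
\<close>

definition nonneg_nonzero_solution :: "real \<Rightarrow> nat \<Rightarrow> (real \<Rightarrow> real) \<Rightarrow> bool" where
  "nonneg_nonzero_solution \<alpha> n v \<longleftrightarrow>
     L2_circle (odd_ext (\<lambda>y. v y powr (1 / \<alpha>))) \<and>
     (\<forall>x\<in>{0..pi}. v x \<ge> 0) \<and> (\<exists>x\<in>{0..pi}. v x \<noteq> 0) \<and>
     (\<forall>x\<in>{0..pi}. v x = - Sn_half n (\<lambda>y. v y powr (1 / \<alpha>)) x)"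

end

theory Submission
  imports Defs
begin

text \<open>
  Put \<open>p = 1/\<alpha> < 1\<close>. On odd functions both operators are sine series, with symbols of size \<open>O(1/k)\<close>, and for
  \<open>f(x) = F(n x)\<close> the \<open>k\<close>-th sine coefficient of \<open>f\<close> vanishes unless \<open>n\<close> divides \<open>k\<close>. Comparing
  the symbols gives \<open>(S f)(x) = (S\<^sub>n F)(n x) / n\<close> (\<open>S_op_scaled\<close>), so everything reduces to the sublinear
  equation \<open>v = T (v\<^sup>p)\<close> on the half period \<open>[0, \<pi>]\<close>, where \<open>T = - S\<^sub>n\<close>.

  The operator \<open>T\<close> maps nonnegative functions on the half period to nonnegative functions
  (\<open>Sn_positive\<close>). Its symbol is
  \<open>1/k + (3/n\<^sup>2) / (k (k + 2/n) (k - 2/n))\<close>, and dividing the sine coefficients of a nonnegative function by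
  \<open>k + a\<close>, \<open>a > -1\<close>, keeps the harmonic extension nonnegative on the upper half disc: in polar coordinates the division
  is an integration of the extension along rays. Hence \<open>T\<close> is monotone. Since \<open>p < 1\<close>, a large constant is a
  supersolution of \<open>v = T (v\<^sup>p)\<close> and bounds every solution; \<open>sin\<close> is a subsolution, because it is an eigenfunction
  with eigenvalue above \<open>1\<close> and \<open>sin \<le> sin\<^sup>p\<close>. Iteration from the constant decreases to the greatest
  solution, which is at least \<open>sin\<close> (\<open>greatest_solution\<close>). If \<open>w\<close> is another solution, then \<open>w \<le> v\<close>, and symmetry
  of \<open>T\<close> gives \<open>\<integral> (v w\<^sup>p - w v\<^sup>p) = 0\<close> with a nonnegative integrand, so \<open>w = v\<close> wherever \<open>w > 0\<close>; by
  connectedness \<open>w = v\<close> everywhere (\<open>solution_unique_below\<close>).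

  For the regularity, let \<open>F\<close> be the odd extension of \<open>v\<^sup>p\<close> and \<open>V = T F\<close>, which is the odd extension of \<open>v\<close>. Square integrability of
  \<open>F\<close> makes \<open>V\<close> Hoelder continuous; then \<open>F = sgn V \<bar>V\<bar>\<^sup>p\<close> is Hoelder continuous, and \<open>T\<close>
  gains a full derivative on Hoelder functions, because up to sign and a smoother remainder the derivative of \<open>T F\<close> is the conjugate function
  of \<open>F\<close> (\<open>Sn_derivative\<close>). So \<open>V\<close> is continuously differentiable and \<open>F\<close> is Hoelder continuous
  with exponent \<open>p\<close>. For \<open>f(x) = - F(n x)\<close> one has \<open>S f(x) = V(n x) / n\<close>, hence \<open>f S f\<close> is a multiple of
  \<open>\<bar>V(n x)\<bar>\<^bsup>p + 1\<^esup>\<close>, and the weak equation is one integration by parts (\<open>rescaled_solution\<close>).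

  Conversely, let \<open>f\<close> be a solution and let \<open>V = S f\<close> have no zero on \<open>(0, \<pi>/n)\<close>. The weak equation says that \<open>H = f V\<close>
  is a primitive of \<open>(1 + p) f V'\<close>, that is \<open>H' = (1 + p) H V' / V\<close>; so
  \<open>H \<bar>V\<bar>\<^bsup>-(1 + p)\<^esup>\<close> is constant and \<open>f = c \<bar>V\<bar>\<^sup>p\<close> on that interval
  (\<open>weak_solution_power\<close>). Rescaled to \<open>[0, \<pi>]\<close>, a positive multiple of \<open>\<bar>V\<bar>\<close> solves \<open>v = T (v\<^sup>p)\<close>, and
  uniqueness identifies it (\<open>classification\<close>).
\<close>

section \<open>Sine series of odd functions\<close>

definition odd_L2 :: "(real \<Rightarrow> real) \<Rightarrow> bool" where
  "odd_L2 f \<longleftrightarrow> L2_circle f \<and> (\<forall>x. f (- x) = - f x)"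

definition sine_coeff :: "(real \<Rightarrow> real) \<Rightarrow> nat \<Rightarrow> real" where
  "sine_coeff f k = integral {-pi..pi} (\<lambda>x. f x * sin (real k * x)) / pi"

text \<open>On odd functions the Fourier multiplier with symbol \<open>m \<bar>k\<bar>\<close> is this series; see
  \<open>fourier_multiplier_odd\<close>.\<close>

definition sine_mult :: "(nat \<Rightarrow> real) \<Rightarrow> (real \<Rightarrow> real) \<Rightarrow> real \<Rightarrow> real" where
  "sine_mult m f x = (\<Sum>k. m k * sine_coeff f k * sin (real k * x))"

lemma continuous_on_Icc_bounded:
  fixes g :: "real \<Rightarrow> real"
  assumes "continuous_on {a..b} g"
  shows "\<exists>B. \<forall>x\<in>{a..b}. \<bar>g x\<bar> \<le> B"
proof -
  have "bounded (g ` {a..b})"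
    by (intro compact_imp_bounded compact_continuous_image assms compact_Icc)
  then show ?thesis unfolding bounded_iff by auto
qed

lemma L2_circle_square_integrable:
  "L2_circle f \<Longrightarrow> (\<lambda>x. (f x)\<^sup>2) integrable_on {-pi..pi}"
  unfolding L2_circle_def using set_lebesgue_integral_eq_integral(1) by blast

lemma L2_circle_periodic: "L2_circle f \<Longrightarrow> f (x + 2 * pi) = f x"
  by (simp add: L2_circle_def)

lemma periodic_int:
  fixes f :: "real \<Rightarrow> 'a"
  assumes "\<And>x. f (x + p) = f x"
  shows "f (x + of_int k * p) = f x"
proof -
  have nat: "f (x + real m * p) = f x" for m x
    by (induction m arbitrary: x) (use assms in \<open>auto simp: algebra_simps, metis add.assoc add.commute\<close>)
  show ?thesis
  proof (cases "k \<ge> 0")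
    case True
    then show ?thesis using nat[of x "nat k"] by simp
  next
    case False
    then show ?thesis using nat[of "x + of_int k * p" "nat (- k)"] by (simp add: algebra_simps)
  qed
qed

lemma measurable_lebesgue_on: "f \<in> borel_measurable lebesgue \<Longrightarrow> f \<in> borel_measurable (lebesgue_on S)"
  by (simp add: measurable_restrict_space1)

lemma L2_circle_mult_bounded:
  assumes "L2_circle f" "g \<in> borel_measurable lebesgue" "\<And>x. x \<in> {-pi..pi} \<Longrightarrow> \<bar>g x\<bar> \<le> B"
  shows "(\<lambda>x. f x * g x) absolutely_integrable_on {-pi..pi}"
proof (rule measurable_bounded_by_integrable_imp_absolutely_integrable
    [where g = "\<lambda>x. B * (1 + (f x)\<^sup>2)"])
  show "(\<lambda>x. f x * g x) \<in> borel_measurable (lebesgue_on {-pi..pi})"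
    using assms by (intro measurable_lebesgue_on borel_measurable_times) (auto simp: L2_circle_def)
  show "(\<lambda>x. B * (1 + (f x)\<^sup>2)) integrable_on {-pi..pi}"
    using L2_circle_square_integrable[OF assms(1)]
    by (intro integrable_on_mult_right integrable_add) auto
  fix x assume x: "x \<in> {-pi..pi}"
  have "\<bar>f x\<bar> \<le> 1 + (f x)\<^sup>2"
    using sum_squares_bound[of "\<bar>f x\<bar>" 1] by simp
  then have "\<bar>f x\<bar> * \<bar>g x\<bar> \<le> (1 + (f x)\<^sup>2) * B"
    using assms(3)[OF x] by (intro mult_mono) auto
  then show "norm (f x * g x) \<le> B * (1 + (f x)\<^sup>2)" by (simp add: abs_mult mult.commute)
qed auto

lemma L2_circle_integrable: "L2_circle f \<Longrightarrow> f absolutely_integrable_on {-pi..pi}"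
  using L2_circle_mult_bounded[of f "\<lambda>_. 1" 1] by simp

lemma continuous_measurable_lebesgue:
  "continuous_on UNIV (g::real \<Rightarrow> real) \<Longrightarrow> g \<in> borel_measurable lebesgue"
  by (simp add: borel_measurable_continuous_onI measurable_completion)

lemma L2_circle_mult_sin:
  assumes "L2_circle f"
  shows "(\<lambda>x. f x * sin (c * x)) integrable_on {-pi..pi}"
proof -
  have "continuous_on UNIV (\<lambda>x. sin (c * x))" by (intro continuous_intros)
  then show ?thesis
    using L2_circle_mult_bounded[OF assms, of "\<lambda>x. sin (c * x)" 1]
    by (intro set_lebesgue_integral_eq_integral(1)) (simp add: continuous_measurable_lebesgue)
qed

lemma sine_coeff_has_integral:
  "L2_circle f \<Longrightarrow> ((\<lambda>x. f x * sin (real k * x)) has_integral pi * sine_coeff f k) {-pi..pi}"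
  using L2_circle_mult_sin[of f "real k"] by (simp add: sine_coeff_def has_integral_iff)

lemma sin_nat_periodic: "sin (real k * (x + 2 * pi)) = sin (real k * x)"
  using periodic_int[where f = sin and p = "2 * pi", OF sin_periodic, of "real k * x" "int k"]
  by (simp add: algebra_simps)

text \<open>The form of dominated convergence in which partial sums of Poisson kernels and of sine series are
  integrated against a function: the majorant is \<open>B \<bar>w\<bar>\<close>.\<close>

lemma bounded_convergence_weighted:
  fixes w :: "real \<Rightarrow> real"
  assumes w: "w absolutely_integrable_on S"
    and int: "\<And>N. ((\<lambda>x. w x * P N x) has_integral J N) S"
    and bd: "\<And>N x. \<bar>P N x\<bar> \<le> B" and lim: "\<And>x. (\<lambda>N. P N x) \<longlonglongrightarrow> K x"
  shows "(\<lambda>x. w x * K x) integrable_on S" "J \<longlonglongrightarrow> integral S (\<lambda>x. w x * K x)"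
proof -
  have 1: "(\<lambda>x. w x * P N x) integrable_on S" for N using int by blast
  have 2: "(\<lambda>x. \<bar>w x\<bar> * B) integrable_on S"
    using set_integrable_abs[OF w] by (intro integrable_on_mult_left set_lebesgue_integral_eq_integral(1))
  have 3: "norm (w x * P N x) \<le> \<bar>w x\<bar> * B" for N x
    using mult_left_mono[OF bd, of "\<bar>w x\<bar>"] by (simp add: abs_mult)
  have 4: "(\<lambda>N. w x * P N x) \<longlonglongrightarrow> w x * K x" for x by (intro tendsto_intros lim)
  show "(\<lambda>x. w x * K x) integrable_on S" "J \<longlonglongrightarrow> integral S (\<lambda>x. w x * K x)"
    using dominated_convergence[where f = "\<lambda>N x. w x * P N x" and g = "\<lambda>x. w x * K x", OF 1 2] 3 4
    by (auto simp: integral_unique[OF int])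
qed

lemma nonneg_even_half:
  fixes g :: "real \<Rightarrow> real"
  assumes "\<And>y. 0 < y \<Longrightarrow> y < pi \<Longrightarrow> g y \<ge> 0" "g 0 \<ge> 0" "g pi \<ge> 0" "\<And>y. g (- y) = g y"
    and "y \<in> {-pi..pi}"
  shows "g y \<ge> 0"
proof -
  have "g \<bar>y\<bar> \<ge> 0"
    using assms(1)[of "\<bar>y\<bar>"] assms(2,3,5) by (cases "y = 0 \<or> \<bar>y\<bar> = pi") auto
  then show ?thesis using assms(4)[of y] by (auto simp: abs_if split: if_splits)
qed

lemma integral_cos_int:
  "((\<lambda>x. cos (of_int m * x)) has_integral (if m = 0 then 2 * pi else 0)) {-pi..pi}"
proof (cases "m = 0")
  case True
  then show ?thesis using has_integral_const_real[of "1::real" "-pi" pi] by simp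
next
  case False
  have "((\<lambda>x. cos (of_int m * x)) has_integral
      (sin (of_int m * pi) / of_int m - sin (of_int m * (-pi)) / of_int m)) {-pi..pi}"
    by (rule fundamental_theorem_of_calculus)
      (use False in \<open>auto intro!: derivative_eq_intros simp flip: has_real_derivative_iff_has_vector_derivative\<close>)
  moreover have "sin (of_int m * pi) = (0::real)" by (simp add: sin_zero_iff_int2)
  ultimately show ?thesis using False by simp
qed

lemma sin_orthogonal:
  "((\<lambda>x. sin (real j * x) * sin (real k * x)) has_integral (if j = k \<and> j \<noteq> 0 then pi else 0)) {-pi..pi}"
proof -
  have "((\<lambda>x. (cos (of_int (int j - int k) * x) - cos (of_int (int j + int k) * x)) / 2) has_integral
     ((if int j - int k = 0 then 2 * pi else 0) - (if int j + int k = 0 then 2 * pi else 0)) / 2) {-pi..pi}"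
    by (intro has_integral_divide has_integral_diff integral_cos_int)
  moreover have "(cos (of_int (int j - int k) * x) - cos (of_int (int j + int k) * x)) / 2 =
     sin (real j * x) * sin (real k * x)" for x :: real
    by (simp add: sin_times_sin algebra_simps)
  ultimately show ?thesis by (auto split: if_splits)
qed

lemma sine_coeff_0 [simp]: "sine_coeff f 0 = 0"
  by (simp add: sine_coeff_def)

text \<open>Bessel's inequality: expand the square of the distance from \<open>f\<close> to a partial sum.\<close>

lemma sine_bessel:
  assumes f: "L2_circle f"
  shows "(\<Sum>k<N. (sine_coeff f k)\<^sup>2) \<le> integral {-pi..pi} (\<lambda>x. (f x)\<^sup>2) / pi"
proof -
  define b where "b = sine_coeff f"
  define s where "s = (\<lambda>x. \<Sum>k<N. b k * sin (real k * x))"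
  have fs: "((\<lambda>x. f x * sin (real k * x)) has_integral pi * b k) {-pi..pi}" for k
    unfolding b_def by (rule sine_coeff_has_integral[OF f])
  have 1: "((\<lambda>x. \<Sum>k<N. b k * (f x * sin (real k * x))) has_integral (\<Sum>k<N. b k * (pi * b k))) {-pi..pi}"
    by (intro has_integral_sum has_integral_mult_right fs) auto
  have 2: "((\<lambda>x. \<Sum>j<N. \<Sum>k<N. b j * b k * (sin (real j * x) * sin (real k * x))) has_integral
     (\<Sum>j<N. \<Sum>k<N. b j * b k * (if j = k \<and> j \<noteq> 0 then pi else 0))) {-pi..pi}"
    by (intro has_integral_sum has_integral_mult_right sin_orthogonal) auto
  have b0: "b 0 = 0" by (simp add: b_def)
  have "(\<Sum>j<N. \<Sum>k<N. b j * b k * (if j = k \<and> j \<noteq> 0 then pi else 0)) =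
      (\<Sum>j<N. \<Sum>k<N. if j = k then pi * (b k)\<^sup>2 else 0)"
    by (intro sum.cong refl) (auto simp: power2_eq_square b0)
  then have 2: "((\<lambda>x. (s x)\<^sup>2) has_integral pi * (\<Sum>k<N. (b k)\<^sup>2)) {-pi..pi}"
    using 2 by (simp add: s_def power2_eq_square sum_product sum_distrib_left mult_ac)
  have 1: "((\<lambda>x. f x * s x) has_integral pi * (\<Sum>k<N. (b k)\<^sup>2)) {-pi..pi}"
    using 1 by (simp add: s_def power2_eq_square sum_distrib_left mult_ac)
  have 0: "((\<lambda>x. (f x)\<^sup>2) has_integral integral {-pi..pi} (\<lambda>x. (f x)\<^sup>2)) {-pi..pi}"
    using L2_circle_square_integrable[OF f] by (simp add: has_integral_iff)
  have "((\<lambda>x. (f x)\<^sup>2 - 2 * (f x * s x) + (s x)\<^sup>2) has_integral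
     integral {-pi..pi} (\<lambda>x. (f x)\<^sup>2) - 2 * (pi * (\<Sum>k<N. (b k)\<^sup>2)) + pi * (\<Sum>k<N. (b k)\<^sup>2)) {-pi..pi}"
    by (intro has_integral_add has_integral_diff has_integral_mult_right 0 1 2)
  moreover have "(f x)\<^sup>2 - 2 * (f x * s x) + (s x)\<^sup>2 \<ge> 0" for x
    using zero_le_power2[of "f x - s x"] by (simp add: power2_diff)
  ultimately have "0 \<le> integral {-pi..pi} (\<lambda>x. (f x)\<^sup>2) - 2 * (pi * (\<Sum>k<N. (b k)\<^sup>2))
      + pi * (\<Sum>k<N. (b k)\<^sup>2)"
    by (rule has_integral_nonneg)
  then show ?thesis unfolding b_def by (simp add: field_simps)
qed

lemma sine_coeff_square_summable:
  assumes "L2_circle f" shows "summable (\<lambda>k. (sine_coeff f k)\<^sup>2)"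
  using sine_bessel[OF assms] by (intro summableI_nonneg_bounded) auto

lemma sine_coeff_add:
  assumes "L2_circle f" "L2_circle g"
  shows "sine_coeff (\<lambda>x. a * f x + b * g x) k = a * sine_coeff f k + b * sine_coeff g k"
proof -
  have "integral {-pi..pi} (\<lambda>x. a * (f x * sin (real k * x)) + b * (g x * sin (real k * x))) =
     a * integral {-pi..pi} (\<lambda>x. f x * sin (real k * x)) + b * integral {-pi..pi} (\<lambda>x. g x * sin (real k * x))"
    using assms by (subst integral_add) (auto intro!: integrable_on_mult_right L2_circle_mult_sin)
  then show ?thesis
    by (simp add: sine_coeff_def algebra_simps add_divide_distrib)
qed

text \<open>A symbol of size \<open>O(1/k)\<close>. With square summable coefficients this makes all sine series below
  absolutely convergent.\<close>

definition symbol_bound :: "(nat \<Rightarrow> real) \<Rightarrow> bool" where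
  "symbol_bound m \<longleftrightarrow> (\<forall>k. \<bar>m k\<bar> \<le> 2 / real k)"

lemma sum_recip_squares: "summable (\<lambda>k. 1 / (real k)\<^sup>2)"
  using inverse_power_summable[of 2] by (simp add: inverse_eq_divide)

lemma symbol_abs_summable:
  assumes "L2_circle f" "symbol_bound m"
  shows "summable (\<lambda>k. \<bar>m k * sine_coeff f k\<bar>)"
proof (rule summable_comparison_test')
  show "summable (\<lambda>k. (1 / (real k)\<^sup>2) + (sine_coeff f k)\<^sup>2)"
    by (intro summable_add sum_recip_squares sine_coeff_square_summable assms)
  fix k assume "k \<ge> (0::nat)"
  have "\<bar>m k\<bar> * \<bar>sine_coeff f k\<bar> \<le> 2 / real k * \<bar>sine_coeff f k\<bar>"
    using assms by (intro mult_right_mono) (auto simp: symbol_bound_def)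
  also have "\<dots> \<le> 1 / (real k)\<^sup>2 + (sine_coeff f k)\<^sup>2"
    using sum_squares_bound[of "1 / real k" "\<bar>sine_coeff f k\<bar>"] by (simp add: power_divide)
  finally show "norm \<bar>m k * sine_coeff f k\<bar> \<le> 1 / (real k)\<^sup>2 + (sine_coeff f k)\<^sup>2"
    by (simp add: abs_mult)
qed

lemma sine_term_bound: "\<bar>c * sin y\<bar> \<le> \<bar>c::real\<bar>"
  by (simp add: abs_mult mult_left_le)

lemma sine_mult_summable:
  assumes "L2_circle f" "symbol_bound m"
  shows "summable (\<lambda>k. m k * sine_coeff f k * sin (real k * x))"
  by (rule summable_comparison_test'[OF symbol_abs_summable[OF assms]]) (auto intro: sine_term_bound)

lemma sine_mult_uniform_limit:
  assumes "L2_circle f" "symbol_bound m"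
  shows "uniform_limit UNIV (\<lambda>N x. \<Sum>k<N. m k * sine_coeff f k * sin (real k * x)) (sine_mult m f) sequentially"
  unfolding sine_mult_def
  by (rule Weierstrass_m_test[OF _ symbol_abs_summable[OF assms]]) (auto intro: sine_term_bound)

lemma sine_mult_continuous:
  assumes "L2_circle f" "symbol_bound m"
  shows "continuous_on UNIV (sine_mult m f)"
  by (rule uniform_limit_theorem[OF _ sine_mult_uniform_limit[OF assms]])
    (auto intro!: always_eventually continuous_intros)

text \<open>Abel's method: a property of the Poisson sums for \<open>r < 1\<close> passes to the sine series itself as
  \<open>r\<close> tends to \<open>1\<close>.\<close>

lemma sine_mult_radial_continuous:
  assumes f: "L2_circle f" and m: "symbol_bound m"
  shows "continuous_on {0..1} (\<lambda>r. sine_mult (\<lambda>k. m k * r ^ k) f x)"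
proof -
  have "uniform_limit {0..1} (\<lambda>N r. \<Sum>k<N. m k * r ^ k * sine_coeff f k * sin (real k * x))
     (\<lambda>r. sine_mult (\<lambda>k. m k * r ^ k) f x) sequentially"
    unfolding sine_mult_def
  proof (rule Weierstrass_m_test[OF _ symbol_abs_summable[OF f m]])
    fix k :: nat and r :: real assume r: "r \<in> {0..1}"
    have "\<bar>m k * r ^ k * sine_coeff f k * sin (real k * x)\<bar> \<le> \<bar>m k * sine_coeff f k * r ^ k\<bar>"
      using sine_term_bound[of "m k * r ^ k * sine_coeff f k" "real k * x"] by (simp add: mult_ac)
    also have "\<dots> \<le> \<bar>m k * sine_coeff f k\<bar> * 1"
      unfolding abs_mult[of _ "r ^ k"] using r by (intro mult_left_mono) (auto simp: power_le_one)
    finally show "norm (m k * r ^ k * sine_coeff f k * sin (real k * x)) \<le> \<bar>m k * sine_coeff f k\<bar>"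
      by simp
  qed
  then show ?thesis
    by (rule uniform_limit_theorem[rotated]) (auto intro!: always_eventually continuous_intros)
qed

lemma sine_mult_odd: "L2_circle f \<Longrightarrow> symbol_bound m \<Longrightarrow> sine_mult m f (- x) = - sine_mult m f x"
  unfolding sine_mult_def by (subst suminf_minus[symmetric]) (auto intro: sine_mult_summable)

lemma sine_mult_periodic: "sine_mult m f (x + 2 * pi) = sine_mult m f x"
  unfolding sine_mult_def sin_nat_periodic ..

lemma sine_mult_at_0 [simp]: "sine_mult m f 0 = 0"
  by (simp add: sine_mult_def)

lemma sine_mult_at_pi [simp]: "sine_mult m f pi = 0"
  by (simp add: sine_mult_def)

lemma sine_mult_linear:
  assumes "L2_circle f" "L2_circle g" "symbol_bound m"
  shows "sine_mult m (\<lambda>x. a * f x + b * g x) x = a * sine_mult m f x + b * sine_mult m g x"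
proof -
  have "(\<lambda>k. a * (m k * sine_coeff f k * sin (real k * x)) + b * (m k * sine_coeff g k * sin (real k * x)))
      sums (a * sine_mult m f x + b * sine_mult m g x)"
    unfolding sine_mult_def using assms
    by (intro sums_add sums_mult summable_sums sine_mult_summable)
  then show ?thesis
    using assms by (simp add: sine_mult_def[of m "\<lambda>x. a * f x + b * g x"] sine_coeff_add algebra_simps sums_iff)
qed

text \<open>Cauchy-Schwarz, with Bessel's inequality for the coefficients and \<open>\<Sum> 4/k\<^sup>2\<close> for the symbol, so
  that the constant is the same for all symbols.\<close>

lemma sine_mult_L2_bound:
  "\<exists>C>0. \<forall>f m x. L2_circle f \<longrightarrow> symbol_bound m \<longrightarrow>
     \<bar>sine_mult m f x\<bar> \<le> C * sqrt (integral {-pi..pi} (\<lambda>x. (f x)\<^sup>2))"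
proof -
  define S where "S = (\<Sum>k. 4 / (real k)\<^sup>2)"
  have sm: "summable (\<lambda>k. 4 / (real k)\<^sup>2)"
    using summable_mult[OF sum_recip_squares, of 4] by simp
  have S0: "S \<ge> 0" unfolding S_def by (rule suminf_nonneg[OF sm]) auto
  have "\<bar>sine_mult m f x\<bar> \<le> sqrt (S + 1) * sqrt (integral {-pi..pi} (\<lambda>x. (f x)\<^sup>2) / pi)"
    if f: "L2_circle f" and m: "symbol_bound m" for f m x
  proof -
    have "(\<Sum>k<N. \<bar>m k * sine_coeff f k\<bar>) \<le> sqrt (S + 1) * sqrt (integral {-pi..pi} (\<lambda>x. (f x)\<^sup>2) / pi)" for N
    proof -
      have "(\<Sum>k<N. \<bar>m k * sine_coeff f k\<bar>) \<le> sqrt (\<Sum>k<N. (m k)\<^sup>2) * sqrt (\<Sum>k<N. (sine_coeff f k)\<^sup>2)"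
        using L2_set_mult_ineq[of m "sine_coeff f" "{..<N}"] by (simp add: abs_mult L2_set_def)
      also have "\<dots> \<le> sqrt (S + 1) * sqrt (integral {-pi..pi} (\<lambda>x. (f x)\<^sup>2) / pi)"
      proof (intro mult_mono real_sqrt_le_mono sine_bessel f)
        have "(\<Sum>k<N. (m k)\<^sup>2) \<le> (\<Sum>k<N. 4 / (real k)\<^sup>2)"
        proof (intro sum_mono)
          fix k
          have "\<bar>m k\<bar>\<^sup>2 \<le> (2 / real k)\<^sup>2" using m by (intro power_mono) (auto simp: symbol_bound_def)
          then show "(m k)\<^sup>2 \<le> 4 / (real k)\<^sup>2" by (simp add: power_divide)
        qed
        also have "\<dots> \<le> S" unfolding S_def by (rule sum_le_suminf[OF sm]) auto
        finally show "(\<Sum>k<N. (m k)\<^sup>2) \<le> S + 1" by simp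
      qed (auto intro!: sum_nonneg simp: S0)
      finally show ?thesis .
    qed
    then have "(\<Sum>k. \<bar>m k * sine_coeff f k\<bar>) \<le> sqrt (S + 1) * sqrt (integral {-pi..pi} (\<lambda>x. (f x)\<^sup>2) / pi)"
      by (intro suminf_le_const symbol_abs_summable f m) auto
    moreover have "\<bar>sine_mult m f x\<bar> \<le> (\<Sum>k. \<bar>m k * sine_coeff f k\<bar>)"
    proof -
      have s: "summable (\<lambda>k. \<bar>m k * sine_coeff f k * sin (real k * x)\<bar>)"
        by (rule summable_comparison_test'[OF symbol_abs_summable[OF f m]]) (auto intro: sine_term_bound)
      have "\<bar>sine_mult m f x\<bar> \<le> (\<Sum>k. \<bar>m k * sine_coeff f k * sin (real k * x)\<bar>)"
        unfolding sine_mult_def by (rule summable_rabs[OF s])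
      also have "\<dots> \<le> (\<Sum>k. \<bar>m k * sine_coeff f k\<bar>)"
        by (intro suminf_le s symbol_abs_summable f m sine_term_bound)
      finally show ?thesis .
    qed
    ultimately show ?thesis by linarith
  qed
  then have "\<bar>sine_mult m f x\<bar> \<le> (sqrt (S + 1) / sqrt pi) * sqrt (integral {-pi..pi} (\<lambda>x. (f x)\<^sup>2))"
    if "L2_circle f" "symbol_bound m" for f m x
    using that by (simp add: real_sqrt_divide)
  moreover have "sqrt (S + 1) / sqrt pi > 0" using S0 by simp
  ultimately show ?thesis by blast
qed

lemma has_sum_int_even:
  fixes g :: "nat \<Rightarrow> real"
  assumes g: "summable (\<lambda>k. \<bar>g k\<bar>)" and g0: "g 0 = 0"
  shows "((\<lambda>k::int. g (nat \<bar>k\<bar>)) has_sum (2 * suminf g)) UNIV"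
proof -
  have sg: "g sums suminf g"
    using summable_rabs_cancel[OF g] by (rule summable_sums)
  have 1: "(g has_sum suminf g) UNIV"
    using norm_summable_imp_has_sum[OF _ sg] g by simp
  have "((\<lambda>k::int. g (nat \<bar>k\<bar>)) has_sum suminf g) (range int)"
    by (subst has_sum_reindex) (use 1 in \<open>auto simp: o_def\<close>)
  moreover have "(\<lambda>n. g (Suc n)) sums suminf g"
    using sg g0 by (simp add: sums_Suc_iff)
  then have "((\<lambda>n. g (Suc n)) has_sum suminf g) UNIV"
    using g by (intro norm_summable_imp_has_sum) (simp_all add: summable_Suc_iff[of "\<lambda>n. \<bar>g n\<bar>"])
  then have "((\<lambda>k::int. g (nat \<bar>k\<bar>)) has_sum suminf g) (range (\<lambda>n. - int (Suc n)))"
    by (subst has_sum_reindex) (auto simp: o_def inj_on_def nat_add_distrib)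
  ultimately have "((\<lambda>k::int. g (nat \<bar>k\<bar>)) has_sum (suminf g + suminf g))
     (range int \<union> range (\<lambda>n. - int (Suc n)))"
    by (rule has_sum_Un_disjoint) auto
  moreover have "k \<in> range int \<union> range (\<lambda>n. - int (Suc n))" for k :: int
  proof (cases "k \<ge> 0")
    case True
    then have "k = int (nat k)" by simp
    then show ?thesis by blast
  next
    case False
    then have "k = - int (Suc (nat (- k - 1)))" by simp
    then show ?thesis by blast
  qed
  then have "range int \<union> range (\<lambda>n. - int (Suc n)) = UNIV" by blast
  ultimately show ?thesis by simp
qed

lemma odd_integral_zero:
  fixes g :: "real \<Rightarrow> real"
  assumes "\<And>x. g (- x) = - g x"
  shows "integral {-a..a} g = 0"
  using Henstock_Kurzweil_Integration.integral_reflect_real[of a "-a" g] assms by simp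

lemma fourier_coeff_odd:
  assumes "odd_L2 f"
  shows "fourier_coeff f k = - \<i> * complex_of_real (of_int (sgn k) * sine_coeff f (nat \<bar>k\<bar>) / 2)"
proof -
  have L: "L2_circle f" and o: "\<And>x. f (- x) = - f x" using assms by (auto simp: odd_L2_def)
  define A where "A = (\<lambda>x. f x * cos (of_int k * x))"
  define B where "B = (\<lambda>x. f x * sin (of_int k * x))"
  have c: "continuous_on UNIV (\<lambda>x. cos (of_int k * x :: real))" "continuous_on UNIV (\<lambda>x. sin (of_int k * x :: real))"
    by (intro continuous_intros)+
  have A: "A absolutely_integrable_on {-pi..pi}" and B: "B absolutely_integrable_on {-pi..pi}"
    unfolding A_def B_def by (rule L2_circle_mult_bounded[OF L, where B = 1]; simp add: c continuous_measurable_lebesgue)+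
  have "integral {-pi..pi} A = 0"
    by (rule odd_integral_zero) (simp add: A_def o)
  then have A0: "(LINT x:{-pi..pi}|lebesgue. A x) = 0"
    using set_lebesgue_integral_eq_integral(2)[OF A] by simp
  have "integral {-pi..pi} B = pi * (of_int (sgn k) * sine_coeff f (nat \<bar>k\<bar>))"
  proof (cases "k \<ge> 0")
    case True
    then show ?thesis by (cases "k = 0") (auto simp: B_def sine_coeff_def sgn_if)
  next
    case False
    then have "B = (\<lambda>x. - (f x * sin (real (nat \<bar>k\<bar>) * x)))" by (auto simp: B_def)
    then show ?thesis using False by (simp add: sine_coeff_def)
  qed
  then have B0: "(LINT x:{-pi..pi}|lebesgue. B x) = pi * (of_int (sgn k) * sine_coeff f (nat \<bar>k\<bar>))"
    using set_lebesgue_integral_eq_integral(2)[OF B] by simp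
  have cA: "set_integrable lebesgue {-pi..pi} (\<lambda>x. complex_of_real (A x))"
    and cB: "set_integrable lebesgue {-pi..pi} (\<lambda>x. complex_of_real (B x))"
    using A B by (simp_all add: set_integrable_def scaleR_conv_of_real complex_of_real_integrable_eq flip: of_real_mult)
  have eq: "complex_of_real (f x) * cis (- (of_int k * x)) = complex_of_real (A x) - \<i> * complex_of_real (B x)" for x
    by (simp add: A_def B_def complex_eq_iff)
  have "(LINT x:{-pi..pi}|lebesgue. complex_of_real (f x) * cis (- (of_int k * x))) =
     (LINT x:{-pi..pi}|lebesgue. complex_of_real (A x)) - (LINT x:{-pi..pi}|lebesgue. \<i> * complex_of_real (B x))"
    unfolding eq by (rule set_integral_diff(2)[OF cA]) (use cB in simp)
  also have "\<dots> = - \<i> * complex_of_real (pi * (of_int (sgn k) * sine_coeff f (nat \<bar>k\<bar>)))"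
    by (simp add: set_integral_complex_of_real A0 B0)
  finally show ?thesis
    by (simp add: fourier_coeff_def)
qed

text \<open>The coefficients of an odd function are odd and imaginary, so the terms with indices \<open>k\<close> and \<open>-k\<close> have the same
  real part, half the \<open>k\<close>-th term of the sine series.\<close>

lemma fourier_multiplier_odd:
  assumes f: "odd_L2 f" and m: "symbol_bound m" and \<mu>: "\<And>k. \<mu> k = m (nat \<bar>k\<bar>)"
  shows "fourier_multiplier \<mu> f = sine_mult m f"
proof
  fix x
  have L: "L2_circle f" using f by (simp add: odd_L2_def)
  define g where "g = (\<lambda>k. m k * sine_coeff f k * sin (real k * x) / 2)"
  define t where "t = (\<lambda>k. complex_of_real (\<mu> k) * fourier_coeff f k * cis (of_int k * x))"
  have Re_t: "Re (t k) = g (nat \<bar>k\<bar>)" for k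
    by (cases k "0::int" rule: linorder_cases) (auto simp: t_def g_def \<mu> fourier_coeff_odd[OF f] of_nat_nat)
  have nt: "norm (t k) \<le> \<bar>m (nat \<bar>k\<bar>) * sine_coeff f (nat \<bar>k\<bar>)\<bar>" for k
    by (cases k "0::int" rule: linorder_cases) (auto simp: t_def \<mu> fourier_coeff_odd[OF f] norm_mult abs_mult)
  have "(\<lambda>k::int. norm (m (nat \<bar>k\<bar>) * sine_coeff f (nat \<bar>k\<bar>))) summable_on UNIV"
    using has_sum_int_even[of "\<lambda>k. \<bar>m k * sine_coeff f k\<bar>"] symbol_abs_summable[OF L m]
    by (auto simp: summable_on_def)
  then have "(\<lambda>k. norm (t k)) summable_on UNIV"
    by (rule Infinite_Sum.abs_summable_on_comparison_test) (use nt in auto)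
  then have "t summable_on UNIV" by (rule abs_summable_summable)
  then have "(t has_sum infsum t UNIV) UNIV" by (rule has_sum_infsum)
  then have "((\<lambda>k. Re (t k)) has_sum Re (infsum t UNIV)) UNIV"
    by (rule has_sum_Re)
  moreover have "summable (\<lambda>k. \<bar>g k\<bar>)"
  proof (rule summable_comparison_test'[OF symbol_abs_summable[OF L m]])
    fix k show "norm \<bar>g k\<bar> \<le> \<bar>m k * sine_coeff f k\<bar>"
      using sine_term_bound[of "m k * sine_coeff f k" "real k * x"] unfolding g_def by simp
  qed
  then have "((\<lambda>k. Re (t k)) has_sum (2 * suminf g)) UNIV"
    unfolding Re_t by (rule has_sum_int_even) (simp add: g_def)
  ultimately have "Re (infsum t UNIV) = 2 * suminf g" by (rule has_sum_unique)
  also have "\<dots> = sine_mult m f x"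
    using suminf_divide[OF sine_mult_summable[OF L m, of x], where c = 2] by (simp add: g_def sine_mult_def)
  finally show "fourier_multiplier \<mu> f x = sine_mult m f x"
    by (simp add: fourier_multiplier_def t_def)
qed

section \<open>Positivity of the operator\<close>

text \<open>Real and imaginary part of the geometric series of \<open>r e\<^bsup>i t\<^esup>\<close>.\<close>

lemma geometric_sums_cis:
  fixes r t :: real
  assumes "0 \<le> r" "r < 1"
  shows "(\<lambda>k. r ^ k * cos (real k * t)) sums ((1 - r * cos t) / (1 - 2 * r * cos t + r\<^sup>2))" (is ?cos)
    and "(\<lambda>k. r ^ k * sin (real k * t)) sums (r * sin t / (1 - 2 * r * cos t + r\<^sup>2))" (is ?sin)
proof -
  define z where "z = complex_of_real r * cis t"
  have geo: "(\<lambda>k. z ^ k) sums (1 / (1 - z))"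
    using assms by (intro geometric_sums) (simp add: z_def norm_mult)
  have zk: "z ^ k = complex_of_real (r ^ k) * cis (real k * t)" for k
    by (simp add: z_def power_mult_distrib Complex.DeMoivre)
  have "Re (z ^ k) = r ^ k * cos (real k * t)" "Im (z ^ k) = r ^ k * sin (real k * t)" for k
    by (simp_all add: zk del: of_real_power)
  note zk = this
  have "(\<lambda>k. Re (z ^ k)) sums Re (1 / (1 - z))" "(\<lambda>k. Im (z ^ k)) sums Im (1 / (1 - z))"
    using sums_Re[OF geo] sums_Im[OF geo] by blast+
  moreover have "(Re (1 - z))\<^sup>2 + (Im (1 - z))\<^sup>2 = 1 - 2 * r * cos t + r\<^sup>2"
    using sin_cos_squared_add[of t] by (simp add: z_def power2_eq_square algebra_simps flip: distrib_left)
  ultimately show ?cos ?sin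
    unfolding zk by (simp_all add: Re_divide Im_divide z_def)
qed

lemma poisson_denominator_pos:
  fixes r t :: real
  assumes "0 \<le> r" "r < 1"
  shows "1 - 2 * r * cos t + r\<^sup>2 > 0"
proof -
  have "2 * r * cos t \<le> 2 * r" using assms cos_le_one[of t] by (simp add: mult_left_le)
  moreover have "(1 - r)\<^sup>2 > 0" using assms by simp
  ultimately show ?thesis by (simp add: power2_eq_square algebra_simps)
qed

text \<open>The odd Poisson kernel, in closed form, has the sign of \<open>sin x sin y\<close>.\<close>

lemma odd_poisson_kernel:
  fixes r x y :: real
  assumes "0 \<le> r" "r < 1"
  obtains c where "c \<ge> 0" "(\<lambda>k. r ^ k * (sin (real k * x) * sin (real k * y))) sums (c * (sin x * sin y))"
proof -
  define D where "D = (\<lambda>t. 1 - 2 * r * cos t + r\<^sup>2)"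
  have D: "D t > 0" for t unfolding D_def by (rule poisson_denominator_pos[OF assms])
  define C where "C = (\<lambda>t. (1 - r * cos t) / D t)"
  have "(\<lambda>k. (r ^ k * cos (real k * (x - y)) - r ^ k * cos (real k * (x + y))) / 2)
      sums ((C (x - y) - C (x + y)) / 2)"
    unfolding C_def D_def by (intro sums_divide sums_diff geometric_sums_cis assms)
  moreover have "(r ^ k * cos (real k * (x - y)) - r ^ k * cos (real k * (x + y))) / 2 =
      r ^ k * (sin (real k * x) * sin (real k * y))" for k
    by (simp add: sin_times_sin algebra_simps diff_divide_distrib)
  moreover have "(C (x - y) - C (x + y)) / 2 = r * (1 - r\<^sup>2) / (D (x - y) * D (x + y)) * (sin x * sin y)"
  proof -
    have "C (x - y) - C (x + y) = ((1 - r * cos (x - y)) * D (x + y) - (1 - r * cos (x + y)) * D (x - y)) / (D (x - y) * D (x + y))"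
      using D[of "x - y"] D[of "x + y"] by (simp add: C_def diff_frac_eq)
    also have "(1 - r * cos (x - y)) * D (x + y) - (1 - r * cos (x + y)) * D (x - y) =
        r * (1 - r\<^sup>2) * (cos (x - y) - cos (x + y))"
      by (simp add: D_def power2_eq_square algebra_simps)
    also have "cos (x - y) - cos (x + y) = 2 * (sin x * sin y)" by (simp add: cos_add cos_diff)
    finally show ?thesis by simp
  qed
  moreover have "r * (1 - r\<^sup>2) / (D (x - y) * D (x + y)) \<ge> 0"
    using assms D[of "x - y"] D[of "x + y"] by (intro divide_nonneg_pos mult_nonneg_nonneg) (auto simp: power_le_one)
  ultimately show thesis using that by simp
qed

text \<open>The harmonic extension with sine coefficients \<open>b\<close> is nonnegative on the upper half disc.\<close>

definition poisson_nonneg :: "(nat \<Rightarrow> real) \<Rightarrow> bool" where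
  "poisson_nonneg b \<longleftrightarrow> (\<forall>r x. 0 \<le> r \<and> r < 1 \<and> 0 \<le> x \<and> x \<le> pi \<longrightarrow>
     (\<Sum>k. b k * sin (real k * x) * r ^ k) \<ge> 0)"

text \<open>The harmonic extension is the integral of \<open>f\<close> against the odd Poisson kernel, and as functions of \<open>y\<close>
  both factors have the sign of \<open>sin y\<close>.\<close>

lemma sine_coeff_poisson_nonneg:
  assumes f: "odd_L2 f" and pos: "\<And>y. 0 < y \<Longrightarrow> y < pi \<Longrightarrow> f y \<ge> 0"
  shows "poisson_nonneg (sine_coeff f)"
  unfolding poisson_nonneg_def
proof (intro allI impI)
  fix r x :: real assume rx: "0 \<le> r \<and> r < 1 \<and> 0 \<le> x \<and> x \<le> pi"
  have L: "L2_circle f" and o: "\<And>x. f (- x) = - f x" using f by (auto simp: odd_L2_def)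
  define P where "P = (\<lambda>N y. \<Sum>k<N. r ^ k * (sin (real k * x) * sin (real k * y)))"
  have "\<exists>K. (\<lambda>k. r ^ k * (sin (real k * x) * sin (real k * y))) sums K \<and> (sin y \<ge> 0 \<longrightarrow> K \<ge> 0) \<and> (sin y \<le> 0 \<longrightarrow> K \<le> 0)" for y
  proof -
    obtain c where c: "c \<ge> 0" "(\<lambda>k. r ^ k * (sin (real k * x) * sin (real k * y))) sums (c * (sin x * sin y))"
      using odd_poisson_kernel[of r x y] rx by blast
    have "sin x \<ge> 0" using rx by (simp add: sin_ge_zero)
    then show ?thesis using c by (auto simp: mult_nonneg_nonpos intro!: mult_nonneg_nonpos)
  qed
  then obtain K where K: "\<And>y. (\<lambda>k. r ^ k * (sin (real k * x) * sin (real k * y))) sums K y"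
    "\<And>y. sin y \<ge> 0 \<Longrightarrow> K y \<ge> 0" "\<And>y. sin y \<le> 0 \<Longrightarrow> K y \<le> 0"
    by metis

  have intP: "((\<lambda>y. f y * P N y) has_integral pi * (\<Sum>k<N. sine_coeff f k * sin (real k * x) * r ^ k)) {-pi..pi}" for N
  proof -
    have "((\<lambda>y. \<Sum>k<N. r ^ k * sin (real k * x) * (f y * sin (real k * y))) has_integral
       (\<Sum>k<N. r ^ k * sin (real k * x) * (pi * sine_coeff f k))) {-pi..pi}"
      by (intro has_integral_sum has_integral_mult_right sine_coeff_has_integral L) auto
    then show ?thesis by (simp add: P_def sum_distrib_left mult_ac)
  qed
  have bound: "\<bar>P N y\<bar> \<le> 1 / (1 - r)" for N y
  proof -
    have "\<bar>P N y\<bar> \<le> (\<Sum>k<N. \<bar>r ^ k * (sin (real k * x) * sin (real k * y))\<bar>)" unfolding P_def by (rule sum_abs)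
    also have "\<dots> \<le> (\<Sum>k<N. r ^ k)"
    proof (intro sum_mono)
      fix k
      have "\<bar>r ^ k * (sin (real k * x) * sin (real k * y))\<bar> \<le> \<bar>r ^ k\<bar>"
        using order_trans[OF sine_term_bound[of "r ^ k * sin (real k * x)" "real k * y"] sine_term_bound[of "r ^ k" "real k * x"]]
        by (simp add: mult.assoc)
      then show "\<bar>r ^ k * (sin (real k * x) * sin (real k * y))\<bar> \<le> r ^ k" using rx by simp
    qed
    also have "\<dots> \<le> (\<Sum>k. r ^ k)" by (rule sum_le_suminf) (use rx in \<open>auto intro: summable_geometric\<close>)
    also have "\<dots> = 1 / (1 - r)" by (rule suminf_geometric) (use rx in auto)
    finally show ?thesis .
  qed
  have "(\<lambda>N. P N y) \<longlonglongrightarrow> K y" for y using K(1)[of y] by (simp add: P_def sums_def)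
  note fK = bounded_convergence_weighted[OF L2_circle_integrable[OF L] intP bound this]
  have "f y * K y \<ge> 0" if "y \<in> {-pi..pi}" for y
  proof -
    consider "0 < y" "y < pi" | "-pi < y" "y < 0" | "y = 0" | "y = pi" | "y = -pi"
      using \<open>y \<in> {-pi..pi}\<close> by fastforce
    then show ?thesis
    proof cases
      case 1
      then show ?thesis using pos[of y] K(2)[of y] by (simp add: sin_ge_zero)
    next
      case 2
      then have "f y \<le> 0" "K y \<le> 0" using pos[of "-y"] o[of y] K(3)[of y] sin_ge_zero[of "-y"] by auto
      then show ?thesis by (simp add: mult_nonpos_nonpos)
    qed (use K(2)[of y] K(3)[of y] in auto)
  qed
  then have "integral {-pi..pi} (\<lambda>y. f y * K y) \<ge> 0"
    using fK(1) by (intro integral_nonneg) auto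
  moreover have "(\<lambda>N. \<Sum>k<N. sine_coeff f k * sin (real k * x) * r ^ k) \<longlonglongrightarrow> integral {-pi..pi} (\<lambda>y. f y * K y) / pi"
    using tendsto_divide[OF fK(2) tendsto_const[of pi]] by simp
  ultimately show "(\<Sum>k. sine_coeff f k * sin (real k * x) * r ^ k) \<ge> 0"
    by (simp add: sums_def[symmetric] sums_iff)
qed

lemma bounded_power_series_summable:
  fixes c :: "nat \<Rightarrow> real"
  assumes "\<And>k. \<bar>c k\<bar> \<le> B" "\<bar>r\<bar> < 1"
  shows "summable (\<lambda>k. c k * r ^ k)"
proof (rule summable_comparison_test')
  show "summable (\<lambda>k. B * \<bar>r\<bar> ^ k)" using assms by (intro summable_mult summable_geometric) auto
  show "norm (c k * r ^ k) \<le> B * \<bar>r\<bar> ^ k" for k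
    using assms(1)[of k] by (simp add: abs_mult power_abs mult_right_mono)
qed

text \<open>Integration along a ray: the function
  \<open>\<rho>\<^sup>a \<Sum> b\<^sub>k \<rho>\<^sup>k sin (k x) / (k + a)\<close> vanishes at \<open>0\<close>, because \<open>a > -1\<close> and the sum starts at \<open>k = 1\<close>, and its derivative
  is \<open>\<rho>\<^bsup>a - 1\<^esup>\<close> times the nonnegative Poisson sum of \<open>b\<close>.\<close>

lemma poisson_nonneg_divide:
  fixes a :: real
  assumes b: "poisson_nonneg b" "\<And>k. \<bar>b k\<bar> \<le> B" "b 0 = 0" and a: "a > -1"
  shows "poisson_nonneg (\<lambda>k. b k / (real k + a))"
  unfolding poisson_nonneg_def
proof (intro allI impI)
  fix r x :: real assume rx: "0 \<le> r \<and> r < 1 \<and> 0 \<le> x \<and> x \<le> pi"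
  \<comment> \<open>With \<open>k = j + 1\<close> the series starts at the power \<open>\<rho>\<^bsup>a + 1\<^esup>\<close>, which has a positive exponent.\<close>
  define s where "s = (\<lambda>j. b (Suc j) * sin (real (Suc j) * x))"
  define c where "c = (\<lambda>j. s j / (real j + 1 + a))"
  have B0: "B \<ge> 0" using b(2)[of 0] by linarith
  have sB: "\<bar>s j\<bar> \<le> B" for j
    using b(2)[of "Suc j"] sine_term_bound[of "b (Suc j)" "real (Suc j) * x"] unfolding s_def by linarith
  have cB: "\<bar>c j\<bar> \<le> B / (1 + a)" for j
    unfolding c_def abs_divide using a sB[of j] B0 by (intro frac_le) auto
  define H where "H = (\<lambda>\<rho>. \<Sum>j. c j * \<rho> ^ j)"
  define G where "G = (\<lambda>\<rho>. \<rho> powr (a + 1) * H \<rho>)"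
  have DH: "(H has_real_derivative (\<Sum>j. diffs c j * \<rho> ^ j)) (at \<rho>)" if "\<bar>\<rho>\<bar> < 1" for \<rho>
  proof -
    obtain K where K: "\<bar>\<rho>\<bar> < K" "K < 1" using dense[OF \<open>\<bar>\<rho>\<bar> < 1\<close>] by blast
    then show ?thesis unfolding H_def
      by (intro termdiffs_strong[where K = K] bounded_power_series_summable[OF cB]) auto
  qed
  have Hs: "summable (\<lambda>j. c j * \<rho> ^ j)" if "\<bar>\<rho>\<bar> < 1" for \<rho>
    using bounded_power_series_summable[OF cB that] .
  have deriv: "\<exists>y. (G has_real_derivative y) (at \<rho>) \<and> y \<ge> 0" if \<rho>: "0 < \<rho>" "\<rho> < r" for \<rho>
  proof -
    have \<rho>1: "\<bar>\<rho>\<bar> < 1" using \<rho> rx by auto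
    have D: "(G has_real_derivative ((a + 1) * \<rho> powr a * H \<rho> + \<rho> powr (a + 1) * (\<Sum>j. diffs c j * \<rho> ^ j))) (at \<rho>)"
      unfolding G_def using \<rho> DH[OF \<rho>1] by (auto intro!: derivative_eq_intros)
    have "\<rho> < 1" using \<rho> rx by linarith
    then obtain K where K: "\<rho> < K" "K < 1" using dense by blast
    have "summable (\<lambda>j. diffs c j * \<rho> ^ j)"
      using K \<rho> by (intro termdiff_converges[of \<rho> 1] Hs) auto
    then have "(\<lambda>j. real j * c j * \<rho> ^ (j - Suc 0)) sums (\<Sum>j. diffs c j * \<rho> ^ j)" by (rule diffs_equiv)
    then have "(\<lambda>j. \<rho> * (real j * c j * \<rho> ^ (j - Suc 0))) sums (\<rho> * (\<Sum>j. diffs c j * \<rho> ^ j))" by (rule sums_mult)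
    moreover have "\<rho> * (real j * c j * \<rho> ^ (j - Suc 0)) = real j * (c j * \<rho> ^ j)" for j by (cases j) auto
    ultimately have 1: "(\<lambda>j. real j * (c j * \<rho> ^ j)) sums (\<rho> * (\<Sum>j. diffs c j * \<rho> ^ j))" by simp
    have 2: "(\<lambda>j. (a + 1) * (c j * \<rho> ^ j)) sums ((a + 1) * H \<rho>)"
      unfolding H_def by (intro sums_mult summable_sums Hs \<rho>1)
    have "(\<lambda>j. (a + 1) * (c j * \<rho> ^ j) + real j * (c j * \<rho> ^ j)) sums ((a + 1) * H \<rho> + \<rho> * (\<Sum>j. diffs c j * \<rho> ^ j))"
      by (rule sums_add[OF 2 1])
    moreover have "(a + 1) * (c j * \<rho> ^ j) + real j * (c j * \<rho> ^ j) = s j * \<rho> ^ j" for j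
    proof -
      have "real j + 1 + a \<noteq> 0" using a by linarith
      then have "(a + 1 + real j) * c j = s j" by (simp add: c_def field_simps)
      then show ?thesis by (metis distrib_right mult.assoc)
    qed
    ultimately have 3: "(\<lambda>j. s j * \<rho> ^ j) sums ((a + 1) * H \<rho> + \<rho> * (\<Sum>j. diffs c j * \<rho> ^ j))" by simp
    then have "(\<lambda>j. s j * \<rho> ^ j * \<rho>) sums (((a + 1) * H \<rho> + \<rho> * (\<Sum>j. diffs c j * \<rho> ^ j)) * \<rho>)" by (rule sums_mult2)
    then have "(\<lambda>j. b (Suc j) * sin (real (Suc j) * x) * \<rho> ^ Suc j) sums (((a + 1) * H \<rho> + \<rho> * (\<Sum>j. diffs c j * \<rho> ^ j)) * \<rho>)"
      by (simp add: s_def mult_ac)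
    then have "(\<lambda>j. b j * sin (real j * x) * \<rho> ^ j) sums (((a + 1) * H \<rho> + \<rho> * (\<Sum>j. diffs c j * \<rho> ^ j)) * \<rho>)"
      by (subst (asm) sums_Suc_iff) (simp add: b(3))
    moreover have "(\<Sum>k. b k * sin (real k * x) * \<rho> ^ k) \<ge> 0"
      using b(1) rx \<rho> unfolding poisson_nonneg_def by auto
    ultimately have "((a + 1) * H \<rho> + \<rho> * (\<Sum>j. diffs c j * \<rho> ^ j)) * \<rho> \<ge> 0" by (simp add: sums_iff)
    then have "(a + 1) * H \<rho> + \<rho> * (\<Sum>j. diffs c j * \<rho> ^ j) \<ge> 0" using \<rho> by (simp add: zero_le_mult_iff)
    then have "\<rho> powr a * ((a + 1) * H \<rho> + \<rho> * (\<Sum>j. diffs c j * \<rho> ^ j)) \<ge> 0" by simp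
    also have "\<rho> powr a * ((a + 1) * H \<rho> + \<rho> * (\<Sum>j. diffs c j * \<rho> ^ j)) =
       (a + 1) * \<rho> powr a * H \<rho> + \<rho> powr (a + 1) * (\<Sum>j. diffs c j * \<rho> ^ j)"
      using \<rho> by (simp add: powr_add algebra_simps)
    finally show ?thesis using D by blast
  qed
  have "G 0 \<le> G r"
  proof (rule DERIV_nonneg_imp_increasing_open[of 0 r G])
    show "continuous_on {0..r} G"
      unfolding G_def
    proof (intro continuous_on_mult continuous_on_powr')
      show "continuous_on {0..r} H"
        by (intro continuous_at_imp_continuous_on ballI DERIV_isCont[OF DH]) (use rx in auto)
    qed (use a in \<open>auto intro: continuous_intros\<close>)
  qed (use rx deriv in auto)
  then have Gr: "r powr (a + 1) * H r \<ge> 0" by (simp add: G_def)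
  have "r * H r \<ge> 0"
  proof (cases "r = 0")
    case False
    then have "r powr (a + 1) > 0" by simp
    then have "H r \<ge> 0" using Gr by (simp add: zero_le_mult_iff)
    then show ?thesis using rx by simp
  qed simp
  moreover have "(\<lambda>j. c j * r ^ j * r) sums (H r * r)"
    unfolding H_def using rx by (intro sums_mult2 summable_sums Hs) auto
  then have "(\<lambda>j. b (Suc j) / (real (Suc j) + a) * sin (real (Suc j) * x) * r ^ Suc j) sums (H r * r)"
    by (simp add: c_def s_def field_simps)
  then have "(\<lambda>j. b j / (real j + a) * sin (real j * x) * r ^ j) sums (H r * r)"
    by (subst (asm) sums_Suc_iff) (simp add: b(3))
  ultimately show "(\<Sum>k. b k / (real k + a) * sin (real k * x) * r ^ k) \<ge> 0"
    by (simp add: sums_iff mult.commute)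
qed

text \<open>The symbol of \<open>- S\<^sub>n\<close>; the sign makes it positive.\<close>

definition Sn_symbol :: "nat \<Rightarrow> nat \<Rightarrow> real" where
  "Sn_symbol n k = 1 / real k * (((real n)\<^sup>2 * (real k)\<^sup>2 - 1) / ((real n)\<^sup>2 * (real k)\<^sup>2 - 4))"

lemma nk_square_ge:
  assumes "n \<ge> 3" "k \<noteq> 0"
  shows "(real n)\<^sup>2 * (real k)\<^sup>2 \<ge> 9 * (real k)\<^sup>2" "(real n)\<^sup>2 * (real k)\<^sup>2 \<ge> 9"
proof -
  have "(real n)\<^sup>2 \<ge> 3\<^sup>2" using assms by (intro power_mono) auto
  then show 1: "(real n)\<^sup>2 * (real k)\<^sup>2 \<ge> 9 * (real k)\<^sup>2" by (intro mult_right_mono) auto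
  have "(real k)\<^sup>2 \<ge> 1" using assms by (intro one_le_power) auto
  then show "(real n)\<^sup>2 * (real k)\<^sup>2 \<ge> 9" using 1 by linarith
qed

lemma Sn_symbol_bound:
  assumes "n \<ge> 3" shows "symbol_bound (Sn_symbol n)"
  unfolding symbol_bound_def
proof
  fix k show "\<bar>Sn_symbol n k\<bar> \<le> 2 / real k"
  proof (cases "k = 0")
    case False
    note ge = nk_square_ge[OF assms False]
    have "(q - 1) / (q - 4) \<le> 2" if "q \<ge> 9" for q :: real
      using that by (simp add: pos_divide_le_eq)
    from this[OF ge(2)] have "((real n)\<^sup>2 * (real k)\<^sup>2 - 1) / ((real n)\<^sup>2 * (real k)\<^sup>2 - 4) \<le> 2" .
    then have "1 / real k * (((real n)\<^sup>2 * (real k)\<^sup>2 - 1) / ((real n)\<^sup>2 * (real k)\<^sup>2 - 4)) \<le> 1 / real k * 2"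
      by (rule mult_left_mono) simp
    moreover have "((real n)\<^sup>2 * (real k)\<^sup>2 - 1) / ((real n)\<^sup>2 * (real k)\<^sup>2 - 4) \<ge> 0" using ge by simp
    then have "1 / real k * (((real n)\<^sup>2 * (real k)\<^sup>2 - 1) / ((real n)\<^sup>2 * (real k)\<^sup>2 - 4)) \<ge> 0"
      by (rule mult_nonneg_nonneg[rotated]) simp
    ultimately show ?thesis unfolding Sn_symbol_def abs_of_nonneg by linarith
  qed (simp add: Sn_symbol_def)
qed

text \<open>A combination with positive coefficients of products of factors \<open>1 / (k + a)\<close>, where \<open>a\<close> is \<open>0\<close>, \<open>2/n\<close> or
  \<open>- 2/n > -1\<close>.\<close>

lemma Sn_symbol_partial_fractions:
  assumes "n \<ge> 3"
  shows "Sn_symbol n k = 1 / real k + 3 / (real n)\<^sup>2 * (1 / real k / (real k + 2 / real n) / (real k - 2 / real n))"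
proof (cases "k = 0")
  case False
  define N where "N = real n" define K where "K = real k"
  have "N\<^sup>2 * K\<^sup>2 \<ge> 9" using nk_square_ge(2)[OF assms False] by (simp add: N_def K_def)
  then have nz: "N\<^sup>2 * K\<^sup>2 - 4 \<noteq> 0" by simp
  have N: "N \<noteq> 0" "K \<noteq> 0" using assms False by (auto simp: N_def K_def)
  have "(K + 2 / N) * (K - 2 / N) = (N\<^sup>2 * K\<^sup>2 - 4) / N\<^sup>2"
    using N by (simp add: field_simps power2_eq_square)
  then have "1 / K + 3 / N\<^sup>2 * (1 / K / (K + 2 / N) / (K - 2 / N)) = 1 / K + 3 / N\<^sup>2 * (1 / K / ((N\<^sup>2 * K\<^sup>2 - 4) / N\<^sup>2))"
    by (simp add: divide_divide_eq_left)
  also have "\<dots> = 1 / K * ((N\<^sup>2 * K\<^sup>2 - 1) / (N\<^sup>2 * K\<^sup>2 - 4))"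
    using N nz by (simp add: divide_simps)
  finally show ?thesis by (simp add: Sn_symbol_def N_def K_def)
qed (simp add: Sn_symbol_def)

text \<open>By the partial fractions, the Poisson sums of the image are obtained from those of \<open>f\<close> by divisions that preserve
  nonnegativity; then \<open>r\<close> tends to \<open>1\<close>.\<close>

theorem Sn_positive:
  assumes f: "odd_L2 f" and pos: "\<And>y. 0 < y \<Longrightarrow> y < pi \<Longrightarrow> f y \<ge> 0" and n: "n \<ge> 3"
    and x: "0 \<le> x" "x \<le> pi"
  shows "sine_mult (Sn_symbol n) f x \<ge> 0"
proof -
  have L: "L2_circle f" using f by (simp add: odd_L2_def)
  define a where "a = 2 / real n"
  have a: "0 < a" "a < 1" using n by (auto simp: a_def)
  define b where "b = sine_coeff f"
  define B where "B = 1 + (\<Sum>k. (b k)\<^sup>2)"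
  have B: "\<bar>b k\<bar> \<le> B" for k
    using sum_le_suminf[OF sine_coeff_square_summable[OF L], of "{k}"] sum_squares_bound[of "\<bar>b k\<bar>" 1]
    by (simp add: B_def b_def)
  have step: "\<exists>B'. \<forall>k. \<bar>c k / (real k + e)\<bar> \<le> B'" if c: "\<And>k. \<bar>c k\<bar> \<le> C" "c 0 = 0" and e: "e > -1" for c :: "nat \<Rightarrow> real" and C e
  proof (intro exI allI)
    fix k show "\<bar>c k / (real k + e)\<bar> \<le> C / (1 + e)"
    proof (cases "k = 0")
      case False
      then show ?thesis unfolding abs_divide using c(1)[of k] c(1)[of 0] e by (intro frac_le) auto
    qed (use c(1)[of 0] e in \<open>simp add: c(2)\<close>)
  qed
  have b0: "b 0 = 0" by (simp add: b_def)
  have p0: "poisson_nonneg b" unfolding b_def using f pos by (rule sine_coeff_poisson_nonneg)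
  have p1: "poisson_nonneg (\<lambda>k. b k / real k)"
    using poisson_nonneg_divide[OF p0 B b0, of 0] by simp
  obtain B1 where B1: "\<And>k. \<bar>b k / real k\<bar> \<le> B1" using step[of b B 0] B b0 by auto
  have p2: "poisson_nonneg (\<lambda>k. b k / real k / (real k + a))"
    using poisson_nonneg_divide[OF p1 B1, of a] b0 a by simp
  obtain B2 where B2: "\<And>k. \<bar>b k / real k / (real k + a)\<bar> \<le> B2"
    using step[of "\<lambda>k. b k / real k" B1 a] B1 b0 a by auto
  have p3: "poisson_nonneg (\<lambda>k. b k / real k / (real k + a) / (real k - a))"
    using poisson_nonneg_divide[OF p2 B2, of "-a"] b0 a by simp
  obtain B3 where B3: "\<And>k. \<bar>b k / real k / (real k + a) / (real k - a)\<bar> \<le> B3"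
    using step[of "\<lambda>k. b k / real k / (real k + a)" B2 "-a"] B2 b0 a by auto
  define F where "F = (\<lambda>r. sine_mult (\<lambda>k. Sn_symbol n k * r ^ k) f x)"
  have F: "F r \<ge> 0" if r: "0 \<le> r" "r < 1" for r
  proof -
    have s: "summable (\<lambda>k. d k * sin (real k * x) * r ^ k)" if "\<And>k. \<bar>d k\<bar> \<le> D" for d :: "nat \<Rightarrow> real" and D
      using r that sine_term_bound order_trans by (intro bounded_power_series_summable[where B = D]) (blast, auto)
    have "(\<lambda>k. b k / real k * sin (real k * x) * r ^ k + 3 / (real n)\<^sup>2 * (b k / real k / (real k + a) / (real k - a) * sin (real k * x) * r ^ k))
      sums ((\<Sum>k. b k / real k * sin (real k * x) * r ^ k) + 3 / (real n)\<^sup>2 * (\<Sum>k. b k / real k / (real k + a) / (real k - a) * sin (real k * x) * r ^ k))"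
      by (intro sums_add sums_mult summable_sums s[OF B1] s[OF B3])
    moreover have "b k / real k * sin (real k * x) * r ^ k + 3 / (real n)\<^sup>2 * (b k / real k / (real k + a) / (real k - a) * sin (real k * x) * r ^ k)
       = Sn_symbol n k * r ^ k * b k * sin (real k * x)" for k
    proof -
      have "b k / real k + 3 / (real n)\<^sup>2 * (b k / real k / (real k + a) / (real k - a)) = Sn_symbol n k * b k"
        unfolding Sn_symbol_partial_fractions[OF n] a_def by (simp add: distrib_right)
      then have "b k / real k * (sin (real k * x) * r ^ k)
          + 3 / (real n)\<^sup>2 * (b k / real k / (real k + a) / (real k - a)) * (sin (real k * x) * r ^ k)
        = Sn_symbol n k * b k * (sin (real k * x) * r ^ k)" by (simp only: distrib_right[symmetric])
      then show ?thesis by (simp only: mult_ac)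
    qed
    moreover have "(\<Sum>k. b k / real k * sin (real k * x) * r ^ k) \<ge> 0"
      using p1 r x unfolding poisson_nonneg_def by auto
    moreover have "(\<Sum>k. b k / real k / (real k + a) / (real k - a) * sin (real k * x) * r ^ k) \<ge> 0"
      using p3 r x unfolding poisson_nonneg_def by auto
    ultimately show ?thesis unfolding F_def sine_mult_def b_def[symmetric] by (simp add: sums_iff)
  qed
  have "continuous_on {0..1} F"
    unfolding F_def by (rule sine_mult_radial_continuous[OF L Sn_symbol_bound[OF n]])
  then have "(F \<longlongrightarrow> F 1) (at 1 within {0..1})" by (simp add: continuous_on_def)
  moreover have "at (1::real) within {0..1} = at_left 1" by (rule at_within_Icc_at_left) simp
  ultimately have "(F \<longlongrightarrow> F 1) (at_left 1)" by simp
  moreover have "\<forall>\<^sub>F r in at_left 1. 0 \<le> F r"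
    by (rule eventually_at_leftI[of 0]) (auto intro: F)
  ultimately have "F 1 \<ge> 0" by (rule tendsto_lowerbound) (rule trivial_limit_at_left_real)
  moreover have "F 1 = sine_mult (Sn_symbol n) f x" by (simp add: F_def)
  ultimately show ?thesis by simp
qed

section \<open>Odd extensions\<close>

lemma circle_rep_range: "- pi < circle_rep x" "circle_rep x \<le> pi"
proof -
  define c where "c = \<lceil>(x - pi) / (2 * pi)\<rceil>"
  have "of_int c - 1 < (x - pi) / (2 * pi)" "(x - pi) / (2 * pi) \<le> of_int c"
    unfolding c_def by linarith+
  then have "(of_int c - 1) * (2 * pi) < x - pi" "x - pi \<le> of_int c * (2 * pi)"
    by (simp_all add: pos_less_divide_eq pos_divide_le_eq)
  then show "- pi < circle_rep x" "circle_rep x \<le> pi"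
    unfolding circle_rep_def c_def[symmetric] by (simp_all add: algebra_simps)
qed

lemma circle_rep_periodic: "circle_rep (x + 2 * pi) = circle_rep x"
proof -
  have "(x + 2 * pi - pi) / (2 * pi) = (x - pi) / (2 * pi) + 1" by (simp add: field_simps)
  then have "\<lceil>(x + 2 * pi - pi) / (2 * pi)\<rceil> = \<lceil>(x - pi) / (2 * pi)\<rceil> + 1" by simp
  then show ?thesis unfolding circle_rep_def by (simp add: algebra_simps)
qed

lemma circle_rep_id:
  assumes "- pi < x" "x \<le> pi" shows "circle_rep x = x"
proof -
  have "\<lceil>(x - pi) / (2 * pi)\<rceil> = 0"
    using assms by (intro ceiling_unique) (auto simp: field_simps)
  then show ?thesis by (simp add: circle_rep_def)
qed

lemma odd_ext_inside [simp]: "0 < x \<Longrightarrow> x < pi \<Longrightarrow> odd_ext w x = w x"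
  by (simp add: odd_ext_def circle_rep_id)

lemma odd_ext_periodic: "odd_ext w (x + 2 * pi) = odd_ext w x"
  by (simp add: odd_ext_def circle_rep_periodic)

lemma circle_cases:
  fixes x :: real
  obtains r k where "x = r + of_int k * (2 * pi)" "- pi < r" "r \<le> pi"
proof
  show "x = circle_rep x + of_int \<lceil>(x - pi) / (2 * pi)\<rceil> * (2 * pi)" by (simp add: circle_rep_def)
qed (rule circle_rep_range)+

lemma odd_ext_odd: "odd_ext w (- x) = - odd_ext w x"
proof (rule circle_cases[of x])
  fix r k assume x: "x = r + of_int k * (2 * pi)" and r: "- pi < r" "r \<le> pi"
  have 1: "odd_ext w x = odd_ext w r"
    unfolding x by (rule periodic_int) (rule odd_ext_periodic)
  have "- x = - r + of_int (- k) * (2 * pi)" by (simp add: x)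
  then have 2: "odd_ext w (- x) = odd_ext w (- r)"
    using periodic_int[where f = "odd_ext w" and p = "2 * pi", OF odd_ext_periodic] by metis
  show ?thesis
  proof (cases "r = pi")
    case True
    have "odd_ext w (- pi) = odd_ext w pi" using odd_ext_periodic[of w "-pi"] by simp
    moreover have "odd_ext w pi = 0" by (simp add: odd_ext_def circle_rep_id)
    ultimately show ?thesis using 1 2 True by simp
  next
    case False
    then show ?thesis unfolding 1 2 using r by (auto simp: odd_ext_def circle_rep_id Let_def)
  qed
qed

text \<open>An odd periodic function is determined by its values on the open half period, because it
  vanishes at \<open>0\<close> and at \<open>\<pi>\<close>.\<close>

lemma odd_periodic_eqI:
  fixes F G :: "real \<Rightarrow> real"
  assumes F: "\<And>x. F (- x) = - F x" "\<And>x. F (x + 2 * pi) = F x"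
    and G: "\<And>x. G (- x) = - G x" "\<And>x. G (x + 2 * pi) = G x"
    and eq: "\<And>x. 0 < x \<Longrightarrow> x < pi \<Longrightarrow> F x = G x"
  shows "F x = G x"
proof (rule circle_cases[of x])
  fix r k assume x: "x = r + of_int k * (2 * pi)" and r: "- pi < r" "r \<le> pi"
  have "F x = F r" "G x = G r"
    unfolding x using F(2) G(2) by (intro periodic_int; blast)+
  moreover have "F 0 = 0" "G 0 = 0" using F(1)[of 0] G(1)[of 0] by auto
  moreover have "F pi = 0" "G pi = 0" using F(1)[of pi] F(2)[of "-pi"] G(1)[of pi] G(2)[of "-pi"] by auto
  moreover have "F r = G r" if "- pi < r" "r < 0"
    using eq[of "-r"] F(1)[of r] G(1)[of r] that by auto
  ultimately show "F x = G x"
    using eq[of r] r by (cases r "0::real" rule: linorder_cases; cases "r = pi") auto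
qed

lemma odd_ext_unique:
  assumes "\<And>x. F (- x) = - F x" "\<And>x. F (x + 2 * pi) = F x" "\<And>x. 0 < x \<Longrightarrow> x < pi \<Longrightarrow> F x = w x"
  shows "F = odd_ext w"
proof
  fix x show "F x = odd_ext w x"
    by (rule odd_periodic_eqI) (simp_all add: assms odd_ext_odd odd_ext_periodic)
qed

lemma circle_rep_measurable: "circle_rep \<in> borel_measurable borel"
  unfolding circle_rep_def by measurable

lemma odd_L2_odd_ext:
  assumes m: "(\<lambda>x. indicator {0<..<pi} x *\<^sub>R w x) \<in> borel_measurable borel"
    and B: "\<And>x. 0 < x \<Longrightarrow> x < pi \<Longrightarrow> \<bar>w x\<bar> \<le> B"
  shows "odd_L2 (odd_ext w)"
proof -
  define g where "g = (\<lambda>x. indicator {0<..<pi} x *\<^sub>R w x)"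
  have eq: "odd_ext w = (\<lambda>x. g (circle_rep x) - g (- circle_rep x))"
  proof
    fix x show "odd_ext w x = g (circle_rep x) - g (- circle_rep x)"
      using circle_rep_range[of x] by (auto simp: odd_ext_def Let_def g_def indicator_def)
  qed
  have g: "g \<in> borel_measurable borel" using m by (simp add: g_def)
  have meas: "odd_ext w \<in> borel_measurable borel"
    unfolding eq by (intro borel_measurable_diff measurable_compose[OF _ g] circle_rep_measurable
      borel_measurable_uminus)
  then have meas': "odd_ext w \<in> borel_measurable lebesgue" by (simp add: measurable_completion)
  have "B \<ge> 0" using B[of 1] pi_gt3 by auto
  then have bd: "\<bar>odd_ext w x\<bar> \<le> B" for x
    using B circle_rep_range[of x] by (auto simp: odd_ext_def Let_def)
  have "set_integrable lebesgue {-pi..pi} (\<lambda>x. (odd_ext w x)\<^sup>2)"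
  proof (rule measurable_bounded_by_integrable_imp_absolutely_integrable[where g = "\<lambda>_. B\<^sup>2"])
    show "(\<lambda>x. (odd_ext w x)\<^sup>2) \<in> borel_measurable (lebesgue_on {-pi..pi})"
      by (intro measurable_lebesgue_on borel_measurable_power meas')
    show "norm ((odd_ext w x)\<^sup>2) \<le> B\<^sup>2" for x
      using power_mono[OF bd[of x], of 2] by simp
  qed auto
  then show ?thesis
    using meas' odd_ext_periodic odd_ext_odd by (auto simp: odd_L2_def L2_circle_def)
qed

lemma odd_L2_odd_ext_continuous:
  assumes "continuous_on {0..pi} w"
  shows "odd_L2 (odd_ext w)"
proof -
  obtain B where B: "\<And>x. x \<in> {0..pi} \<Longrightarrow> \<bar>w x\<bar> \<le> B"
    using continuous_on_Icc_bounded[OF assms] by blast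
  show ?thesis
  proof (rule odd_L2_odd_ext[where B = B])
    show "(\<lambda>x. indicator {0<..<pi} x *\<^sub>R w x) \<in> borel_measurable borel"
      by (rule borel_measurable_continuous_on_indicator[OF _ continuous_on_subset[OF assms]]) auto
  qed (use B in auto)
qed

lemma L2_circle_lincomb:
  assumes "L2_circle f" "L2_circle g"
  shows "L2_circle (\<lambda>x. a * f x + b * g x)"
proof -
  have f: "f \<in> borel_measurable lebesgue" and g: "g \<in> borel_measurable lebesgue"
    using assms by (auto simp: L2_circle_def)
  have "(\<lambda>x. (a * f x + b * g x)\<^sup>2) absolutely_integrable_on {-pi..pi}"
  proof (rule measurable_bounded_by_integrable_imp_absolutely_integrable
      [where g = "\<lambda>x. 2 * a\<^sup>2 * (f x)\<^sup>2 + 2 * b\<^sup>2 * (g x)\<^sup>2"])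
    show "(\<lambda>x. (a * f x + b * g x)\<^sup>2) \<in> borel_measurable (lebesgue_on {-pi..pi})"
      using f g by (intro measurable_lebesgue_on borel_measurable_power borel_measurable_add
          borel_measurable_times borel_measurable_const)
    show "(\<lambda>x. 2 * a\<^sup>2 * (f x)\<^sup>2 + 2 * b\<^sup>2 * (g x)\<^sup>2) integrable_on {-pi..pi}"
      by (intro integrable_add integrable_on_mult_right L2_circle_square_integrable assms)
    have "(a * f x + b * g x)\<^sup>2 \<le> 2 * a\<^sup>2 * (f x)\<^sup>2 + 2 * b\<^sup>2 * (g x)\<^sup>2" for x
      using sum_squares_bound[of "a * f x" "b * g x"] by (simp add: power2_sum power_mult_distrib)
    then show "norm ((a * f x + b * g x)\<^sup>2) \<le> 2 * a\<^sup>2 * (f x)\<^sup>2 + 2 * b\<^sup>2 * (g x)\<^sup>2" for x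
      by (simp only: real_norm_def abs_power2)
  qed auto
  then show ?thesis using assms f g by (auto simp: L2_circle_def)
qed

lemma odd_L2_lincomb:
  "odd_L2 f \<Longrightarrow> odd_L2 g \<Longrightarrow> odd_L2 (\<lambda>x. a * f x + b * g x)"
  unfolding odd_L2_def by (auto intro: L2_circle_lincomb)

section \<open>The operator on the half period\<close>

text \<open>The operator \<open>- S\<^sub>n\<close> on functions on the half period.\<close>

definition half_op :: "nat \<Rightarrow> (real \<Rightarrow> real) \<Rightarrow> real \<Rightarrow> real" where
  "half_op n w = sine_mult (Sn_symbol n) (odd_ext w)"

lemma symbol_bound_uminus: "symbol_bound m \<Longrightarrow> symbol_bound (\<lambda>k. - m k)"
  by (simp add: symbol_bound_def)

lemma Sn_op_odd:
  assumes "odd_L2 f" "n \<ge> 3"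
  shows "Sn_op n f x = - sine_mult (Sn_symbol n) f x"
proof -
  have "Sn_op n f = sine_mult (\<lambda>k. - Sn_symbol n k) f"
    unfolding Sn_op_def
    by (rule fourier_multiplier_odd[OF assms(1) symbol_bound_uminus[OF Sn_symbol_bound[OF assms(2)]]])
      (auto simp: Sn_symbol_def of_nat_nat)
  moreover have "sine_mult (\<lambda>k. - Sn_symbol n k) f x = - sine_mult (Sn_symbol n) f x"
    unfolding sine_mult_def using assms
    by (subst suminf_minus[symmetric]) (auto intro!: sine_mult_summable Sn_symbol_bound simp: odd_L2_def)
  ultimately show ?thesis by simp
qed

lemma half_op_mono:
  assumes n: "n \<ge> 3" and L: "odd_L2 (odd_ext w1)" "odd_L2 (odd_ext w2)"
    and le: "\<And>y. 0 < y \<Longrightarrow> y < pi \<Longrightarrow> w1 y \<le> w2 y" and x: "0 \<le> x" "x \<le> pi"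
  shows "half_op n w1 x \<le> half_op n w2 x"
proof -
  have "sine_mult (Sn_symbol n) (\<lambda>x. 1 * odd_ext w2 x + (-1) * odd_ext w1 x) x \<ge> 0"
    by (rule Sn_positive[OF odd_L2_lincomb[OF L(2,1)] _ n x]) (use le in auto)
  then show ?thesis
    using L n by (subst (asm) sine_mult_linear) (auto simp: odd_L2_def half_op_def Sn_symbol_bound)
qed

lemma half_op_sup_bound:
  "\<exists>C\<ge>1. \<forall>n w B x. n \<ge> 3 \<longrightarrow> odd_L2 (odd_ext w) \<longrightarrow> (\<forall>y. 0 < y \<and> y < pi \<longrightarrow> \<bar>w y\<bar> \<le> B) \<longrightarrow>
     \<bar>half_op n w x\<bar> \<le> C * B"
proof -
  obtain C where C: "C > 0" "\<And>f m x. L2_circle f \<Longrightarrow> symbol_bound m \<Longrightarrow>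
     \<bar>sine_mult m f x\<bar> \<le> C * sqrt (integral {-pi..pi} (\<lambda>x. (f x)\<^sup>2))"
    using sine_mult_L2_bound by blast
  have "\<bar>half_op n w x\<bar> \<le> max 1 (C * sqrt (2 * pi)) * B"
    if n: "n \<ge> 3" and L: "odd_L2 (odd_ext w)" and B: "\<forall>y. 0 < y \<and> y < pi \<longrightarrow> \<bar>w y\<bar> \<le> B" for n w B x
  proof -
    have B0: "B \<ge> 0" using B[rule_format, of 1] pi_gt3 by auto
    then have bd: "\<bar>odd_ext w x\<bar> \<le> B" for x
      using B circle_rep_range[of x] by (auto simp: odd_ext_def Let_def)
    have L': "L2_circle (odd_ext w)" using L by (simp add: odd_L2_def)
    have "integral {-pi..pi} (\<lambda>x. (odd_ext w x)\<^sup>2) \<le> integral {-pi..pi} (\<lambda>x. B\<^sup>2)"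
      using bd by (intro integral_le L2_circle_square_integrable[OF L']) (auto intro!: power2_le_iff_abs_le[THEN iffD2] B0)
    also have "\<dots> = 2 * pi * B\<^sup>2" by simp
    finally have "sqrt (integral {-pi..pi} (\<lambda>x. (odd_ext w x)\<^sup>2)) \<le> sqrt (2 * pi * B\<^sup>2)"
      by (rule real_sqrt_le_mono)
    also have "\<dots> = sqrt (2 * pi) * B" using B0 by (simp add: real_sqrt_mult)
    finally have "sqrt (integral {-pi..pi} (\<lambda>x. (odd_ext w x)\<^sup>2)) \<le> sqrt (2 * pi) * B" .
    then have "C * sqrt (integral {-pi..pi} (\<lambda>x. (odd_ext w x)\<^sup>2)) \<le> C * (sqrt (2 * pi) * B)"
      using C(1) by (intro mult_left_mono) auto
    also have "\<dots> \<le> max 1 (C * sqrt (2 * pi)) * B"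
      unfolding mult.assoc[symmetric] by (intro mult_right_mono B0) simp
    finally show ?thesis
      using C(2)[OF L' Sn_symbol_bound[OF n], of x] by (simp add: half_op_def)
  qed
  then show ?thesis by (intro exI[of _ "max 1 (C * sqrt (2 * pi))"]) auto
qed

lemma half_op_continuous:
  assumes "n \<ge> 3" "odd_L2 (odd_ext w)" shows "continuous_on S (half_op n w)"
  unfolding half_op_def using assms
  by (intro continuous_on_subset[OF sine_mult_continuous]) (auto simp: odd_L2_def Sn_symbol_bound)

text \<open>Bounded pointwise convergence implies convergence in mean square, which the operator turns into
  pointwise convergence.\<close>

lemma half_op_LIMSEQ:
  assumes n: "n \<ge> 3" and Lj: "\<And>j. odd_L2 (odd_ext (w j))" and L: "odd_L2 (odd_ext v)"
    and B: "\<And>j y. 0 < y \<Longrightarrow> y < pi \<Longrightarrow> \<bar>w j y\<bar> \<le> B"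
    and lim: "\<And>y. 0 < y \<Longrightarrow> y < pi \<Longrightarrow> (\<lambda>j. w j y) \<longlonglongrightarrow> v y"
  shows "(\<lambda>j. half_op n (w j) x) \<longlonglongrightarrow> half_op n v x"
proof -
  obtain C where C: "C > 0" "\<And>f m x. L2_circle f \<Longrightarrow> symbol_bound m \<Longrightarrow>
     \<bar>sine_mult m f x\<bar> \<le> C * sqrt (integral {-pi..pi} (\<lambda>x. (f x)\<^sup>2))"
    using sine_mult_L2_bound by blast
  define d where "d = (\<lambda>j x. 1 * odd_ext (w j) x + (-1) * odd_ext v x)"
  have Ld: "L2_circle (d j)" for j
    unfolding d_def using Lj L by (intro L2_circle_lincomb) (auto simp: odd_L2_def)
  have B0: "B \<ge> 0" using B[of 1 0] pi_gt3 by auto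
  have vB: "\<bar>v y\<bar> \<le> B" if "0 < y" "y < pi" for y
    by (rule tendsto_upperbound[OF tendsto_rabs[OF lim]]) (use that B in auto)
  have dB: "\<bar>d j x\<bar> \<le> 2 * B" for j x
  proof -
    have "\<bar>odd_ext (w j) x\<bar> \<le> B" "\<bar>odd_ext v x\<bar> \<le> B"
      using B vB B0 circle_rep_range[of x] by (auto simp: odd_ext_def Let_def)
    then show ?thesis by (simp add: d_def)
  qed
  have ext_lim: "(\<lambda>j. odd_ext (w j) x) \<longlonglongrightarrow> odd_ext v x" for x
    using lim circle_rep_range[of x] by (auto simp: odd_ext_def Let_def intro!: tendsto_minus)
  have "(\<lambda>j. integral {-pi..pi} (\<lambda>x. (d j x)\<^sup>2)) \<longlonglongrightarrow> integral {-pi..pi} (\<lambda>x. 0)"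
  proof (rule dominated_convergence[where h = "\<lambda>_. (2 * B)\<^sup>2"])
    show "(\<lambda>x. (d j x)\<^sup>2) integrable_on {-pi..pi}" for j by (rule L2_circle_square_integrable[OF Ld])
    show "norm ((d j x)\<^sup>2) \<le> (2 * B)\<^sup>2" for j x
      using power_mono[OF dB, of j x 2] by simp
    show "(\<lambda>j. (d j x)\<^sup>2) \<longlonglongrightarrow> 0" for x
    proof -
      have "(\<lambda>j. (d j x)\<^sup>2) \<longlonglongrightarrow> (1 * odd_ext v x + (-1) * odd_ext v x)\<^sup>2"
        unfolding d_def by (intro tendsto_intros ext_lim)
      then show ?thesis by simp
    qed
  qed auto
  then have "(\<lambda>j. integral {-pi..pi} (\<lambda>x. (d j x)\<^sup>2)) \<longlonglongrightarrow> 0" by simp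
  then have "(\<lambda>j. sqrt (integral {-pi..pi} (\<lambda>x. (d j x)\<^sup>2))) \<longlonglongrightarrow> sqrt 0" by (rule tendsto_real_sqrt)
  then have lim0: "(\<lambda>j. C * sqrt (integral {-pi..pi} (\<lambda>x. (d j x)\<^sup>2))) \<longlonglongrightarrow> 0"
    by (intro tendsto_mult_right_zero) simp
  have le0: "norm (half_op n (w j) x - half_op n v x) \<le> C * sqrt (integral {-pi..pi} (\<lambda>x. (d j x)\<^sup>2))" for j
  proof -
    have "sine_mult (Sn_symbol n) (d j) x = half_op n (w j) x - half_op n v x"
      unfolding d_def using Lj L n
      by (subst sine_mult_linear) (auto simp: odd_L2_def half_op_def Sn_symbol_bound)
    then show ?thesis using C(2)[OF Ld Sn_symbol_bound[OF n], of j x] by simp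
  qed
  have "(\<lambda>j. half_op n (w j) x - half_op n v x) \<longlonglongrightarrow> 0"
    by (rule Lim_null_comparison[OF always_eventually lim0]) (use le0 in blast)
  then show ?thesis by (rule LIM_zero_cancel)
qed

text \<open>The sine is an eigenfunction with eigenvalue \<open>(n\<^sup>2 - 1) / (n\<^sup>2 - 4) > 1\<close>.\<close>

lemma half_op_sin:
  assumes n: "n \<ge> 3" and x: "0 \<le> x" "x \<le> pi"
  shows "sin x \<le> half_op n sin x"
proof -
  have ext: "odd_ext sin = sin"
    by (rule odd_ext_unique[symmetric]) auto
  have c: "sine_coeff sin k = (if k = 1 then 1 else 0)" for k
    using integral_unique[OF sin_orthogonal[of 1 k]] by (simp add: sine_coeff_def)
  have "half_op n sin x = (\<Sum>k. if k = 1 then Sn_symbol n 1 * sin x else 0)"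
    unfolding half_op_def ext sine_mult_def by (intro suminf_cong) (auto simp: c)
  also have "\<dots> = Sn_symbol n 1 * sin x"
    using sums_If_finite_set[of "{1::nat}" "\<lambda>_. Sn_symbol n 1 * sin x"] by (simp add: sums_iff)
  finally have eq: "half_op n sin x = Sn_symbol n 1 * sin x" .
  have "(real n)\<^sup>2 \<ge> 9" using nk_square_ge(2)[OF n, of 1] by simp
  then have "Sn_symbol n 1 \<ge> 1" by (simp add: Sn_symbol_def)
  then show ?thesis unfolding eq using sin_ge_zero[OF x] by (simp add: mult_le_cancel_right1)
qed

text \<open>Self-adjointness, by integrating the uniformly convergent series.\<close>

lemma sine_mult_symmetric:
  assumes f: "L2_circle f" and g: "L2_circle g" and m: "symbol_bound m"
  shows "((\<lambda>x. sine_mult m f x * g x) has_integral pi * (\<Sum>k. m k * sine_coeff f k * sine_coeff g k)) {-pi..pi}"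
proof -
  define P where "P = (\<lambda>N x. \<Sum>k<N. m k * sine_coeff f k * sin (real k * x))"
  define S where "S = (\<Sum>k. \<bar>m k * sine_coeff f k\<bar>)"
  have intP: "((\<lambda>x. g x * P N x) has_integral pi * (\<Sum>k<N. m k * sine_coeff f k * sine_coeff g k)) {-pi..pi}" for N
  proof -
    have "((\<lambda>y. \<Sum>k<N. m k * sine_coeff f k * (g y * sin (real k * y))) has_integral
       (\<Sum>k<N. m k * sine_coeff f k * (pi * sine_coeff g k))) {-pi..pi}"
      by (intro has_integral_sum has_integral_mult_right sine_coeff_has_integral g) auto
    then show ?thesis by (simp add: P_def sum_distrib_left sum_distrib_right mult_ac)
  qed
  have PS: "\<bar>P N x\<bar> \<le> S" for N x
  proof -
    have "\<bar>P N x\<bar> \<le> (\<Sum>k<N. \<bar>m k * sine_coeff f k * sin (real k * x)\<bar>)" unfolding P_def by (rule sum_abs)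
    also have "\<dots> \<le> (\<Sum>k<N. \<bar>m k * sine_coeff f k\<bar>)" by (intro sum_mono sine_term_bound)
    also have "\<dots> \<le> S" unfolding S_def by (rule sum_le_suminf[OF symbol_abs_summable[OF f m]]) auto
    finally show ?thesis .
  qed
  have "(\<lambda>N. P N x) \<longlonglongrightarrow> sine_mult m f x" for x
    using summable_LIMSEQ[OF sine_mult_summable[OF f m, of x]] by (simp add: P_def sine_mult_def)
  note lim = bounded_convergence_weighted[OF L2_circle_integrable[OF g] intP PS this]
  have "(\<lambda>N. \<Sum>k<N. m k * sine_coeff f k * sine_coeff g k) \<longlonglongrightarrow> integral {-pi..pi} (\<lambda>x. g x * sine_mult m f x) / pi"
    using tendsto_divide[OF lim(2) tendsto_const[of pi]] by simp
  then have "(\<Sum>k. m k * sine_coeff f k * sine_coeff g k) = integral {-pi..pi} (\<lambda>x. g x * sine_mult m f x) / pi"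
    by (simp add: sums_def[symmetric] sums_iff)
  then show ?thesis using lim(1) by (simp add: has_integral_iff mult.commute)
qed

section \<open>The positive solution\<close>

lemma nonneg_nonzero_solution_iff:
  assumes "n \<ge> 3"
  shows "nonneg_nonzero_solution \<alpha> n v \<longleftrightarrow>
     odd_L2 (odd_ext (\<lambda>y. v y powr (1 / \<alpha>))) \<and>
     (\<forall>x\<in>{0..pi}. v x \<ge> 0) \<and> (\<exists>x\<in>{0..pi}. v x \<noteq> 0) \<and>
     (\<forall>x\<in>{0..pi}. v x = half_op n (\<lambda>y. v y powr (1 / \<alpha>)) x)"
proof -
  have "odd_L2 (odd_ext w) \<longleftrightarrow> L2_circle (odd_ext w)" for w
    by (simp add: odd_L2_def odd_ext_odd)
  moreover have "Sn_half n w x = - half_op n w x" if "odd_L2 (odd_ext w)" for w x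
    unfolding Sn_half_def half_op_def by (rule Sn_op_odd[OF that assms])
  ultimately show ?thesis unfolding nonneg_nonzero_solution_def by auto
qed

lemma powr_split: "0 < x \<Longrightarrow> x powr p * x powr (1 - p) = (x::real)"
  by (simp flip: powr_add)

text \<open>The integrand in the symmetry identity for two solutions, in a form that shows its sign.\<close>

lemma powr_cross_difference:
  fixes v w p :: real
  assumes "0 < v" "0 < w"
  shows "v * w powr p - w * v powr p = w powr p * v powr p * (v powr (1 - p) - w powr (1 - p))"
proof -
  have "w powr p * v powr p * (v powr (1 - p) - w powr (1 - p)) =
     (v powr p * v powr (1 - p)) * w powr p - (w powr p * w powr (1 - p)) * v powr p"
    by (simp add: algebra_simps)
  then show ?thesis using assms by (simp add: powr_split)
qed

text \<open>\<open>M\<close> is the positive fixed point of \<open>s \<mapsto> C s\<^sup>p\<close>; as \<open>p < 1\<close>, the graph lies below the diagonal beyond it.\<close>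

lemma powr_fixpoint_bound:
  fixes s C M p :: real
  assumes "0 \<le> s" "s \<le> C * s powr p" "0 < p" "p < 1" "M = C powr (1 / (1 - p))" "C \<ge> 1"
  shows "s \<le> M"
proof (cases "s = 0")
  case False
  then have s: "s > 0" using assms by simp
  have "s powr (1 - p) * s powr p \<le> C * s powr p"
    using assms(2) powr_split[OF s, of p] by (simp add: mult.commute)
  then have "s powr (1 - p) \<le> C" using s by (simp add: mult_le_cancel_right)
  then have "(s powr (1 - p)) powr (1 / (1 - p)) \<le> M"
    unfolding assms(5) using assms(4) by (intro powr_mono2) auto
  then show ?thesis using s assms(4) by (simp add: powr_powr)
qed (use assms in auto)

text \<open>With \<open>0 \<le> sin x \<le> 1\<close> and \<open>p < 1\<close> a lower bound by the sine survives the power.\<close>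

lemma sin_le_powr:
  assumes "sin x \<le> u" "0 \<le> x" "x \<le> pi" and p: "0 < p" "p < 1"
  shows "sin x \<le> u powr p"
proof -
  have s0: "0 \<le> sin x" using assms by (simp add: sin_ge_zero)
  have "sin x \<le> sin x powr p"
  proof (cases "sin x = 0")
    case False
    then show ?thesis using powr_mono'[of p 1 "sin x"] p s0 by simp
  qed simp
  also have "\<dots> \<le> u powr p" using assms s0 by (intro powr_mono2) auto
  finally show ?thesis .
qed

text \<open>The fixed point \<open>M\<close> of \<open>s \<mapsto> C s\<^sup>p\<close>, with \<open>C\<close> the sup norm bound of the operator, is a constant
  supersolution, and it bounds every solution \<open>w\<close>, because \<open>max w \<le> C (max w)\<^sup>p\<close>. Taking \<open>C \<ge> 1\<close> puts \<open>M\<close> above \<open>sin\<close>. By monotonicity the iterates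
  \<open>U j\<close> of \<open>M\<close> decrease, stay above \<open>sin\<close> and above every solution, and so does their limit.\<close>

theorem greatest_solution:
  assumes n: "n \<ge> 3" and \<alpha>: "\<alpha> > 1"
  obtains v where "continuous_on {0..pi} v" "nonneg_nonzero_solution \<alpha> n v"
    "\<And>x. 0 \<le> x \<Longrightarrow> x \<le> pi \<Longrightarrow> sin x \<le> v x"
    "\<And>w x. nonneg_nonzero_solution \<alpha> n w \<Longrightarrow> 0 \<le> x \<Longrightarrow> x \<le> pi \<Longrightarrow> w x \<le> v x"
proof -
  define p where "p = 1 / \<alpha>"
  have p: "0 < p" "p < 1" using \<alpha> by (auto simp: p_def)
  obtain C where C: "C \<ge> 1" "\<And>w B x. odd_L2 (odd_ext w) \<Longrightarrow> (\<And>y. 0 < y \<Longrightarrow> y < pi \<Longrightarrow> \<bar>w y\<bar> \<le> B) \<Longrightarrow>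
     \<bar>half_op n w x\<bar> \<le> C * B"
    using half_op_sup_bound n by metis
  define M where "M = C powr (1 / (1 - p))"
  have M1: "M \<ge> 1" using C(1) p by (simp add: M_def ge_one_powr_ge_zero)
  have CM: "C * M powr p = M"
  proof -
    have "C = M powr (1 - p)" using C(1) p by (simp add: M_def powr_powr)
    then have "C * M powr p = M powr p * M powr (1 - p)" by (metis mult.commute)
    then show ?thesis using powr_split[of M p] M1 by simp
  qed
  define U where "U = (\<lambda>j::nat. rec_nat (\<lambda>x. M) (\<lambda>_ u. half_op n (\<lambda>y. u y powr p)) j)"
  have U0: "U 0 = (\<lambda>x. M)" and US: "U (Suc j) = half_op n (\<lambda>y. U j y powr p)" for j
    by (simp_all add: U_def)
  have ext: "odd_L2 (odd_ext (\<lambda>y. u y powr p))" if "continuous_on {0..pi} u" "\<And>x. 0 \<le> x \<Longrightarrow> x \<le> pi \<Longrightarrow> sin x \<le> u x" for u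
  proof (intro odd_L2_odd_ext_continuous continuous_on_powr' that(1) continuous_on_const ballI)
    fix x assume "x \<in> {0..pi}"
    then have "0 \<le> u x" using that(2)[of x] sin_ge_zero[of x] by auto
    then show "0 \<le> u x \<and> (u x = 0 \<longrightarrow> 0 < p)" using p by simp
  qed

  have sinL: "odd_L2 (odd_ext sin)" by (rule odd_L2_odd_ext_continuous) (intro continuous_intros)
  have inv: "continuous_on {0..pi} (U j) \<and> (\<forall>x\<in>{0..pi}. sin x \<le> U j x \<and> U j x \<le> M)" for j
  proof (induction j)
    case 0
    have "sin x \<le> M" for x using M1 sin_le_one[of x] by linarith
    then show ?case by (simp add: U0)
  next
    case (Suc j)
    then have L: "odd_L2 (odd_ext (\<lambda>y. U j y powr p))" by (intro ext) auto
    have "continuous_on {0..pi} (U (Suc j))" unfolding US by (rule half_op_continuous[OF n L])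
    moreover have "sin x \<le> U (Suc j) x" if "x \<in> {0..pi}" for x
    proof -
      have "sin x \<le> half_op n sin x" using half_op_sin[OF n] that by simp
      also have "\<dots> \<le> U (Suc j) x"
        unfolding US by (rule half_op_mono[OF n sinL L]) (use that Suc sin_le_powr p in auto)
      finally show ?thesis .
    qed
    moreover have "U (Suc j) x \<le> M" for x
    proof -
      have "\<bar>half_op n (\<lambda>y. U j y powr p) x\<bar> \<le> C * M powr p"
      proof (rule C(2)[OF L])
        fix y :: real assume "0 < y" "y < pi"
        then have "sin y \<le> U j y" "U j y \<le> M" using Suc by auto
        moreover have "0 \<le> sin y" using \<open>0 < y\<close> \<open>y < pi\<close> by (simp add: sin_ge_zero)
        ultimately have "0 \<le> U j y" "U j y \<le> M" by auto
        then show "\<bar>U j y powr p\<bar> \<le> M powr p" using p by (auto intro!: powr_mono2)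
      qed
      then show ?thesis by (simp add: US CM)
    qed
    ultimately show ?case by blast
  qed
  have U_ge0: "0 \<le> U j x" if "0 \<le> x" "x \<le> pi" for j x
    using inv[of j] sin_ge_zero[OF that] that order_trans[of 0 "sin x" "U j x"] by auto
  have UL: "odd_L2 (odd_ext (\<lambda>y. U j y powr p))" for j using inv[of j] by (intro ext) auto
  have dec: "U (Suc j) x \<le> U j x" if "0 \<le> x" "x \<le> pi" for j x
    using that
  proof (induction j arbitrary: x)
    case 0
    then show ?case using inv[of "Suc 0"] by (auto simp: U0)
  next
    case (Suc j)
    have "half_op n (\<lambda>y. U (Suc j) y powr p) x \<le> half_op n (\<lambda>y. U j y powr p) x"
      by (rule half_op_mono[OF n UL UL]) (use Suc U_ge0 p in \<open>auto intro!: powr_mono2\<close>)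
    then show ?case using fun_cong[OF US[of j], of x] fun_cong[OF US[of "Suc j"], of x] by linarith
  qed
  have conv: "\<exists>l. (\<lambda>j. U j x) \<longlonglongrightarrow> l" if "0 \<le> x" "x \<le> pi" for x
  proof -
    have "decseq (\<lambda>j. U j x)" using dec[OF that] by (intro decseq_SucI)
    then show ?thesis using U_ge0[OF that] by (metis decseq_convergent)
  qed
  define v where "v = (\<lambda>x. lim (\<lambda>j. U j x))"
  have v: "(\<lambda>j. U j x) \<longlonglongrightarrow> v x" if "0 \<le> x" "x \<le> pi" for x
    using conv[OF that] limI unfolding v_def by metis
  have v_sin: "sin x \<le> v x" if "0 \<le> x" "x \<le> pi" for x
    by (rule LIMSEQ_le_const[OF v[OF that]]) (use inv that in auto)
  have v_M: "v x \<le> M" if "0 \<le> x" "x \<le> pi" for x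
    by (rule LIMSEQ_le_const2[OF v[OF that]]) (use inv that in auto)
  have v_ge0: "0 \<le> v x" if "0 \<le> x" "x \<le> pi" for x
    using v_sin[OF that] sin_ge_zero[OF that] by linarith
  have powr_lim: "(\<lambda>j. U j x powr p) \<longlonglongrightarrow> v x powr p" if "0 \<le> x" "x \<le> pi" for x
    using v[OF that] U_ge0[OF that] p by (intro tendsto_powr2) auto
  have powr_le: "\<bar>u powr p\<bar> \<le> M powr p" if "0 \<le> u" "u \<le> M" for u
    using that p by (auto intro!: powr_mono2)
  have vL: "odd_L2 (odd_ext (\<lambda>y. v y powr p))"
  proof (rule odd_L2_odd_ext)
    have "(\<lambda>x. indicator {0<..<pi} x *\<^sub>R (U j x powr p)) \<in> borel_measurable borel" for j
    proof (rule borel_measurable_continuous_on_indicator)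
      show "continuous_on {0<..<pi} (\<lambda>x. U j x powr p)"
      proof (rule continuous_on_powr')
        show "continuous_on {0<..<pi} (U j)"
          by (rule continuous_on_subset[of "{0..pi}"]) (use inv[of j] in auto)
      qed (use U_ge0 p in auto)
    qed simp
    then show "(\<lambda>x. indicator {0<..<pi} x *\<^sub>R (v x powr p)) \<in> borel_measurable borel"
    proof (rule borel_measurable_LIMSEQ_real[rotated])
      fix x :: real
      show "(\<lambda>j. indicator {0<..<pi} x *\<^sub>R (U j x powr p)) \<longlonglongrightarrow> indicator {0<..<pi} x *\<^sub>R (v x powr p)"
        using powr_lim[of x] by (auto simp: indicator_def)
    qed
    show "\<bar>v x powr p\<bar> \<le> M powr p" if "0 < x" "x < pi" for x
      using powr_le[of "v x"] v_ge0 v_M that by auto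
  qed
  have v_eq: "v x = half_op n (\<lambda>y. v y powr p) x" if "0 \<le> x" "x \<le> pi" for x
  proof -
    have "(\<lambda>j. half_op n (\<lambda>y. U j y powr p) x) \<longlonglongrightarrow> half_op n (\<lambda>y. v y powr p) x"
    proof (rule half_op_LIMSEQ[OF n UL vL])
      show "\<bar>U j y powr p\<bar> \<le> M powr p" if "0 < y" "y < pi" for j y
        using powr_le[of "U j y"] U_ge0[of y j] inv[of j] that by auto
    qed (use powr_lim in auto)
    moreover have "(\<lambda>j. half_op n (\<lambda>y. U j y powr p) x) \<longlonglongrightarrow> v x"
      using LIMSEQ_Suc[OF v[OF that]] by (simp add: US)
    ultimately show ?thesis by (rule LIMSEQ_unique[rotated])
  qed
  show thesis
  proof
    have "continuous_on {0..pi} (half_op n (\<lambda>y. v y powr p))" by (rule half_op_continuous[OF n vL])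
    then show "continuous_on {0..pi} v" by (rule continuous_on_eq) (use v_eq in auto)
    have "v (pi / 2) \<ge> 1" using v_sin[of "pi / 2"] by simp
    then show "nonneg_nonzero_solution \<alpha> n v"
      unfolding nonneg_nonzero_solution_iff[OF n] p_def[symmetric]
      using vL v_ge0 v_eq by (intro conjI bexI[of _ "pi / 2"]) auto
    show "sin x \<le> v x" if "0 \<le> x" "x \<le> pi" for x by (rule v_sin[OF that])
    fix w x assume w: "nonneg_nonzero_solution \<alpha> n w" and x: "0 \<le> x" "x \<le> pi"
    have wL: "odd_L2 (odd_ext (\<lambda>y. w y powr p))" and w0: "\<And>x. 0 \<le> x \<Longrightarrow> x \<le> pi \<Longrightarrow> 0 \<le> w x"
      and w_eq: "\<And>x. 0 \<le> x \<Longrightarrow> x \<le> pi \<Longrightarrow> w x = half_op n (\<lambda>y. w y powr p) x"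
      using w unfolding nonneg_nonzero_solution_iff[OF n] p_def[symmetric] by auto
    have "continuous_on {0..pi} (half_op n (\<lambda>y. w y powr p))" by (rule half_op_continuous[OF n wL])
    then have "continuous_on {0..pi} w" by (rule continuous_on_eq) (use w_eq in auto)
    then obtain x0 where x0: "x0 \<in> {0..pi}" "\<And>y. y \<in> {0..pi} \<Longrightarrow> w y \<le> w x0"
      using continuous_attains_sup[of "{0..pi}" w] by auto
    have "\<bar>half_op n (\<lambda>y. w y powr p) x0\<bar> \<le> C * w x0 powr p"
    proof (rule C(2)[OF wL])
      fix y :: real assume "0 < y" "y < pi"
      then have "0 \<le> w y" "w y \<le> w x0" using w0[of y] x0(2)[of y] by auto
      then show "\<bar>w y powr p\<bar> \<le> w x0 powr p" using p by (simp add: powr_mono2)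
    qed
    then have "w x0 \<le> C * w x0 powr p" using w_eq[of x0] x0(1) by auto
    then have "w x0 \<le> M"
      using powr_fixpoint_bound[of "w x0" C p M] w0[of x0] x0(1) p C(1) M_def by auto
    then have wM: "w y \<le> M" if "0 \<le> y" "y \<le> pi" for y using x0(2)[of y] that by auto
    have wU: "w y \<le> U j y" if "0 \<le> y" "y \<le> pi" for j y
      using that
    proof (induction j arbitrary: y)
      case 0
      then show ?case using wM by (simp add: U0)
    next
      case (Suc j)
      have "half_op n (\<lambda>y. w y powr p) y \<le> half_op n (\<lambda>y. U j y powr p) y"
      proof (rule half_op_mono[OF n wL UL])
        fix z :: real assume "0 < z" "z < pi"
        then have "0 \<le> w z" "w z \<le> U j z" using w0[of z] Suc.IH[of z] by auto
        then show "w z powr p \<le> U j z powr p" using p by (simp add: powr_mono2)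
      qed (use Suc.prems in auto)
      then show ?case using w_eq[OF Suc.prems] fun_cong[OF US, of j y] by linarith
    qed
    show "w x \<le> v x" by (rule LIMSEQ_le_const[OF v[OF x]]) (use wU[OF x] in auto)
  qed
qed

text \<open>Symmetry of the operator gives \<open>\<integral> w\<^sup>p v\<^sup>p (v\<^bsup>1 - p\<^esup> - w\<^bsup>1 - p\<^esup>) = 0\<close> for two solutions. If
  \<open>w \<le> v\<close>, the integrand is nonnegative, so \<open>w\<close> takes at every point the value \<open>0\<close> or that of \<open>v\<close>; connectedness
  of the interval excludes a mixture.\<close>

theorem solution_unique_below:
  assumes n: "n \<ge> 3" and \<alpha>: "\<alpha> > 1"
    and v: "nonneg_nonzero_solution \<alpha> n v" and v_pos: "\<And>x. 0 < x \<Longrightarrow> x < pi \<Longrightarrow> v x > 0"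
    and w: "nonneg_nonzero_solution \<alpha> n w"
    and le: "\<And>x. 0 \<le> x \<Longrightarrow> x \<le> pi \<Longrightarrow> w x \<le> v x"
    and x: "0 \<le> x" "x \<le> pi"
  shows "w x = v x"
proof -
  define p where "p = 1 / \<alpha>"
  have p: "0 < p" "p < 1" using \<alpha> by (auto simp: p_def)
  define f where "f = odd_ext (\<lambda>y. v y powr p)"
  define g where "g = odd_ext (\<lambda>y. w y powr p)"
  have f: "odd_L2 f" and v0: "\<And>x. 0 \<le> x \<Longrightarrow> x \<le> pi \<Longrightarrow> 0 \<le> v x"
    and v_eq: "\<And>x. 0 \<le> x \<Longrightarrow> x \<le> pi \<Longrightarrow> v x = sine_mult (Sn_symbol n) f x"
    using v unfolding nonneg_nonzero_solution_iff[OF n] p_def[symmetric] f_def half_op_def by auto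
  have g: "odd_L2 g" and w0: "\<And>x. 0 \<le> x \<Longrightarrow> x \<le> pi \<Longrightarrow> 0 \<le> w x"
    and w_eq: "\<And>x. 0 \<le> x \<Longrightarrow> x \<le> pi \<Longrightarrow> w x = sine_mult (Sn_symbol n) g x"
    and w_nz: "\<exists>x\<in>{0..pi}. w x \<noteq> 0"
    using w unfolding nonneg_nonzero_solution_iff[OF n] p_def[symmetric] g_def half_op_def by auto
  have Lf: "L2_circle f" and Lg: "L2_circle g" using f g by (auto simp: odd_L2_def)
  note m = Sn_symbol_bound[OF n]
  define F where "F = sine_mult (Sn_symbol n) f"
  define G where "G = sine_mult (Sn_symbol n) g"
  have contF: "continuous_on S F" and contG: "continuous_on S G" for S
    unfolding F_def G_def by (rule continuous_on_subset[OF sine_mult_continuous[OF _ m]]; simp add: Lf Lg)+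
  define d where "d = (\<lambda>x. F x * g x - G x * f x)"
  have "(d has_integral (pi * (\<Sum>k. Sn_symbol n k * sine_coeff f k * sine_coeff g k)
      - pi * (\<Sum>k. Sn_symbol n k * sine_coeff g k * sine_coeff f k))) {-pi..pi}"
    unfolding d_def F_def G_def by (intro has_integral_diff sine_mult_symmetric Lf Lg m)
  then have d0: "(d has_integral 0) {-pi..pi}" by (simp add: mult_ac)
  define e where "e = (\<lambda>x. v x * w x powr p - w x * v x powr p)"
  have e_ge0: "e x \<ge> 0" if "0 \<le> x" "x \<le> pi" for x
  proof (cases "w x = 0")
    case False
    then have wx: "0 < w x" "w x \<le> v x" using w0[OF that] le[OF that] by auto
    then have "w x powr (1 - p) \<le> v x powr (1 - p)" using p by (intro powr_mono2) auto
    then have "0 \<le> w x powr p * v x powr p * (v x powr (1 - p) - w x powr (1 - p))"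
      by (intro mult_nonneg_nonneg) auto
    then show ?thesis unfolding e_def using powr_cross_difference[of "v x" "w x" p] wx by simp
  qed (simp add: e_def p)
  have de: "d x = e x" if "0 < x" "x < pi" for x
    using that v_eq[of x] w_eq[of x] by (simp add: d_def e_def F_def G_def f_def g_def mult.commute)
  have d_even: "d (- x) = d x" for x
    unfolding d_def F_def G_def using sine_mult_odd[OF Lf m] sine_mult_odd[OF Lg m] f g by (simp add: odd_L2_def)
  have d_ge0: "d x \<ge> 0" if x: "x \<in> {-pi..pi}" for x
  proof (rule nonneg_even_half[of d, OF _ _ _ d_even x])
    show "d y \<ge> 0" if "0 < y" "y < pi" for y using de[of y] e_ge0[of y] that by simp
  qed (simp_all add: d_def F_def G_def)
  have F_v: "F x = v x" and G_w: "G x = w x" if "x \<in> {0..pi}" for x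
    using v_eq[of x] w_eq[of x] that by (auto simp: F_def G_def)
  have cont_v: "continuous_on {0..pi} v" and cont_w: "continuous_on {0..pi} w"
    using continuous_on_eq[OF contF, of "{0..pi}" v] continuous_on_eq[OF contG, of "{0..pi}" w] F_v G_w by auto
  have cont_e: "continuous_on {0..pi} e"
    unfolding e_def using p v0 w0 by (intro continuous_intros continuous_on_powr' cont_v cont_w) auto
  have "integral {0..pi} e = 0"
  proof (rule antisym)
    have "integral {0..pi} e = integral {0..pi} d"
      by (rule integral_spike[of "{0, pi}"]) (use de in auto)
    also have "\<dots> \<le> integral {-pi..pi} d"
      by (rule integral_subset_le) (use d0 d_ge0 integrable_on_subinterval[of d "{-pi..pi}" 0 pi] in auto)
    finally show "integral {0..pi} e \<le> 0" using integral_unique[OF d0] by simp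
    show "0 \<le> integral {0..pi} e"
      by (intro integral_nonneg integrable_continuous_real cont_e) (use e_ge0 in auto)
  qed
  then have e0: "e y = 0" if "y \<in> {0..pi}" for y
    using integral_eq_0_iff[OF cont_e] e_ge0 that by simp
  have dichotomy: "w y / v y = 0 \<or> w y / v y = 1" if "0 < y" "y < pi" for y
  proof (cases "w y = 0")
    case False
    then have wy: "0 < w y" "0 < v y" using w0[of y] v_pos[of y] that by auto
    have "w y powr p * v y powr p * (v y powr (1 - p) - w y powr (1 - p)) = 0"
      using powr_cross_difference[of "v y" "w y" p] e0[of y] that wy by (simp add: e_def)
    then have "v y powr (1 - p) = w y powr (1 - p)" using wy by simp
    then have "(v y powr (1 - p)) powr (1 / (1 - p)) = (w y powr (1 - p)) powr (1 / (1 - p))" by simp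
    then have "v y = w y" using wy p by (simp add: powr_powr)
    then show ?thesis using wy by simp
  qed simp
  obtain x0 where x0: "x0 \<in> {0..pi}" "w x0 \<noteq> 0" using w_nz by blast
  have ends: "w 0 = 0" "w pi = 0" "v 0 = 0" "v pi = 0"
    using w_eq[of 0] w_eq[of pi] v_eq[of 0] v_eq[of pi] by auto
  then have x0': "0 < x0" "x0 < pi" using x0 by (cases "x0 = 0 \<or> x0 = pi"; auto simp: less_le)+
  have q1: "w x0 / v x0 = 1" using dichotomy[OF x0'] x0(2) v_pos[OF x0'] by auto
  show ?thesis
  proof (cases "x = 0 \<or> x = pi")
    case False
    then have x': "0 < x" "x < pi" using x by auto
    define S where "S = (\<lambda>y. w y / v y) ` {0<..<pi}"
    have "continuous_on {0<..<pi} (\<lambda>y. w y / v y)"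
    proof (intro continuous_on_divide ballI)
      show "continuous_on {0<..<pi} w" by (rule continuous_on_subset[OF cont_w]) auto
      show "continuous_on {0<..<pi} v" by (rule continuous_on_subset[OF cont_v]) auto
      show "v y \<noteq> 0" if "y \<in> {0<..<pi}" for y using v_pos[of y] that by auto
    qed
    then have "connected S" unfolding S_def by (rule connected_continuous_image) simp
    moreover have "1 \<in> S" unfolding S_def using q1 x0' by (force intro!: image_eqI[of _ _ x0])
    moreover have "S \<subseteq> {0, 1}" unfolding S_def
    proof (rule image_subsetI)
      fix y assume "y \<in> {0<..<pi}"
      then show "w y / v y \<in> {0, 1}" using dichotomy[of y] by simp
    qed
    ultimately have "0 \<notin> S"
      using connected_contains_Icc[of S 0 1] by (force simp: subset_iff dest!: spec[of _ "1/2 :: real"])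
    moreover have "w x / v x \<in> S" unfolding S_def using x' by auto
    ultimately have "w x / v x = 1" using dichotomy[OF x'] by auto
    then show ?thesis using v_pos[OF x'] by simp
  qed (use ends in auto)
qed

section \<open>Regularity\<close>

lemma abs_sin_diff_le: "\<bar>sin a - sin b\<bar> \<le> \<bar>a - b :: real\<bar>"
proof -
  have "\<bar>sin a - sin b\<bar> = 2 * \<bar>sin ((a - b) / 2)\<bar> * \<bar>cos ((a + b) / 2)\<bar>"
    by (simp add: sin_diff_sin abs_mult)
  also have "\<dots> \<le> 2 * \<bar>(a - b) / 2\<bar> * 1"
    by (intro mult_mono abs_sin_x_le_abs_x) auto
  finally show ?thesis by simp
qed

lemma abs_sin_diff_powr:
  assumes "0 < \<beta>" "\<beta> \<le> 1"
  shows "\<bar>sin a - sin b\<bar> \<le> 2 * \<bar>a - b :: real\<bar> powr \<beta>"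
proof (cases "\<bar>a - b\<bar> \<le> 1")
  case True
  have "\<bar>a - b\<bar> \<le> \<bar>a - b\<bar> powr \<beta>"
  proof (cases "a = b")
    case False
    then show ?thesis using powr_mono'[of \<beta> 1 "\<bar>a - b\<bar>"] assms True by simp
  qed simp
  then show ?thesis using abs_sin_diff_le[of a b] by linarith
next
  case False
  then have "1 \<le> \<bar>a - b\<bar> powr \<beta>" using assms by (intro ge_one_powr_ge_zero) auto
  moreover have "\<bar>sin a - sin b\<bar> \<le> 2"
    using abs_triangle_ineq4[of "sin a" "sin b"] abs_sin_le_one[of a] abs_sin_le_one[of b] by linarith
  ultimately show ?thesis by linarith
qed

text \<open>A first gain of regularity from square integrability alone, by Cauchy-Schwarz. The exponent \<open>1/4\<close> is
  not optimal; any positive exponent starts the bootstrap.\<close>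

lemma sine_mult_holder:
  assumes f: "L2_circle f" and m: "symbol_bound m"
  shows "\<exists>K\<ge>0. \<forall>x y. \<bar>sine_mult m f x - sine_mult m f y\<bar> \<le> K * \<bar>x - y\<bar> powr (1/4)"
proof -
  define g where "g = (\<lambda>k. 2 * \<bar>m k * sine_coeff f k\<bar> * real k powr (1/4))"
  have sg: "summable g"
  proof (rule summable_comparison_test')
    show "summable (\<lambda>k. 2 * (real k powr (-3/2) + (sine_coeff f k)\<^sup>2))"
      by (intro summable_mult summable_add sine_coeff_square_summable f)
        (simp add: summable_real_powr_iff)
    fix k assume "k \<ge> (0::nat)"
    show "norm (g k) \<le> 2 * (real k powr (-3/2) + (sine_coeff f k)\<^sup>2)"
    proof (cases "k = 0")
      case False
      have "\<bar>m k\<bar> * real k powr (1/4) \<le> 2 / real k * real k powr (1/4)"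
        using m by (intro mult_right_mono) (auto simp: symbol_bound_def)
      also have "\<dots> = 2 * real k powr (-3/4)"
        using False powr_diff[of "real k" "1/4" 1] by simp
      finally have "g k \<le> 2 * (2 * real k powr (-3/4)) * \<bar>sine_coeff f k\<bar>"
        using mult_right_mono[of "\<bar>m k\<bar> * real k powr (1/4)" "2 * real k powr (-3/4)" "2 * \<bar>sine_coeff f k\<bar>"]
        by (simp add: g_def abs_mult mult_ac)
      also have "\<dots> \<le> 2 * ((real k powr (-3/4))\<^sup>2 + (sine_coeff f k)\<^sup>2)"
        using sum_squares_bound[of "real k powr (-3/4)" "\<bar>sine_coeff f k\<bar>"] by simp
      also have "(real k powr (-3/4))\<^sup>2 = real k powr (-3/2)"
        using False by (simp add: power2_eq_square flip: powr_add)
      finally show ?thesis by (simp add: g_def)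
    qed (simp add: g_def)
  qed
  have "\<bar>sine_mult m f x - sine_mult m f y\<bar> \<le> suminf g * \<bar>x - y\<bar> powr (1/4)" for x y
  proof -
    have "(\<lambda>k. m k * sine_coeff f k * sin (real k * x) - m k * sine_coeff f k * sin (real k * y)) sums
       (sine_mult m f x - sine_mult m f y)"
      unfolding sine_mult_def by (intro sums_diff summable_sums sine_mult_summable f m)
    then have eq: "sine_mult m f x - sine_mult m f y =
        (\<Sum>k. m k * sine_coeff f k * (sin (real k * x) - sin (real k * y)))"
      by (simp add: sums_iff algebra_simps)
    have le: "norm (m k * sine_coeff f k * (sin (real k * x) - sin (real k * y))) \<le> g k * \<bar>x - y\<bar> powr (1/4)" for k
    proof -
      have "\<bar>sin (real k * x) - sin (real k * y)\<bar> \<le> 2 * \<bar>real k * x - real k * y\<bar> powr (1/4)"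
        by (rule abs_sin_diff_powr) auto
      also have "\<bar>real k * x - real k * y\<bar> = real k * \<bar>x - y\<bar>"
        by (simp add: abs_mult flip: right_diff_distrib)
      also have "(real k * \<bar>x - y\<bar>) powr (1/4) = real k powr (1/4) * \<bar>x - y\<bar> powr (1/4)"
        by (simp add: powr_mult)
      finally have "\<bar>m k * sine_coeff f k\<bar> * \<bar>sin (real k * x) - sin (real k * y)\<bar> \<le>
          \<bar>m k * sine_coeff f k\<bar> * (2 * (real k powr (1/4) * \<bar>x - y\<bar> powr (1/4)))"
        by (rule mult_left_mono) simp
      then show ?thesis by (simp add: g_def abs_mult mult_ac)
    qed
    have sN: "summable (\<lambda>k. norm (m k * sine_coeff f k * (sin (real k * x) - sin (real k * y))))"
      by (rule summable_comparison_test'[OF summable_mult2[OF sg]]) (use le in simp)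
    have "\<bar>sine_mult m f x - sine_mult m f y\<bar> \<le>
        (\<Sum>k. norm (m k * sine_coeff f k * (sin (real k * x) - sin (real k * y))))"
      unfolding eq using summable_norm[OF sN] by simp
    also have "\<dots> \<le> (\<Sum>k. g k * \<bar>x - y\<bar> powr (1/4))"
      by (rule suminf_le[OF le sN summable_mult2[OF sg]])
    also have "\<dots> = suminf g * \<bar>x - y\<bar> powr (1/4)" by (rule suminf_mult2[OF sg, symmetric])
    finally show ?thesis .
  qed
  moreover have "suminf g \<ge> 0" by (rule suminf_nonneg[OF sg]) (simp add: g_def)
  ultimately show ?thesis by blast
qed

text \<open>For equal signs this is subadditivity of \<open>a \<mapsto> a\<^sup>p\<close>; for opposite signs both moduli are at most
  \<open>\<bar>s - t\<bar>\<close>, whence the factor \<open>2\<close>.\<close>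

lemma signed_powr_holder:
  fixes s t p :: real
  assumes p: "0 < p" "p < 1"
  shows "\<bar>sgn s * \<bar>s\<bar> powr p - sgn t * \<bar>t\<bar> powr p\<bar> \<le> 2 * \<bar>s - t\<bar> powr p"
proof -
  have sub: "(a + b) powr p \<le> a powr p + b powr p" if "0 < a" "0 < b" for a b :: real
  proof -
    have "a / (a + b) \<le> (a / (a + b)) powr p" "b / (a + b) \<le> (b / (a + b)) powr p"
      using powr_mono'[of p 1 "a / (a + b)"] powr_mono'[of p 1 "b / (a + b)"] that p by (auto simp: divide_simps)
    then have "a / (a + b) + b / (a + b) \<le> (a powr p + b powr p) / (a + b) powr p"
      using that by (simp add: powr_divide add_divide_distrib)
    moreover have "a / (a + b) + b / (a + b) = 1" using that by (simp flip: add_divide_distrib)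
    ultimately show ?thesis using that by (simp add: pos_le_divide_eq)
  qed
  have same: "\<bar>a powr p - b powr p\<bar> \<le> \<bar>a - b\<bar> powr p" if "0 \<le> a" "0 \<le> b" for a b :: real
    using that
  proof (induction a b rule: linorder_wlog)
    case (le a b)
    show ?case
    proof (cases "a = 0 \<or> a = b")
      case False
      then show ?thesis using sub[of a "b - a"] le powr_mono2[of p a b] p by (auto simp: abs_if)
    qed (use p le in auto)
  qed (simp add: abs_minus_commute)
  have opp: "\<bar>a powr p + b powr p\<bar> \<le> 2 * (a + b) powr p" if "0 \<le> a" "0 \<le> b" for a b :: real
    using powr_mono2[of p a "a + b"] powr_mono2[of p b "a + b"] that p by auto
  show ?thesis
  proof (cases "0 \<le> s \<longleftrightarrow> 0 \<le> t")
    case True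
    then have "\<bar>sgn s * \<bar>s\<bar> powr p - sgn t * \<bar>t\<bar> powr p\<bar> \<le> \<bar>s - t\<bar> powr p"
      using same[of s t] same[of "-s" "-t"] p by (auto simp: sgn_if abs_minus_commute split: if_splits)
    moreover have "0 \<le> \<bar>s - t\<bar> powr p" by simp
    ultimately show ?thesis by linarith
  next
    case False
    then show ?thesis
      using opp[of s "-t"] opp[of "-s" t] p by (auto simp: sgn_if add.commute abs_if split: if_splits)
  qed
qed

text \<open>Term-by-term differentiation.\<close>

lemma sine_mult_has_derivative:
  assumes f: "L2_circle f" and m: "symbol_bound m" and s: "summable (\<lambda>k. \<bar>real k * m k * sine_coeff f k\<bar>)"
  shows "(sine_mult m f has_real_derivative (\<Sum>k. real k * m k * sine_coeff f k * cos (real k * x))) (at x)"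
    and "continuous_on UNIV (\<lambda>x. \<Sum>k. real k * m k * sine_coeff f k * cos (real k * x))"
proof -
  have ul: "uniform_limit UNIV (\<lambda>N x. \<Sum>k<N. real k * m k * sine_coeff f k * cos (real k * x))
      (\<lambda>x. \<Sum>k. real k * m k * sine_coeff f k * cos (real k * x)) sequentially"
  proof (rule Weierstrass_m_test[OF _ s])
    show "norm (real k * m k * sine_coeff f k * cos (real k * x)) \<le> \<bar>real k * m k * sine_coeff f k\<bar>" for k x
      unfolding real_norm_def abs_mult[of _ "cos (real k * x)"] by (rule mult_left_le) auto
  qed
  show "continuous_on UNIV (\<lambda>x. \<Sum>k. real k * m k * sine_coeff f k * cos (real k * x))"
    by (rule uniform_limit_theorem[OF _ ul]) (auto intro!: always_eventually continuous_intros)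
  have "((\<lambda>x. \<Sum>k. m k * sine_coeff f k * sin (real k * x)) has_real_derivative
      (\<Sum>k. real k * m k * sine_coeff f k * cos (real k * x))) (at x)"
  proof (rule has_field_derivative_series'(2)[where f = "\<lambda>k x. m k * sine_coeff f k * sin (real k * x)"
        and f' = "\<lambda>k x. real k * m k * sine_coeff f k * cos (real k * x)" and S = UNIV])
    show "((\<lambda>x. m k * sine_coeff f k * sin (real k * x)) has_real_derivative
       real k * m k * sine_coeff f k * cos (real k * y)) (at y within UNIV)" for k y
      by (auto intro!: derivative_eq_intros)
    show "uniformly_convergent_on UNIV (\<lambda>N x. \<Sum>k<N. real k * m k * sine_coeff f k * cos (real k * x))"
      using ul uniformly_convergent_on_def by blast
    show "0 \<in> (UNIV :: real set)" by simp
  qed auto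
  then show "(sine_mult m f has_real_derivative (\<Sum>k. real k * m k * sine_coeff f k * cos (real k * x))) (at x)"
    by (simp add: sine_mult_def[abs_def])
qed

text \<open>For \<open>0 \<le> c \<le> 2\<pi>\<close> cut the interval at \<open>c - \<pi>\<close> and move the left piece by one period.\<close>

lemma periodic_integral_shift:
  fixes g :: "real \<Rightarrow> real"
  assumes g: "g integrable_on {-pi..pi}" and per: "\<And>x. g (x + 2 * pi) = g x"
  shows "((\<lambda>t. g (c + t)) has_integral integral {-pi..pi} g) {-pi..pi}"
proof -
  have main: "((\<lambda>t. g (c + t)) has_integral integral {-pi..pi} g) {-pi..pi}" if c: "0 \<le> c" "c \<le> 2 * pi" for c
  proof -
    define I1 where "I1 = integral {-pi..c - pi} g"
    define I2 where "I2 = integral {c - pi..pi} g"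
    have i1: "(g has_integral I1) {-pi..c - pi}" and i2: "(g has_integral I2) {c - pi..pi}"
      unfolding I1_def I2_def using c by (auto intro!: integrable_integral integrable_on_subinterval[OF g])
    have sum: "integral {-pi..pi} g = I2 + I1"
      using has_integral_combine[OF _ _ i1 i2] c by (simp add: integral_unique)
    have 2: "((\<lambda>t. g (c + t)) has_integral I2) {-pi..pi - c}"
      using has_integral_shift_Icc_real[of g c I2 "-pi" "pi - c"] i2 by (simp add: o_def algebra_simps)
    have "((\<lambda>t. g ((c - 2 * pi) + t)) has_integral I1) {pi - c..pi}"
      using has_integral_shift_Icc_real[of g "c - 2 * pi" I1 "pi - c" pi] i1 by (simp add: o_def algebra_simps)
    moreover have "g ((c - 2 * pi) + t) = g (c + t)" for t
      using per[of "(c - 2 * pi) + t"] by (simp add: algebra_simps)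
    ultimately have "((\<lambda>t. g (c + t)) has_integral I1) {pi - c..pi}" by simp
    then show ?thesis unfolding sum using 2 c by (intro has_integral_combine[of _ "pi - c"]) auto
  qed
  show ?thesis
  proof (rule circle_cases[of c])
    fix r k assume ck: "c = r + of_int k * (2 * pi)" and r: "- pi < r" "r \<le> pi"
    have eq: "g (c + t) = g (r + t)" for t
      using periodic_int[where f = g and p = "2 * pi", OF per, of "r + t" k] by (simp add: ck algebra_simps)
    show ?thesis
    proof (cases "r \<ge> 0")
      case True
      then show ?thesis using main[of r] r by (simp add: eq)
    next
      case False
      have "g (r + 2 * pi + t) = g (r + t)" for t
        using per[of "r + t"] by (simp add: algebra_simps)
      then show ?thesis using main[of "r + 2 * pi"] r False by (simp add: eq)
    qed
  qed
qed

text \<open>Linear lower bound for the sine, used to bound the conjugate Poisson kernel by \<open>3/\<bar>t\<bar>\<close>.\<close>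

lemma abs_sin_ge_third:
  fixes x :: real assumes "\<bar>x\<bar> \<le> 2" shows "\<bar>x\<bar> / 3 \<le> \<bar>sin x\<bar>"
proof -
  have "\<bar>sin x - x\<bar> \<le> \<bar>x\<bar> ^ 3 / 6"
    using Maclaurin_sin_bound[of x 3] by (simp add: sin_coeff_def eval_nat_numeral)
  moreover have "\<bar>x\<bar> ^ 3 \<le> \<bar>x\<bar> * 4"
  proof -
    have "\<bar>x\<bar>\<^sup>2 \<le> 2\<^sup>2" using assms by (intro power_mono) auto
    then have "\<bar>x\<bar> * \<bar>x\<bar>\<^sup>2 \<le> \<bar>x\<bar> * 4" by (intro mult_left_mono) auto
    then show ?thesis by (simp add: eval_nat_numeral)
  qed
  ultimately show ?thesis by linarith
qed

lemma conjugate_kernel_bound: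
  fixes r t :: real
  assumes r: "0 < r" "r \<le> 1" and t: "\<bar>t\<bar> \<le> pi" "t \<noteq> 0"
  shows "\<bar>r * sin t / (1 - 2 * r * cos t + r\<^sup>2)\<bar> \<le> 3 / \<bar>t\<bar>"
proof -
  define s where "s = sin (t / 2)"
  have s: "\<bar>t\<bar> / 6 \<le> \<bar>s\<bar>" unfolding s_def using abs_sin_ge_third[of "t / 2"] t pi_less_4 by simp
  have s0: "\<bar>s\<bar> > 0" using s t by linarith
  have c: "cos t = 1 - 2 * s\<^sup>2" using cos_double_sin[of "t / 2"] by (simp add: s_def)
  have sn: "\<bar>sin t\<bar> \<le> 2 * \<bar>s\<bar>"
  proof -
    have "sin t = 2 * s * cos (t / 2)" using sin_double[of "t / 2"] by (simp add: s_def)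
    then show ?thesis using mult_left_mono[of "\<bar>cos (t / 2)\<bar>" 1 "2 * \<bar>s\<bar>"] by (simp add: abs_mult)
  qed
  define D where "D = 1 - 2 * r * cos t + r\<^sup>2"
  have "D = (1 - r)\<^sup>2 + 4 * r * s\<^sup>2" by (simp add: D_def c power2_eq_square algebra_simps)
  then have D: "D \<ge> 4 * r * s\<^sup>2" by simp
  have D0: "4 * r * s\<^sup>2 > 0" using r s0 by simp
  have "\<bar>r * sin t / D\<bar> = r * \<bar>sin t\<bar> / D" using D D0 r by (simp add: abs_mult)
  also have "\<dots> \<le> r * (2 * \<bar>s\<bar>) / (4 * r * s\<^sup>2)"
    using D D0 sn r by (intro frac_le mult_left_mono) auto
  also have "\<dots> = 1 / (2 * \<bar>s\<bar>)" using r s0 by (simp add: field_simps power2_eq_square)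
  also have "\<dots> \<le> 1 / (2 * (\<bar>t\<bar> / 6))" using s t by (intro frac_le) auto
  finally show ?thesis by (simp add: D_def)
qed

lemma powr_abs_integrable:
  fixes \<beta> :: real
  assumes "\<beta> > 0"
  shows "(\<lambda>t. \<bar>t\<bar> powr (\<beta> - 1)) integrable_on {-pi..pi}"
proof -
  have "((\<lambda>x. x powr (\<beta> - 1)) has_integral (pi powr (\<beta> - 1 + 1) / (\<beta> - 1 + 1))) {0..pi}"
    by (rule has_integral_powr_from_0) (use assms in auto)
  then have 1: "((\<lambda>x. \<bar>x\<bar> powr (\<beta> - 1)) has_integral (pi powr (\<beta> - 1 + 1) / (\<beta> - 1 + 1))) {0..pi}"
    by (rule has_integral_eq[rotated]) auto
  then have "((\<lambda>x. \<bar>- x\<bar> powr (\<beta> - 1)) has_integral (pi powr (\<beta> - 1 + 1) / (\<beta> - 1 + 1))) {- pi..- 0}"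
    by (subst has_integral_reflect_real)
  then have 2: "(\<lambda>x. \<bar>x\<bar> powr (\<beta> - 1)) integrable_on {- pi..0}" by (auto simp: integrable_on_def)
  show ?thesis
    by (rule Henstock_Kurzweil_Integration.integrable_combine[OF _ _ 2]) (use 1 in \<open>auto simp: integrable_on_def\<close>)
qed

lemma holder_continuous:
  fixes f :: "real \<Rightarrow> real"
  assumes h: "\<And>x y. \<bar>f x - f y\<bar> \<le> K * \<bar>x - y\<bar> powr \<beta>" and \<beta>: "\<beta> > 0"
  shows "continuous_on S f"
proof (intro continuous_at_imp_continuous_on ballI)
  fix x
  have "((\<lambda>y. K * \<bar>y - x\<bar> powr \<beta>) \<longlongrightarrow> K * \<bar>x - x\<bar> powr \<beta>) (at x)"
    using \<beta> by (intro tendsto_mult tendsto_const tendsto_powr2 tendsto_rabs tendsto_diff tendsto_ident_at) auto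
  then have "((\<lambda>y. K * \<bar>y - x\<bar> powr \<beta>) \<longlongrightarrow> 0) (at x)" by simp
  then have "((\<lambda>y. f y - f x) \<longlongrightarrow> 0) (at x)"
    by (rule Lim_null_comparison[rotated]) (simp add: h)
  then show "isCont f x" by (simp add: isCont_def LIM_zero_iff)
qed

text \<open>Since the cosine coefficients of \<open>f\<close> vanish, \<open>\<pi> b\<^sub>k cos (k x)\<close> is the integral of
  \<open>f (x + t) sin (k t)\<close>; subtracting \<open>f x\<close> changes nothing.\<close>

lemma sine_coeff_cos_integral:
  assumes f: "odd_L2 f" and cf: "continuous_on UNIV f"
  shows "((\<lambda>t. (f (x + t) - f x) * sin (real k * t)) has_integral pi * (sine_coeff f k * cos (real k * x))) {-pi..pi}"
proof -
  have L: "L2_circle f" and o: "\<And>x. f (- x) = - f x" using f by (auto simp: odd_L2_def)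
  have cf': "continuous_on S f" for S using cf continuous_on_subset by blast
  define g where "g = (\<lambda>y. f y * sin (real k * (y - x)))"
  have "((\<lambda>y. f y * sin (real k * y)) has_integral pi * sine_coeff f k) {-pi..pi}"
    by (rule sine_coeff_has_integral[OF L])
  moreover have "((\<lambda>y. f y * cos (real k * y)) has_integral 0) {-pi..pi}"
  proof -
    have "(\<lambda>y. f y * cos (real k * y)) integrable_on {-pi..pi}"
      by (intro integrable_continuous_real continuous_intros cf')
    moreover have "integral {-pi..pi} (\<lambda>y. f y * cos (real k * y)) = 0"
      by (rule odd_integral_zero) (simp add: o)
    ultimately show ?thesis by (simp add: has_integral_iff)
  qed
  ultimately have "((\<lambda>y. f y * sin (real k * y) * cos (real k * x) - f y * cos (real k * y) * sin (real k * x))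
      has_integral (pi * sine_coeff f k * cos (real k * x) - 0 * sin (real k * x))) {-pi..pi}"
    by (intro has_integral_diff has_integral_mult_left)
  moreover have "f y * sin (real k * y) * cos (real k * x) - f y * cos (real k * y) * sin (real k * x) = g y" for y
    by (simp add: g_def sin_diff algebra_simps)
  ultimately have gi: "(g has_integral (pi * (sine_coeff f k * cos (real k * x)))) {-pi..pi}"
    by (simp add: mult.assoc)
  have "g (y + 2 * pi) = g y" for y
  proof -
    have "sin (real k * (y + 2 * pi - x)) = sin (real k * (y - x) + of_int (int k) * (2 * pi))"
      by (simp add: algebra_simps)
    also have "\<dots> = sin (real k * (y - x))"
      by (rule periodic_int[where f = sin and p = "2 * pi", OF sin_periodic])
    finally show ?thesis using L2_circle_periodic[OF L] by (simp add: g_def)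
  qed
  then have "((\<lambda>t. g (x + t)) has_integral integral {-pi..pi} g) {-pi..pi}"
    by (intro periodic_integral_shift) (use gi in auto)
  moreover have "((\<lambda>t. f x * sin (real k * t)) has_integral 0) {-pi..pi}"
  proof -
    have "(\<lambda>t. f x * sin (real k * t)) integrable_on {-pi..pi}"
      by (intro integrable_continuous_real continuous_intros)
    moreover have "integral {-pi..pi} (\<lambda>t. f x * sin (real k * t)) = 0"
      by (rule odd_integral_zero) simp
    ultimately show ?thesis by (simp add: has_integral_iff)
  qed
  ultimately have "((\<lambda>t. g (x + t) - f x * sin (real k * t)) has_integral (integral {-pi..pi} g - 0)) {-pi..pi}"
    by (rule has_integral_diff)
  then show ?thesis using integral_unique[OF gi] by (simp add: g_def algebra_simps)
qed

definition conjugate_kernel :: "real \<Rightarrow> real \<Rightarrow> real" where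
  "conjugate_kernel r t = r * sin t / (1 - 2 * r * cos t + r\<^sup>2)"

lemma conjugate_poisson_sums:
  assumes f: "odd_L2 f" and cf: "continuous_on UNIV f" and r: "0 < r" "r < 1"
  shows "(\<lambda>k. r ^ k * sine_coeff f k * cos (real k * x)) sums
     (integral {-pi..pi} (\<lambda>t. (f (x + t) - f x) * conjugate_kernel r t) / pi)"
proof -
  define d where "d = (\<lambda>t. f (x + t) - f x)"
  define P where "P = (\<lambda>N t. \<Sum>k<N. r ^ k * sin (real k * t))"
  have "continuous_on S (\<lambda>t. f (x + t))" for S
    by (rule continuous_on_compose2[OF cf]) (auto intro!: continuous_intros)
  then have cd: "continuous_on S d" for S unfolding d_def by (intro continuous_on_diff) auto
  have intP: "((\<lambda>t. d t * P N t) has_integral (\<Sum>k<N. r ^ k * (pi * (sine_coeff f k * cos (real k * x))))) {-pi..pi}" for N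
  proof -
    have "((\<lambda>t. \<Sum>k<N. r ^ k * (d t * sin (real k * t))) has_integral
       (\<Sum>k<N. r ^ k * (pi * (sine_coeff f k * cos (real k * x))))) {-pi..pi}"
      unfolding d_def by (intro has_integral_sum has_integral_mult_right sine_coeff_cos_integral f cf) auto
    then show ?thesis by (simp add: P_def sum_distrib_left mult_ac)
  qed
  have bound: "\<bar>P N t\<bar> \<le> 1 / (1 - r)" for N t
  proof -
    have "\<bar>P N t\<bar> \<le> (\<Sum>k<N. \<bar>r ^ k * sin (real k * t)\<bar>)" unfolding P_def by (rule sum_abs)
    also have "\<dots> \<le> (\<Sum>k<N. \<bar>r ^ k\<bar>)" by (intro sum_mono sine_term_bound)
    also have "\<dots> = (\<Sum>k<N. r ^ k)" using r by simp
    also have "\<dots> \<le> (\<Sum>k. r ^ k)" by (rule sum_le_suminf) (use r in \<open>auto intro: summable_geometric\<close>)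
    also have "\<dots> = 1 / (1 - r)" by (rule suminf_geometric) (use r in auto)
    finally show ?thesis .
  qed
  have "(\<lambda>N. P N t) \<longlonglongrightarrow> conjugate_kernel r t" for t
    using geometric_sums_cis(2)[of r t] r by (simp add: P_def sums_def conjugate_kernel_def)
  from bounded_convergence_weighted(2)[OF absolutely_integrable_continuous_real[OF cd] intP bound this]
  have "(\<lambda>N. (\<Sum>k<N. r ^ k * (pi * (sine_coeff f k * cos (real k * x)))) / pi)
     \<longlonglongrightarrow> integral {-pi..pi} (\<lambda>t. d t * conjugate_kernel r t) / pi"
    by (intro tendsto_divide tendsto_const) simp_all
  then show ?thesis
    by (simp add: sums_def d_def sum_divide_distrib mult.assoc)
qed

text \<open>For an odd function and \<open>r < 1\<close> this is \<open>\<Sum> r\<^sup>k b\<^sub>k cos (k x)\<close>, by \<open>conjugate_poisson_sums\<close>. Subtracting \<open>f x\<close> does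
  not change the integral for \<open>r < 1\<close>, since the kernel is odd; at \<open>r = 1\<close> it makes the integral of a Hoelder continuous function
  converge absolutely. The value there is, up to sign, the conjugate function.\<close>

definition conjugate :: "(real \<Rightarrow> real) \<Rightarrow> real \<Rightarrow> real \<Rightarrow> real" where
  "conjugate f r x = integral {-pi..pi} (\<lambda>t. (f (x + t) - f x) * conjugate_kernel r t) / pi"

lemma cos_less_one: "\<bar>t\<bar> \<le> pi \<Longrightarrow> t \<noteq> 0 \<Longrightarrow> cos t < 1"
  using cos_monotone_0_pi[of 0 "\<bar>t\<bar>"] by simp

lemma conjugate_kernel_measurable:
  "conjugate_kernel r \<in> borel_measurable borel"
  unfolding conjugate_kernel_def by measurable

text \<open>Hoelder continuity compensates the singularity \<open>3/\<bar>t\<bar>\<close> of the kernel: \<open>3 K \<bar>t\<bar>\<^bsup>\<beta> - 1\<^esup>\<close> is an integrable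
  majorant for all \<open>r\<close> in \<open>(0, 1]\<close>.\<close>

context
  fixes f :: "real \<Rightarrow> real" and K \<beta> :: real
  assumes holder: "\<And>x y. \<bar>f x - f y\<bar> \<le> K * \<bar>x - y\<bar> powr \<beta>" and \<beta>: "0 < \<beta>"
begin

lemma conjugate_dominated:
  assumes "0 < r" "r \<le> 1" "t \<in> {-pi..pi}"
  shows "\<bar>(f (x + t) - f x) * conjugate_kernel r t\<bar> \<le> 3 * K * \<bar>t\<bar> powr (\<beta> - 1)"
proof (cases "t = 0")
  case False
  have "\<bar>f (x + t) - f x\<bar> * \<bar>conjugate_kernel r t\<bar> \<le> (K * \<bar>t\<bar> powr \<beta>) * (3 / \<bar>t\<bar>)"
    using holder[of "x + t" x] conjugate_kernel_bound[of r t] assms False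
    by (intro mult_mono) (auto simp: conjugate_kernel_def intro: order_trans[OF abs_ge_zero])
  also have "\<dots> = 3 * K * \<bar>t\<bar> powr (\<beta> - 1)"
    using False powr_diff[of "\<bar>t\<bar>" \<beta> 1] by simp
  finally show ?thesis by (simp add: abs_mult)
qed simp

lemma conjugate_integrable:
  assumes "0 < r" "r \<le> 1"
  shows "(\<lambda>t. (f (x + t) - f x) * conjugate_kernel r t) integrable_on {-pi..pi}"
proof -
  have "continuous_on UNIV (\<lambda>t. f (x + t) - f x)"
    by (intro continuous_on_diff continuous_on_const continuous_on_compose2[OF holder_continuous[OF holder \<beta>, of UNIV]])
      (auto intro!: continuous_intros)
  then have "(\<lambda>t. f (x + t) - f x) \<in> borel_measurable lebesgue" by (rule continuous_measurable_lebesgue)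
  moreover have "conjugate_kernel r \<in> borel_measurable lebesgue"
    using conjugate_kernel_measurable by (simp add: measurable_completion)
  ultimately have "(\<lambda>t. (f (x + t) - f x) * conjugate_kernel r t) \<in> borel_measurable (lebesgue_on {-pi..pi})"
    by (intro measurable_lebesgue_on borel_measurable_times)
  then have "(\<lambda>t. (f (x + t) - f x) * conjugate_kernel r t) absolutely_integrable_on {-pi..pi}"
    by (rule measurable_bounded_by_integrable_imp_absolutely_integrable[where g = "\<lambda>t. 3 * K * \<bar>t\<bar> powr (\<beta> - 1)"])
      (use conjugate_dominated[OF assms] in \<open>auto intro!: integrable_on_mult_right powr_abs_integrable \<beta>\<close>)
  then show ?thesis by (rule set_lebesgue_integral_eq_integral(1))
qed

text \<open>Dominated convergence gives joint continuity up to \<open>r = 1\<close>.\<close>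

lemma conjugate_LIMSEQ:
  assumes r: "\<And>j. 0 < r j" "\<And>j. r j \<le> 1" "r \<longlonglongrightarrow> 1" and x: "xs \<longlonglongrightarrow> x"
  shows "(\<lambda>j. conjugate f (r j) (xs j)) \<longlonglongrightarrow> conjugate f 1 x"
proof -
  have cf: "continuous_on UNIV f" by (rule holder_continuous[OF holder \<beta>])
  have flim: "(\<lambda>j. f (xs j + t)) \<longlonglongrightarrow> f (x + t)" for t
    by (rule continuous_on_tendsto_compose[OF cf tendsto_add[OF x tendsto_const]]) auto
  have klim: "(\<lambda>j. (f (xs j + t) - f (xs j)) * conjugate_kernel (r j) t) \<longlonglongrightarrow> (f (x + t) - f x) * conjugate_kernel 1 t"
    if t: "t \<in> {-pi..pi}" for t
  proof (cases "t = 0")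
    case False
    then have "cos t < 1" using t by (intro cos_less_one) auto
    then have "(\<lambda>j. conjugate_kernel (r j) t) \<longlonglongrightarrow> conjugate_kernel 1 t"
      unfolding conjugate_kernel_def by (intro tendsto_intros r(3)) simp
    then show ?thesis using flim[of t] flim[of 0] by (intro tendsto_intros) simp_all
  qed simp
  have "(\<lambda>j. integral {-pi..pi} (\<lambda>t. (f (xs j + t) - f (xs j)) * conjugate_kernel (r j) t)) \<longlonglongrightarrow>
     integral {-pi..pi} (\<lambda>t. (f (x + t) - f x) * conjugate_kernel 1 t)"
  proof (rule dominated_convergence(2)[where h = "\<lambda>t. 3 * K * \<bar>t\<bar> powr (\<beta> - 1)"])
    show "(\<lambda>t. 3 * K * \<bar>t\<bar> powr (\<beta> - 1)) integrable_on {-pi..pi}"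
      by (intro integrable_on_mult_right powr_abs_integrable \<beta>)
  qed (use conjugate_integrable conjugate_dominated klim r in auto)
  then show ?thesis unfolding conjugate_def by (intro tendsto_divide tendsto_const) simp_all
qed

lemma conjugate_bound:
  assumes "0 < r" "r \<le> 1"
  shows "\<bar>conjugate f r x\<bar> \<le> integral {-pi..pi} (\<lambda>t. 3 * K * \<bar>t\<bar> powr (\<beta> - 1)) / pi"
proof -
  have "norm (integral {-pi..pi} (\<lambda>t. (f (x + t) - f x) * conjugate_kernel r t)) \<le>
     integral {-pi..pi} (\<lambda>t. 3 * K * \<bar>t\<bar> powr (\<beta> - 1))"
    by (rule integral_norm_bound_integral[OF conjugate_integrable[OF assms]])
      (use conjugate_dominated[OF assms] in \<open>auto intro!: integrable_on_mult_right powr_abs_integrable \<beta>\<close>)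
  then show ?thesis by (simp add: conjugate_def divide_right_mono)
qed

lemma conjugate_continuous: "continuous_on UNIV (conjugate f 1)"
proof (intro continuous_at_imp_continuous_on ballI)
  fix x show "isCont (conjugate f 1) x"
    unfolding continuous_at_sequentially o_def using conjugate_LIMSEQ[of "\<lambda>_. 1"] by auto
qed

text \<open>For \<open>r < 1\<close> the series may be differentiated term by term. Integrate this, let \<open>r\<close> tend to \<open>1\<close>
  under the integral, and differentiate the integral of the continuous limit.\<close>

lemma reciprocal_multiplier_derivative:
  assumes f: "odd_L2 f"
  shows "(sine_mult (\<lambda>k. 1 / real k) f has_real_derivative conjugate f 1 x) (at x)"
proof -
  have L: "L2_circle f" using f by (simp add: odd_L2_def)
  have cf: "continuous_on UNIV f" by (rule holder_continuous[OF holder \<beta>])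
  define A where "A = (\<lambda>r. sine_mult (\<lambda>k. 1 / real k * r ^ k) f)"
  have sb: "symbol_bound (\<lambda>k. 1 / real k)" by (simp add: symbol_bound_def divide_right_mono)
  have dA: "(A r has_real_derivative conjugate f r y) (at y)" if r: "0 < r" "r < 1" for r y
  proof -
    have sr: "symbol_bound (\<lambda>k. 1 / real k * r ^ k)"
      unfolding symbol_bound_def
    proof
      fix k
      have "1 / real k * r ^ k \<le> 1 / real k * 2" using r power_le_one[of r k] by (intro mult_left_mono) auto
      then show "\<bar>1 / real k * r ^ k\<bar> \<le> 2 / real k" using r by simp
    qed
    have eq: "real k * (1 / real k * r ^ k) * sine_coeff f k = r ^ k * sine_coeff f k" for k
      by (cases "k = 0") auto
    have "summable (\<lambda>k. r ^ k + (sine_coeff f k)\<^sup>2)"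
      using r by (intro summable_add sine_coeff_square_summable L summable_geometric) auto
    then have "summable (\<lambda>k. \<bar>real k * (1 / real k * r ^ k) * sine_coeff f k\<bar>)"
    proof (rule summable_comparison_test')
      fix k assume "k \<ge> (0::nat)"
      have rk: "0 \<le> r ^ k" "r ^ k \<le> 1" using r by (auto simp: power_le_one)
      have "r ^ k * \<bar>sine_coeff f k\<bar> \<le> (r ^ k)\<^sup>2 + (sine_coeff f k)\<^sup>2"
        using sum_squares_bound[of "r ^ k" "\<bar>sine_coeff f k\<bar>"] mult_nonneg_nonneg[OF rk(1) abs_ge_zero[of "sine_coeff f k"]]
        by simp
      also have "(r ^ k)\<^sup>2 \<le> r ^ k" using rk by (simp add: power2_eq_square mult_left_le)
      finally show "norm \<bar>real k * (1 / real k * r ^ k) * sine_coeff f k\<bar> \<le> r ^ k + (sine_coeff f k)\<^sup>2"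
        using rk by (simp add: eq abs_mult)
    qed
    from sine_mult_has_derivative(1)[OF L sr this, of y]
    have "(A r has_real_derivative (\<Sum>k. r ^ k * sine_coeff f k * cos (real k * y))) (at y)"
      by (simp only: A_def eq)
    also have "(\<Sum>k. r ^ k * sine_coeff f k * cos (real k * y)) = conjugate f r y"
      using conjugate_poisson_sums[OF f cf r, of y] by (simp add: sums_iff conjugate_def)
    finally show ?thesis .
  qed
  define r where "r = (\<lambda>j::nat. 1 - 1 / real (j + 2))"
  have r: "0 < r j" "r j < 1" for j by (auto simp: r_def field_simps)
  have "r \<longlonglongrightarrow> 1 - 0"
    unfolding r_def by (intro tendsto_diff tendsto_const LIMSEQ_ignore_initial_segment[OF lim_1_over_n, of 2])
  then have rlim: "r \<longlonglongrightarrow> 1" by simp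
  have Alim: "(\<lambda>j. A (r j) y) \<longlonglongrightarrow> sine_mult (\<lambda>k. 1 / real k) f y" for y
  proof -
    have "(\<lambda>j. A (r j) y) \<longlonglongrightarrow> A 1 y"
      unfolding A_def
      by (rule continuous_on_tendsto_compose[OF sine_mult_radial_continuous[OF L sb] rlim])
        (use r in \<open>auto intro!: always_eventually less_imp_le\<close>)
    then show ?thesis by (simp add: A_def)
  qed
  have FTC: "(conjugate f 1 has_integral (sine_mult (\<lambda>k. 1 / real k) f b - sine_mult (\<lambda>k. 1 / real k) f a)) {a..b}"
    if "a \<le> b" for a b
  proof (rule has_integral_dominated_convergence)
    show "(conjugate f (r j) has_integral (A (r j) b - A (r j) a)) {a..b}" for j
      by (rule fundamental_theorem_of_calculus[OF that])
        (use dA[OF r, of j] in \<open>auto simp flip: has_real_derivative_iff_has_vector_derivative intro: has_field_derivative_at_within\<close>)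
    show "(\<lambda>y. integral {-pi..pi} (\<lambda>t. 3 * K * \<bar>t\<bar> powr (\<beta> - 1)) / pi) integrable_on {a..b}"
      by (rule integrable_const_ivl)
    show "\<forall>y\<in>{a..b}. norm (conjugate f (r j) y) \<le> integral {-pi..pi} (\<lambda>t. 3 * K * \<bar>t\<bar> powr (\<beta> - 1)) / pi" for j
      using conjugate_bound[of "r j"] r[of j] by simp
    show "\<forall>y\<in>{a..b}. (\<lambda>j. conjugate f (r j) y) \<longlonglongrightarrow> conjugate f 1 y"
      using conjugate_LIMSEQ[of r "\<lambda>_. y" y for y] r rlim less_imp_le by blast
    show "(\<lambda>j. A (r j) b - A (r j) a) \<longlonglongrightarrow> sine_mult (\<lambda>k. 1 / real k) f b - sine_mult (\<lambda>k. 1 / real k) f a"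
      by (intro tendsto_diff Alim)
  qed
  have "((\<lambda>y. integral {x - 1..y} (conjugate f 1)) has_real_derivative conjugate f 1 x) (at x within {x - 1..x + 1})"
    by (rule integral_has_real_derivative) (use continuous_on_subset[OF conjugate_continuous] in auto)
  then have "((\<lambda>y. integral {x - 1..y} (conjugate f 1) + sine_mult (\<lambda>k. 1 / real k) f (x - 1))
      has_real_derivative conjugate f 1 x) (at x within {x - 1..x + 1})"
    by (auto intro!: derivative_eq_intros)
  then have "(sine_mult (\<lambda>k. 1 / real k) f has_real_derivative conjugate f 1 x) (at x within {x - 1..x + 1})"
    by (rule has_field_derivative_transform_within[where d = 1]) (use integral_unique[OF FTC] in auto)
  then show ?thesis by (simp add: at_within_Icc_at)
qed

text \<open>The symbol differs from \<open>1/k\<close> by \<open>O(1/k\<^sup>3)\<close>, so the difference may be differentiated term by term.\<close>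

theorem Sn_derivative:
  assumes f: "odd_L2 f" and n: "n \<ge> 3"
  shows "\<exists>D. continuous_on UNIV D \<and> (\<forall>x. (sine_mult (Sn_symbol n) f has_real_derivative D x) (at x))"
proof -
  have L: "L2_circle f" using f by (simp add: odd_L2_def)
  define m where "m = (\<lambda>k. Sn_symbol n k - 1 / real k)"
  have mk: "\<bar>m k\<bar> \<le> 2 / real k \<and> \<bar>real k * m k\<bar> \<le> 2 / real k" for k
  proof (cases "k = 0")
    case False
    define N where "N = (real n)\<^sup>2 * (real k)\<^sup>2"
    have N: "N \<ge> 9" "N \<ge> 9 * (real k)\<^sup>2" using nk_square_ge[OF n False] by (auto simp: N_def)
    have k: "real k \<ge> 1" using False by simp
    then have k2: "real k \<le> (real k)\<^sup>2" by (simp add: power2_eq_square)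
    have "real k * m k = (N - 1) / (N - 4) - 1"
      using False by (simp add: m_def Sn_symbol_def N_def right_diff_distrib)
    also have "\<dots> = 3 / (N - 4)" using N by (simp add: field_simps)
    finally have mm: "real k * m k = 3 / (N - 4)" .
    have "9 * real k \<le> 9 * (real k)\<^sup>2" using k2 by simp
    then have "9 * real k \<le> N" using N(2) by (rule order_trans)
    then have "3 * real k \<le> 2 * (N - 4)" using k by (simp add: algebra_simps)
    then have 1: "3 / (N - 4) \<le> 2 / real k"
      using N(1) k frac_le_eq[of "N - 4" "real k" 3 2] by (simp add: divide_le_0_iff)
    have 2: "\<bar>real k * m k\<bar> \<le> 2 / real k" using 1 N unfolding mm by simp
    have "\<bar>m k\<bar> \<le> \<bar>real k * m k\<bar>" using k by (simp add: abs_mult mult_le_cancel_right1)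
    then show ?thesis using 2 by simp
  qed (simp add: m_def Sn_symbol_def)
  then have sm: "symbol_bound m" and skm: "symbol_bound (\<lambda>k. real k * m k)" by (auto simp: symbol_bound_def)
  have sb: "symbol_bound (\<lambda>k. 1 / real k)" by (simp add: symbol_bound_def divide_right_mono)
  have split: "sine_mult (Sn_symbol n) f = (\<lambda>x. sine_mult (\<lambda>k. 1 / real k) f x + sine_mult m f x)"
  proof
    fix x
    have "(\<lambda>k. 1 / real k * sine_coeff f k * sin (real k * x) + m k * sine_coeff f k * sin (real k * x)) sums
       (sine_mult (\<lambda>k. 1 / real k) f x + sine_mult m f x)"
      unfolding sine_mult_def by (intro sums_add summable_sums sine_mult_summable[OF L sb] sine_mult_summable[OF L sm])
    then show "sine_mult (Sn_symbol n) f x = sine_mult (\<lambda>k. 1 / real k) f x + sine_mult m f x"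
      by (simp add: sine_mult_def[of "Sn_symbol n"] m_def sums_iff algebra_simps)
  qed
  note dm = sine_mult_has_derivative[OF L sm symbol_abs_summable[OF L skm]]
  show ?thesis
    unfolding split using dm reciprocal_multiplier_derivative[OF f] conjugate_continuous
    by (intro exI[of _ "\<lambda>x. conjugate f 1 x + (\<Sum>k. real k * m k * sine_coeff f k * cos (real k * x))"])
      (auto intro!: continuous_on_add DERIV_add)
qed

end

section \<open>Primitives of integrable functions\<close>

text \<open>Absolute continuity, expressed through the integral: the derivative \<open>u\<close> is known only up to null sets, so
  the product and chain rules are proved from increments and not from difference quotients.\<close>

definition primitive_on :: "real \<Rightarrow> real \<Rightarrow> (real \<Rightarrow> real) \<Rightarrow> (real \<Rightarrow> real) \<Rightarrow> bool" where
  "primitive_on a b U u \<longleftrightarrow> u absolutely_integrable_on {a..b} \<and>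
     (\<forall>x\<in>{a..b}. U x = U a + integral {a..x} u)"

lemma primitive_on_eq: "primitive_on a b U u \<Longrightarrow> x \<in> {a..b} \<Longrightarrow> U x = U a + integral {a..x} u"
  unfolding primitive_on_def by blast

lemma primitive_on_abs: "primitive_on a b U u \<Longrightarrow> u absolutely_integrable_on {a..b}"
  unfolding primitive_on_def by blast

lemma primitive_on_integrable:
  assumes "primitive_on a b U u" "a \<le> x" "y \<le> b"
  shows "u absolutely_integrable_on {x..y}" "u integrable_on {x..y}"
proof -
  show "u absolutely_integrable_on {x..y}"
    by (rule absolutely_integrable_on_subinterval[OF primitive_on_abs[OF assms(1)]]) (use assms in auto)
  then show "u integrable_on {x..y}" by (rule set_lebesgue_integral_eq_integral(1))
qed

lemma primitive_on_diff:
  assumes U: "primitive_on a b U u" and "a \<le> x" "x \<le> y" "y \<le> b"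
  shows "(u has_integral (U y - U x)) {x..y}"
proof -
  have "integral {a..x} u + integral {x..y} u = integral {a..y} u"
    by (rule Henstock_Kurzweil_Integration.integral_combine) (use assms primitive_on_integrable[OF U, of a y] in auto)
  moreover have "U x = U a + integral {a..x} u" "U y = U a + integral {a..y} u"
    by (rule primitive_on_eq[OF U]; use assms in simp)+
  ultimately show ?thesis
    using primitive_on_integrable(2)[OF U, of x y] assms by (simp add: has_integral_iff)
qed

lemma primitive_on_continuous:
  assumes U: "primitive_on a b U u" shows "continuous_on {a..b} U"
proof (cases "a \<le> b")
  case True
  have "u integrable_on {a..b}" using primitive_on_integrable(2)[OF U] by simp
  then have "continuous_on {a..b} (\<lambda>x. U a + integral {a..x} u)"
    by (intro continuous_on_add continuous_on_const indefinite_integral_continuous_1)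
  then show ?thesis by (rule continuous_on_eq) (rule primitive_on_eq[OF U, symmetric])
qed simp

lemma primitive_on_subinterval:
  assumes U: "primitive_on a b U u" and "a \<le> c" "c \<le> d" "d \<le> b"
  shows "primitive_on c d U u"
  unfolding primitive_on_def
proof (intro conjI ballI)
  show "u absolutely_integrable_on {c..d}" using primitive_on_integrable(1)[OF U] assms by simp
  fix x assume "x \<in> {c..d}"
  then show "U x = U c + integral {c..x} u"
    using integral_unique[OF primitive_on_diff[OF U, of c x]] assms by simp
qed

lemma continuous_times_integrable:
  fixes u W :: "real \<Rightarrow> real"
  assumes u: "u absolutely_integrable_on {a..b}" and W: "continuous_on {a..b} W"
  shows "(\<lambda>x. u x * W x) absolutely_integrable_on {a..b}"
proof -
  obtain B where B: "\<And>x. x \<in> {a..b} \<Longrightarrow> \<bar>W x\<bar> \<le> B"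
    using continuous_on_Icc_bounded[OF W] by blast
  show ?thesis
  proof (rule measurable_bounded_by_integrable_imp_absolutely_integrable[where g = "\<lambda>x. B * \<bar>u x\<bar>"])
    have "W \<in> borel_measurable (lebesgue_on {a..b})"
      by (rule absolutely_integrable_imp_borel_measurable[OF absolutely_integrable_continuous_real[OF W]]) simp
    moreover have "u \<in> borel_measurable (lebesgue_on {a..b})"
      by (rule absolutely_integrable_imp_borel_measurable[OF u]) simp
    ultimately show "(\<lambda>x. u x * W x) \<in> borel_measurable (lebesgue_on {a..b})"
      by (intro borel_measurable_times)
    show "(\<lambda>x. B * \<bar>u x\<bar>) integrable_on {a..b}"
      using set_integrable_abs[OF u] by (intro integrable_on_mult_right set_lebesgue_integral_eq_integral(1))
    show "norm (u x * W x) \<le> B * \<bar>u x\<bar>" if "x \<in> {a..b}" for x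
      using mult_left_mono[OF B[OF that], of "\<bar>u x\<bar>"] by (simp add: abs_mult mult.commute)
  qed simp
qed

text \<open>Subdivide the interval: increments that are small compared with those of a fixed function \<open>A\<close>
  add up to something small compared with \<open>A b - A a\<close>.\<close>

lemma eq_if_small_increments:
  fixes F A :: "real \<Rightarrow> real"
  assumes ab: "a \<le> b"
    and small: "\<And>\<epsilon>. \<epsilon> > 0 \<Longrightarrow> \<exists>\<delta>>0. \<forall>x y. a \<le> x \<and> x \<le> y \<and> y \<le> b \<and> y - x < \<delta> \<longrightarrow> \<bar>F y - F x\<bar> \<le> \<epsilon> * (A y - A x)"
  shows "F b = F a"
proof -
  have le: "\<bar>F b - F a\<bar> \<le> \<epsilon> * (A b - A a)" if \<epsilon>: "\<epsilon> > 0" for \<epsilon>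
  proof -
    obtain \<delta> where \<delta>: "\<delta> > 0" "\<And>x y. a \<le> x \<Longrightarrow> x \<le> y \<Longrightarrow> y \<le> b \<Longrightarrow> y - x < \<delta> \<Longrightarrow> \<bar>F y - F x\<bar> \<le> \<epsilon> * (A y - A x)"
      using small[OF \<epsilon>] by blast
    obtain N where N: "(b - a) / \<delta> < real N" using reals_Archimedean2 by blast
    have N0: "N > 0" using N ab \<delta>(1) by (cases N) (auto simp: divide_less_0_iff)
    define h where "h = (b - a) / real N"
    have h: "0 \<le> h" "h < \<delta>" using N N0 ab \<delta>(1) by (auto simp: h_def field_simps)
    define p where "p = (\<lambda>i. a + real i * h)"
    have pN: "p N = b" using N0 by (simp add: p_def h_def)
    have "\<bar>F b - F a\<bar> = \<bar>\<Sum>i<N. F (p (Suc i)) - F (p i)\<bar>"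
      using sum_lessThan_telescope[of "\<lambda>i. F (p i)" N] pN by (simp add: p_def)
    also have "\<dots> \<le> (\<Sum>i<N. \<bar>F (p (Suc i)) - F (p i)\<bar>)" by (rule sum_abs)
    also have "\<dots> \<le> (\<Sum>i<N. \<epsilon> * (A (p (Suc i)) - A (p i)))"
    proof (rule sum_mono)
      fix i assume "i \<in> {..<N}"
      then have "p (Suc i) \<le> p N" unfolding p_def using h by (intro add_left_mono mult_right_mono) auto
      then show "\<bar>F (p (Suc i)) - F (p i)\<bar> \<le> \<epsilon> * (A (p (Suc i)) - A (p i))"
        using h pN by (intro \<delta>(2)) (auto simp: p_def algebra_simps)
    qed
    also have "\<dots> = \<epsilon> * (A b - A a)"
      using sum_lessThan_telescope[of "\<lambda>i. A (p i)" N] pN by (simp add: p_def flip: sum_distrib_left)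
    finally show ?thesis .
  qed
  have "A b - A a \<ge> 0" using le[of 1] by simp
  then have "\<bar>F b - F a\<bar> \<le> e" if "e > 0" for e
  proof -
    have "\<bar>F b - F a\<bar> \<le> e / (A b - A a + 1) * (A b - A a)"
      using le[of "e / (A b - A a + 1)"] \<open>A b - A a \<ge> 0\<close> that by simp
    also have "\<dots> \<le> e" using \<open>A b - A a \<ge> 0\<close> that by (simp add: field_simps)
    finally show ?thesis .
  qed
  then have "\<bar>F b - F a\<bar> \<le> 0" by (rule field_le_epsilon) simp
  then show ?thesis by simp
qed

lemma uniformly_continuous_Icc:
  fixes f :: "real \<Rightarrow> real"
  assumes "continuous_on {a..b} f" "\<epsilon> > 0"
  obtains \<delta> where "\<delta> > 0" "\<And>x y. x \<in> {a..b} \<Longrightarrow> y \<in> {a..b} \<Longrightarrow> \<bar>x - y\<bar> < \<delta> \<Longrightarrow> \<bar>f x - f y\<bar> < \<epsilon>"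
proof -
  have "uniformly_continuous_on {a..b} f" by (rule compact_uniformly_continuous[OF assms(1)]) simp
  then obtain \<delta> where "\<delta> > 0" "\<forall>x\<in>{a..b}. \<forall>x'\<in>{a..b}. dist x' x < \<delta> \<longrightarrow> dist (f x') (f x) < \<epsilon>"
    unfolding uniformly_continuous_on_def using assms(2) by blast
  then show thesis using that by (auto simp: dist_real_def)
qed

text \<open>On a short interval \<open>{x..y}\<close> the increment of \<open>U W\<close> is the integral of \<open>u W y + w U x\<close>. By uniform continuity it
  differs from the integral of \<open>u W + w U\<close> by at most \<open>\<epsilon> \<integral> (\<bar>u\<bar> + \<bar>w\<bar>)\<close>.\<close>

lemma primitive_on_mult_Icc:
  assumes ab: "a \<le> b" and U: "primitive_on a b U u" and W: "primitive_on a b W w"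
  shows "((\<lambda>s. u s * W s + w s * U s) has_integral (U b * W b - U a * W a)) {a..b}"
proof -
  note cU = primitive_on_continuous[OF U] and cW = primitive_on_continuous[OF W]
  define v where "v = (\<lambda>s. u s * W s + w s * U s)"
  note au = primitive_on_abs[OF U] and aw = primitive_on_abs[OF W]
  have av: "v absolutely_integrable_on {a..b}"
    unfolding v_def by (intro set_integral_add(1) continuous_times_integrable au aw cU cW)
  define F where "F = (\<lambda>x. U x * W x - integral {a..x} v)"
  have aA: "(\<lambda>s. \<bar>u s\<bar> + \<bar>w s\<bar>) absolutely_integrable_on {a..b}"
    by (intro set_integral_add(1) set_integrable_abs au aw)
  define A where "A = (\<lambda>x. integral {a..x} (\<lambda>s. \<bar>u s\<bar> + \<bar>w s\<bar>))"
  have primA: "primitive_on a b A (\<lambda>s. \<bar>u s\<bar> + \<bar>w s\<bar>)" using aA by (simp add: primitive_on_def A_def)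
  have primV: "primitive_on a b (\<lambda>x. integral {a..x} v) v" using av by (simp add: primitive_on_def)
  have "F b = F a"
  proof (rule eq_if_small_increments[OF ab, where A = A])
    fix \<epsilon> :: real assume \<epsilon>: "\<epsilon> > 0"
    obtain d1 where d1: "d1 > 0" "\<And>x y. x \<in> {a..b} \<Longrightarrow> y \<in> {a..b} \<Longrightarrow> \<bar>x - y\<bar> < d1 \<Longrightarrow> \<bar>U x - U y\<bar> < \<epsilon>"
      using uniformly_continuous_Icc[OF cU \<epsilon>] by blast
    obtain d2 where d2: "d2 > 0" "\<And>x y. x \<in> {a..b} \<Longrightarrow> y \<in> {a..b} \<Longrightarrow> \<bar>x - y\<bar> < d2 \<Longrightarrow> \<bar>W x - W y\<bar> < \<epsilon>"
      using uniformly_continuous_Icc[OF cW \<epsilon>] by blast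
    have "\<bar>F y - F x\<bar> \<le> \<epsilon> * (A y - A x)" if xy: "a \<le> x" "x \<le> y" "y \<le> b" "y - x < min d1 d2" for x y
    proof -
      have "((\<lambda>s. u s * W y + w s * U x - v s) has_integral ((U y - U x) * W y + (W y - W x) * U x -
          (integral {a..y} v - integral {a..x} v))) {x..y}"
        by (intro has_integral_diff has_integral_add has_integral_mult_left primitive_on_diff[OF U] primitive_on_diff[OF W]
           primitive_on_diff[OF primV] xy)
      moreover have "(U y - U x) * W y + (W y - W x) * U x - (integral {a..y} v - integral {a..x} v) = F y - F x"
        by (simp add: F_def algebra_simps)
      ultimately have 1: "((\<lambda>s. u s * W y + w s * U x - v s) has_integral (F y - F x)) {x..y}" by simp
      have 2: "((\<lambda>s. \<epsilon> * (\<bar>u s\<bar> + \<bar>w s\<bar>)) has_integral \<epsilon> * (A y - A x)) {x..y}"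
        by (intro has_integral_mult_right primitive_on_diff[OF primA] xy)
      have "norm (u s * W y + w s * U x - v s) \<le> \<epsilon> * (\<bar>u s\<bar> + \<bar>w s\<bar>)" if s: "s \<in> {x..y}" for s
      proof -
        have "\<bar>W y - W s\<bar> \<le> \<epsilon>" "\<bar>U x - U s\<bar> \<le> \<epsilon>"
          using d2(2)[of y s] d1(2)[of x s] s xy by force+
        then have le: "\<bar>u s\<bar> * \<bar>W y - W s\<bar> + \<bar>w s\<bar> * \<bar>U x - U s\<bar> \<le> \<bar>u s\<bar> * \<epsilon> + \<bar>w s\<bar> * \<epsilon>"
          by (intro add_mono mult_left_mono) auto
        have "u s * W y + w s * U x - v s = u s * (W y - W s) + w s * (U x - U s)"
          by (simp add: v_def algebra_simps)
        then have "norm (u s * W y + w s * U x - v s) \<le> \<bar>u s * (W y - W s)\<bar> + \<bar>w s * (U x - U s)\<bar>"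
          using abs_triangle_ineq[of "u s * (W y - W s)" "w s * (U x - U s)"] by (simp only: real_norm_def)
        also have "\<dots> \<le> \<bar>u s\<bar> * \<epsilon> + \<bar>w s\<bar> * \<epsilon>"
          using le by (simp only: abs_mult)
        finally show ?thesis by (simp add: algebra_simps)
      qed
      then have "norm (integral {x..y} (\<lambda>s. u s * W y + w s * U x - v s)) \<le> integral {x..y} (\<lambda>s. \<epsilon> * (\<bar>u s\<bar> + \<bar>w s\<bar>))"
        by (intro integral_norm_bound_integral has_integral_integrable[OF 1] has_integral_integrable[OF 2])
      then show ?thesis unfolding integral_unique[OF 1] integral_unique[OF 2] real_norm_def .
    qed
    then show "\<exists>\<delta>>0. \<forall>x y. a \<le> x \<and> x \<le> y \<and> y \<le> b \<and> y - x < \<delta> \<longrightarrow> \<bar>F y - F x\<bar> \<le> \<epsilon> * (A y - A x)"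
      using d1(1) d2(1) by (intro exI[of _ "min d1 d2"]) auto
  qed
  then have "integral {a..b} v = U b * W b - U a * W a" by (simp add: F_def)
  moreover have "v integrable_on {a..b}" using av by (rule set_lebesgue_integral_eq_integral(1))
  ultimately show ?thesis unfolding v_def[symmetric] by (simp add: has_integral_iff)
qed

lemma primitive_on_mult:
  assumes U: "primitive_on a b U u" and W: "primitive_on a b W w"
  shows "primitive_on a b (\<lambda>x. U x * W x) (\<lambda>s. u s * W s + w s * U s)"
  unfolding primitive_on_def
proof (intro conjI ballI)
  show "(\<lambda>s. u s * W s + w s * U s) absolutely_integrable_on {a..b}"
    by (intro set_integral_add(1) continuous_times_integrable primitive_on_continuous[OF U]
        primitive_on_continuous[OF W] primitive_on_abs[OF U] primitive_on_abs[OF W])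
  fix x assume x: "x \<in> {a..b}"
  have "((\<lambda>s. u s * W s + w s * U s) has_integral (U x * W x - U a * W a)) {a..x}"
    using x by (intro primitive_on_mult_Icc primitive_on_subinterval[OF U] primitive_on_subinterval[OF W]) auto
  then show "U x * W x = U a * W a + integral {a..x} (\<lambda>s. u s * W s + w s * U s)"
    by (simp add: integral_unique)
qed

text \<open>By the mean value theorem the increment of \<open>\<phi> \<circ> V\<close> on a short interval is \<open>\<phi>' (V \<eta>)\<close> times that of \<open>V\<close>,
  and \<open>\<phi>' \<circ> V\<close> is uniformly continuous.\<close>

lemma primitive_on_chain:
  fixes \<phi> \<phi>' V D :: "real \<Rightarrow> real"
  assumes V: "primitive_on a b V D"
    and \<phi>: "\<And>x. x \<in> {a..b} \<Longrightarrow> (\<phi> has_real_derivative \<phi>' (V x)) (at (V x))"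
    and c\<phi>': "continuous_on {a..b} (\<lambda>x. \<phi>' (V x))"
  shows "primitive_on a b (\<lambda>x. \<phi> (V x)) (\<lambda>s. D s * \<phi>' (V s))"
proof -
  note cV = primitive_on_continuous[OF V]
  note aD = primitive_on_abs[OF V]
  define v where "v = (\<lambda>s. D s * \<phi>' (V s))"
  have av: "v absolutely_integrable_on {a..b}" unfolding v_def by (rule continuous_times_integrable[OF aD c\<phi>'])
  define F where "F = (\<lambda>x. \<phi> (V x) - integral {a..x} v)"
  define A where "A = (\<lambda>x. integral {a..x} (\<lambda>s. \<bar>D s\<bar>))"
  have primA: "primitive_on a b A (\<lambda>s. \<bar>D s\<bar>)" using set_integrable_abs[OF aD] by (simp add: primitive_on_def A_def)
  have primV: "primitive_on a b (\<lambda>x. integral {a..x} v) v" using av by (simp add: primitive_on_def)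
  have F: "F c = F a" if c: "c \<in> {a..b}" for c
  proof (rule eq_if_small_increments[where F = F and A = A and a = a and b = c])
    show "a \<le> c" using c by simp
    fix \<epsilon> :: real assume \<epsilon>: "\<epsilon> > 0"
    obtain d where d: "d > 0" "\<And>x y. x \<in> {a..b} \<Longrightarrow> y \<in> {a..b} \<Longrightarrow> \<bar>x - y\<bar> < d \<Longrightarrow> \<bar>\<phi>' (V x) - \<phi>' (V y)\<bar> < \<epsilon>"
      using uniformly_continuous_Icc[OF c\<phi>' \<epsilon>] by blast
    have "\<bar>F y - F x\<bar> \<le> \<epsilon> * (A y - A x)" if xy: "a \<le> x" "x \<le> y" "y \<le> c" "y - x < d" for x y
    proof -
      have cVxy: "continuous_on {x..y} V" by (rule continuous_on_subset[OF cV]) (use xy c in auto)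
      have sub: "closed_segment (V x) (V y) \<subseteq> V ` {x..y}"
      proof -
        have "connected (V ` {x..y})" by (rule connected_continuous_image[OF cVxy]) simp
        then show ?thesis using xy by (simp add: connected_convex_1 closed_segment_subset)
      qed
      \<comment> \<open>The mean value theorem, with the intermediate point in the form \<open>V \<eta>\<close>.\<close>
      have "\<exists>\<eta>\<in>{x..y}. \<phi> (V y) - \<phi> (V x) = (V y - V x) * \<phi>' (V \<eta>)"
      proof -
        have mvt: "\<exists>\<eta>\<in>{x..y}. \<phi> q - \<phi> p = (q - p) * \<phi>' (V \<eta>)" if pq: "p < q" "{p..q} \<subseteq> V ` {x..y}" for p q
        proof -
          have "\<exists>z. p < z \<and> z < q \<and> \<phi> q - \<phi> p = (q - p) * \<phi>' z"
          proof (rule MVT2[OF pq(1)])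
            fix z assume "p \<le> z" "z \<le> q"
            then obtain \<eta> where "\<eta> \<in> {x..y}" "z = V \<eta>" using pq(2) by force
            then show "(\<phi> has_real_derivative \<phi>' z) (at z)" using \<phi>[of \<eta>] xy c by auto
          qed
          then obtain z where "p < z" "z < q" and z: "\<phi> q - \<phi> p = (q - p) * \<phi>' z" by blast
          then have "z \<in> V ` {x..y}" using pq(2) by auto
          then show ?thesis using z by blast
        qed
        show ?thesis
        proof (cases "V x" "V y" rule: linorder_cases)
          case less
          then show ?thesis using mvt[of "V x" "V y"] sub by (simp add: closed_segment_eq_real_ivl)
        next
          case equal
          then show ?thesis using xy by auto
        next
          case greater
          then obtain \<eta> where "\<eta> \<in> {x..y}" "\<phi> (V x) - \<phi> (V y) = (V x - V y) * \<phi>' (V \<eta>)"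
            using mvt[of "V y" "V x"] sub by (auto simp: closed_segment_eq_real_ivl)
          then show ?thesis by (intro bexI[of _ \<eta>]) (auto simp: algebra_simps)
        qed
      qed
      then obtain \<eta> where \<eta>: "\<eta> \<in> {x..y}" "\<phi> (V y) - \<phi> (V x) = (V y - V x) * \<phi>' (V \<eta>)" by blast
      have "((\<lambda>s. D s * \<phi>' (V \<eta>) - v s) has_integral ((V y - V x) * \<phi>' (V \<eta>) - (integral {a..y} v - integral {a..x} v))) {x..y}"
        using xy c by (intro has_integral_diff has_integral_mult_left primitive_on_diff[OF V] primitive_on_diff[OF primV]) auto
      moreover have "(V y - V x) * \<phi>' (V \<eta>) - (integral {a..y} v - integral {a..x} v) = F y - F x"
        by (simp add: F_def \<eta>(2)[symmetric])
      ultimately have 1: "((\<lambda>s. D s * \<phi>' (V \<eta>) - v s) has_integral (F y - F x)) {x..y}" by simp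
      have 2: "((\<lambda>s. \<epsilon> * \<bar>D s\<bar>) has_integral \<epsilon> * (A y - A x)) {x..y}"
        using xy c by (intro has_integral_mult_right primitive_on_diff[OF primA]) auto
      have "norm (D s * \<phi>' (V \<eta>) - v s) \<le> \<epsilon> * \<bar>D s\<bar>" if s: "s \<in> {x..y}" for s
      proof -
        have "\<bar>\<phi>' (V \<eta>) - \<phi>' (V s)\<bar> \<le> \<epsilon>" using d(2)[of \<eta> s] s \<eta>(1) xy c by force
        then have "\<bar>D s\<bar> * \<bar>\<phi>' (V \<eta>) - \<phi>' (V s)\<bar> \<le> \<bar>D s\<bar> * \<epsilon>" by (rule mult_left_mono) simp
        then show ?thesis by (simp add: v_def mult.commute flip: abs_mult right_diff_distrib)
      qed
      then have "norm (integral {x..y} (\<lambda>s. D s * \<phi>' (V \<eta>) - v s)) \<le> integral {x..y} (\<lambda>s. \<epsilon> * \<bar>D s\<bar>)"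
        by (intro integral_norm_bound_integral has_integral_integrable[OF 1] has_integral_integrable[OF 2])
      then show ?thesis unfolding integral_unique[OF 1] integral_unique[OF 2] real_norm_def .
    qed
    then show "\<exists>\<delta>>0. \<forall>x y. a \<le> x \<and> x \<le> y \<and> y \<le> c \<and> y - x < \<delta> \<longrightarrow> \<bar>F y - F x\<bar> \<le> \<epsilon> * (A y - A x)"
      using d(1) by blast
  qed
  show ?thesis
    unfolding primitive_on_def v_def[symmetric]
  proof (intro conjI ballI av)
    fix x assume "x \<in> {a..b}"
    from F[OF this] show "\<phi> (V x) = \<phi> (V a) + integral {a..x} v" by (simp add: F_def)
  qed
qed

text \<open>The linear equation \<open>H' = q H V' / V\<close>: by the product and chain rules \<open>H V\<^bsup>-q\<^esup>\<close> has derivative \<open>0\<close>.\<close>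

lemma primitive_ode:
  fixes H V :: "real \<Rightarrow> real"
  assumes H: "primitive_on a b H h" and V: "primitive_on a b V D"
    and pos: "\<And>x. x \<in> {a..b} \<Longrightarrow> V x > 0"
    and N: "negligible N" and eq: "\<And>x. x \<in> {a..b} \<Longrightarrow> x \<notin> N \<Longrightarrow> h x * V x = q * H x * D x"
    and x: "x \<in> {a..b}"
  shows "H x * V x powr (- q) = H a * V a powr (- q)"
proof -
  have W: "primitive_on a b (\<lambda>x. V x powr (- q)) (\<lambda>s. D s * (- q * V s powr (- q - 1)))"
  proof (rule primitive_on_chain[OF V])
    show "((\<lambda>z. z powr (- q)) has_real_derivative - q * V x powr (- q - 1)) (at (V x))" if "x \<in> {a..b}" for x
      using pos[OF that] by (auto intro!: derivative_eq_intros)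
    show "continuous_on {a..b} (\<lambda>x. - q * V x powr (- q - 1))"
      by (intro continuous_intros primitive_on_continuous[OF V]) (use pos in force)
  qed
  have P: "primitive_on a b (\<lambda>x. H x * V x powr (- q))
      (\<lambda>s. h s * V s powr (- q) + (D s * (- q * V s powr (- q - 1))) * H s)"
    by (rule primitive_on_mult[OF H W])
  have "integral {a..x} (\<lambda>s. h s * V s powr (- q) + (D s * (- q * V s powr (- q - 1))) * H s) = integral {a..x} (\<lambda>s. 0)"
  proof (rule integral_spike[OF N])
    fix s assume s: "s \<in> {a..x} - N"
    then have s': "s \<in> {a..b}" using x by auto
    have "V s powr (- q - 1) = V s powr (- q) / V s"
      using pos[OF s'] powr_diff[of "V s" "- q" 1] by simp
    moreover have "h s = q * H s * D s / V s" using eq[of s] s s' pos[OF s'] by (simp add: field_simps)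
    ultimately show "0 = h s * V s powr (- q) + (D s * (- q * V s powr (- q - 1))) * H s"
      by simp
  qed
  then show ?thesis using primitive_on_eq[OF P x] by simp
qed

section \<open>Weak derivatives on the circle\<close>

lemma smooth_circle_derivative:
  assumes "smooth_circle \<psi>"
  shows "(\<psi> has_real_derivative deriv \<psi> x) (at x)" "continuous_on S (deriv \<psi>)" "continuous_on S \<psi>"
proof -
  have d: "\<And>j x. (deriv ^^ j) \<psi> differentiable at x" using assms by (simp add: smooth_circle_def)
  show "(\<psi> has_real_derivative deriv \<psi> x) (at x)" for x
    using d[of 0 x] by (simp add: DERIV_deriv_iff_real_differentiable)
  then show "continuous_on S \<psi>" by (meson DERIV_isCont continuous_at_imp_continuous_on)
  have "(deriv \<psi> has_real_derivative deriv (deriv \<psi>) x) (at x)" for x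
    using d[of 1 x] by (simp add: DERIV_deriv_iff_real_differentiable)
  then show "continuous_on S (deriv \<psi>)" by (meson DERIV_isCont continuous_at_imp_continuous_on)
qed

text \<open>Polynomials in \<open>cos x\<close> and \<open>sin x\<close>, as real polynomial functions on the unit circle.\<close>

definition trig_poly :: "(real \<Rightarrow> real) \<Rightarrow> bool" where
  "trig_poly q \<longleftrightarrow> (\<exists>p :: complex \<Rightarrow> real. real_polynomial_function p \<and> q = (\<lambda>x. p (cis x)))"

text \<open>For a linear form \<open>l\<close> the derivative of \<open>l (cis x)\<close> is \<open>l (\<i> cis x)\<close>; sums and products follow by
  induction.\<close>

lemma trig_poly_derivative:
  assumes "trig_poly q"
  shows "\<exists>q'. trig_poly q' \<and> (\<forall>x. (q has_real_derivative q' x) (at x))"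
proof -
  obtain p :: "complex \<Rightarrow> real" where p: "real_polynomial_function p" "q = (\<lambda>x. p (cis x))"
    using assms by (auto simp: trig_poly_def)
  have "\<exists>p'. real_polynomial_function p' \<and> (\<forall>x. ((\<lambda>x. p (cis x)) has_real_derivative p' (cis x)) (at x))"
    using p(1)
  proof (induction p)
    case (linear l)
    have "((\<lambda>x. l (cis x)) has_real_derivative l (\<i> * cis x)) (at x)" for x
    proof -
      have l: "l (a *\<^sub>R 1 + b *\<^sub>R \<i>) = a * l 1 + b * l \<i>" for a b
        using linear_add[OF bounded_linear.linear[OF linear]] linear_scale[OF bounded_linear.linear[OF linear]]
        by simp
      have "cis y = cos y *\<^sub>R 1 + sin y *\<^sub>R \<i>" "\<i> * cis y = (- sin y) *\<^sub>R 1 + cos y *\<^sub>R \<i>" for y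
        by (simp_all add: complex_eq_iff)
      then have "l (cis y) = cos y * l 1 + sin y * l \<i>" "l (\<i> * cis y) = - sin y * l 1 + cos y * l \<i>" for y
        using l[of "cos y" "sin y"] l[of "- sin y" "cos y"] by simp_all
      then show ?thesis by (auto intro!: derivative_eq_intros)
    qed
    moreover have "bounded_linear (\<lambda>z. l (\<i> * z))"
      by (rule bounded_linear_compose[OF linear bounded_linear_mult_right])
    ultimately show ?case by (intro exI[of _ "\<lambda>z. l (\<i> * z)"]) auto
  next
    case (const c)
    show ?case by (intro exI[of _ "\<lambda>_. 0"]) auto
  next
    case (add f g)
    then obtain f' g' where "real_polynomial_function f'" "real_polynomial_function g'"
      "\<And>x. ((\<lambda>x. f (cis x)) has_real_derivative f' (cis x)) (at x)"
      "\<And>x. ((\<lambda>x. g (cis x)) has_real_derivative g' (cis x)) (at x)" by auto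
    then show ?case by (intro exI[of _ "\<lambda>z. f' z + g' z"]) (auto intro!: DERIV_add)
  next
    case (mult f g)
    then obtain f' g' where "real_polynomial_function f'" "real_polynomial_function g'"
      "\<And>x. ((\<lambda>x. f (cis x)) has_real_derivative f' (cis x)) (at x)"
      "\<And>x. ((\<lambda>x. g (cis x)) has_real_derivative g' (cis x)) (at x)" by auto
    note fg = this
    have "real_polynomial_function (\<lambda>z. f' z * g z + g' z * f z)"
      using mult(1,2) fg(1,2) by (intro real_polynomial_function.intros(3,4))
    moreover have "((\<lambda>x. f (cis x) * g (cis x)) has_real_derivative
        f' (cis x) * g (cis x) + g' (cis x) * f (cis x)) (at x)" for x
      by (rule DERIV_mult[OF fg(3,4)])
    ultimately show ?case by (intro exI[of _ "\<lambda>z. f' z * g z + g' z * f z"]) auto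
  qed
  then show ?thesis using p(2) unfolding trig_poly_def by auto
qed

lemma trig_poly_continuous: "trig_poly q \<Longrightarrow> continuous_on S q"
  using trig_poly_derivative[of q] by (meson DERIV_isCont continuous_at_imp_continuous_on)

lemma trig_poly_periodic: "trig_poly q \<Longrightarrow> q (x + 2 * pi) = q x"
proof -
  have "cis (x + 2 * pi) = cis x" by (simp add: complex_eq_iff)
  then show "trig_poly q \<Longrightarrow> q (x + 2 * pi) = q x" by (auto simp: trig_poly_def)
qed

lemma trig_poly_diff_const: "trig_poly q \<Longrightarrow> trig_poly (\<lambda>x. q x - c)"
proof -
  assume "trig_poly q"
  then obtain p :: "complex \<Rightarrow> real" where p: "real_polynomial_function p" "q = (\<lambda>x. p (cis x))"
    by (auto simp: trig_poly_def)
  have "real_polynomial_function (\<lambda>z. p z - c)"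
    by (intro real_polynomial_function_diff p(1) real_polynomial_function.intros(2))
  then show "trig_poly (\<lambda>x. q x - c)" using p(2) unfolding trig_poly_def by auto
qed

lemma trig_poly_higher_derivative: "trig_poly q \<Longrightarrow> trig_poly ((deriv ^^ j) q)"
proof (induction j)
  case (Suc j)
  then obtain q' where q': "trig_poly q'" "\<And>x. ((deriv ^^ j) q has_real_derivative q' x) (at x)"
    using trig_poly_derivative by blast
  then have "deriv ((deriv ^^ j) q) = q'" by (intro ext DERIV_imp_deriv)
  then show ?case using q'(1) by simp
qed simp

lemma trig_poly_differentiable: "trig_poly q \<Longrightarrow> (deriv ^^ j) q differentiable at x"
  using trig_poly_derivative[OF trig_poly_higher_derivative, of q j] real_differentiable_def by blast

lemma antiderivative_UNIV:
  fixes q :: "real \<Rightarrow> real"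
  assumes "continuous_on UNIV q"
  shows "\<exists>\<psi>. \<forall>x. (\<psi> has_real_derivative q x) (at x)"
proof -
  define \<psi> where "\<psi> = (\<lambda>x. integral {0..x} q - integral {x..0} q)"
  have "(\<psi> has_real_derivative q x) (at x)" for x
  proof -
    define R where "R = \<bar>x\<bar> + 1"
    have int: "q integrable_on {a..b}" for a b
      by (intro integrable_continuous_real continuous_on_subset[OF assms]) auto
    have eq: "integral {-R..y} q - integral {-R..0} q = \<psi> y" if "y \<in> {-R..R}" for y
    proof (cases "0 \<le> y")
      case True
      have "integral {-R..0} q + integral {0..y} q = integral {-R..y} q"
        by (rule Henstock_Kurzweil_Integration.integral_combine[OF _ _ int]) (use True R_def in auto)
      then show ?thesis using True by (cases "y = 0") (auto simp: \<psi>_def)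
    next
      case False
      have "integral {-R..y} q + integral {y..0} q = integral {-R..0} q"
        by (rule Henstock_Kurzweil_Integration.integral_combine[OF _ _ int]) (use False that in auto)
      then show ?thesis using False by (auto simp: \<psi>_def)
    qed
    have "((\<lambda>y. integral {-R..y} q) has_real_derivative q x) (at x within {-R..R})"
      by (rule integral_has_real_derivative) (use continuous_on_subset[OF assms] R_def in auto)
    then have "((\<lambda>y. integral {-R..y} q - integral {-R..0} q) has_real_derivative q x) (at x within {-R..R})"
      by (auto intro!: derivative_eq_intros)
    then have "(\<psi> has_real_derivative q x) (at x within {-R..R})"
      by (rule has_field_derivative_transform_within[where d = 1]) (use eq R_def in auto)
    then show ?thesis by (simp add: at_within_Icc_at R_def)
  qed
  then show ?thesis by blast
qed

text \<open>Over one period an antiderivative increases by the integral of \<open>q\<close>, so a vanishing mean makes it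
  periodic, hence a test function.\<close>

lemma trig_poly_smooth_antiderivative:
  assumes q: "trig_poly q" and mean: "integral {-pi..pi} q = 0"
  obtains \<psi> where "smooth_circle \<psi>" "\<And>x. deriv \<psi> x = q x"
proof -
  obtain \<psi> where \<psi>: "\<And>x. (\<psi> has_real_derivative q x) (at x)"
    using antiderivative_UNIV[OF trig_poly_continuous[OF q]] by blast
  have d: "deriv \<psi> = q" using \<psi> by (intro ext DERIV_imp_deriv)
  have "((\<lambda>x. \<psi> (x + 2 * pi) - \<psi> x) has_real_derivative 0) (at x)" for x
  proof -
    have "((\<lambda>x. \<psi> (x + 2 * pi)) has_real_derivative q (x + 2 * pi)) (at x)"
      using \<psi>[of "x + 2 * pi"] by (subst (asm) DERIV_shift) simp
    then show ?thesis using DERIV_diff[OF _ \<psi>[of x]] trig_poly_periodic[OF q, of x] by fastforce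
  qed
  then have const: "\<psi> (x + 2 * pi) - \<psi> x = \<psi> (- pi + 2 * pi) - \<psi> (- pi)" for x
    using DERIV_isconst_all[of "\<lambda>x. \<psi> (x + 2 * pi) - \<psi> x" x "-pi"] by blast
  have "(q has_integral (\<psi> pi - \<psi> (- pi))) {-pi..pi}"
    by (rule fundamental_theorem_of_calculus)
      (use \<psi> in \<open>auto simp flip: has_real_derivative_iff_has_vector_derivative intro: has_field_derivative_at_within\<close>)
  then have "integral {-pi..pi} q = \<psi> pi - \<psi> (- pi)" by (rule integral_unique)
  then have "\<psi> pi = \<psi> (- pi)" using mean by simp
  then have per: "\<psi> (x + 2 * pi) = \<psi> x" for x using const[of x] by simp
  have "(deriv ^^ j) \<psi> differentiable at x" for j x
  proof (cases j)
    case 0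
    then show ?thesis using \<psi> real_differentiable_def by auto
  next
    case (Suc i)
    then have "(deriv ^^ j) \<psi> = (deriv ^^ i) q" by (simp add: funpow_swap1 d)
    then show ?thesis using trig_poly_differentiable[OF q] by simp
  qed
  then have "smooth_circle \<psi>" using per by (simp add: smooth_circle_def)
  then show thesis using that d by simp
qed

text \<open>Stone-Weierstrass on the unit circle. The factor \<open>1 + cos x\<close> makes the function continuous at the
  branch point \<open>\<plusminus>\<pi>\<close> of the argument.\<close>

lemma trig_poly_approx:
  fixes \<phi> :: "real \<Rightarrow> real"
  assumes c: "continuous_on UNIV \<phi>" and B: "\<And>x. \<bar>\<phi> x\<bar> \<le> B" and e: "e > 0"
  obtains q where "trig_poly q" "\<And>x. x \<in> {-pi..pi} \<Longrightarrow> \<bar>\<phi> x * (1 + cos x) - q x\<bar> < e"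
proof -
  define F where "F = (\<lambda>z. \<phi> (Arg z) * (1 + Re z))"
  have cont: "continuous_on (sphere 0 1) F"
  proof (unfold continuous_on_eq_continuous_within, intro ballI)
    fix z :: complex assume z: "z \<in> sphere 0 1"
    show "continuous (at z within sphere 0 1) F"
    proof (cases "z \<in> \<real>\<^sub>\<le>\<^sub>0")
      case True
      then have z1: "z = - 1" using z by (auto simp: nonpos_Reals_def norm_of_real)
      have "((\<lambda>w. B * \<bar>1 + Re w\<bar>) \<longlongrightarrow> B * \<bar>1 + Re z\<bar>) (at z within sphere 0 1)"
        by (intro tendsto_intros)
      then have lim: "((\<lambda>w. B * \<bar>1 + Re w\<bar>) \<longlongrightarrow> 0) (at z within sphere 0 1)" by (simp add: z1)
      have "(F \<longlongrightarrow> 0) (at z within sphere 0 1)"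
      proof (rule Lim_null_comparison[OF always_eventually lim], intro allI)
        fix w show "norm (F w) \<le> B * \<bar>1 + Re w\<bar>"
          using mult_right_mono[OF B[of "Arg w"], of "\<bar>1 + Re w\<bar>"] by (simp add: F_def abs_mult)
      qed
      then show ?thesis by (simp add: continuous_within F_def z1)
    next
      case False
      then have "isCont Arg z" by (rule continuous_at_Arg)
      moreover have "isCont \<phi> (Arg z)" using c by (simp add: continuous_on_eq_continuous_at)
      ultimately have "isCont (\<lambda>w. \<phi> (Arg w)) z" by (rule isCont_o2)
      moreover have "isCont Re z" by (rule continuous_Re[OF continuous_ident])
      ultimately have "isCont F z" unfolding F_def by (intro continuous_mult continuous_add continuous_const)
      then show ?thesis by (rule continuous_at_imp_continuous_at_within)
    qed
  qed
  obtain p where p: "real_polynomial_function p" "\<And>z. z \<in> sphere 0 1 \<Longrightarrow> \<bar>F z - p z\<bar> < e"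
    using Stone_Weierstrass_real_polynomial_function[OF _ cont e] by auto
  show thesis
  proof
    show "trig_poly (\<lambda>x. p (cis x))" using p(1) by (auto simp: trig_poly_def)
    fix x :: real assume x: "x \<in> {-pi..pi}"
    have "F (cis x) = \<phi> x * (1 + cos x)"
    proof (cases "x = - pi")
      case False
      then have "Arg (cis x) = x" using x by (intro Arg_cis) auto
      then show ?thesis by (simp add: F_def)
    qed (simp add: F_def)
    then show "\<bar>\<phi> x * (1 + cos x) - p (cis x)\<bar> < e" using p(2)[of "cis x"] by simp
  qed
qed

text \<open>Bounded continuous functions approximate \<open>sgn g\<close> almost everywhere, and their products with \<open>1 + cos x\<close> are
  uniform limits of trigonometric polynomials. Therefore \<open>\<integral> \<bar>g\<bar> (1 + cos x) = 0\<close>, where the weight vanishes on \<open>[-\<pi>, \<pi>]\<close> only at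
  \<open>\<plusminus>\<pi>\<close>.\<close>

lemma trig_poly_orthogonal_imp_zero:
  fixes g :: "real \<Rightarrow> real"
  assumes g: "g absolutely_integrable_on {-pi..pi}"
    and orth: "\<And>q. trig_poly q \<Longrightarrow> integral {-pi..pi} (\<lambda>x. g x * q x) = 0"
  shows "AE x in lebesgue. x \<in> {-pi..pi} \<longrightarrow> g x = 0"
proof -
  let ?I = "{-pi..pi}"
  have g_cont: "(\<lambda>x. g x * \<phi> x) absolutely_integrable_on ?I" if "continuous_on ?I \<phi>" for \<phi> :: "real \<Rightarrow> real"
    using continuous_times_integrable[OF g that] .
  have g_int: "(\<lambda>x. g x * \<phi> x) integrable_on ?I" if "continuous_on ?I \<phi>" for \<phi> :: "real \<Rightarrow> real"
    using g_cont[OF that] by (rule set_lebesgue_integral_eq_integral(1))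
  have g_abs: "(\<lambda>x. \<bar>g x\<bar>) integrable_on ?I"
    using set_integrable_abs[OF g] by (rule set_lebesgue_integral_eq_integral(1))
  have zero: "integral ?I (\<lambda>x. g x * (\<phi> x * (1 + cos x))) = 0"
    if c: "continuous_on UNIV \<phi>" and B: "\<And>x. \<bar>\<phi> x\<bar> \<le> B"
    for \<phi> :: "real \<Rightarrow> real" and B :: real
  proof -
    have c\<phi>: "continuous_on ?I (\<lambda>x. \<phi> x * (1 + cos x))"
      by (intro continuous_intros continuous_on_subset[OF c]) auto
    have "\<bar>integral ?I (\<lambda>x. g x * (\<phi> x * (1 + cos x)))\<bar> \<le> e * integral ?I (\<lambda>x. \<bar>g x\<bar>)" if e: "e > 0" for e
    proof -
      obtain q where q: "trig_poly q" "\<And>x. x \<in> ?I \<Longrightarrow> \<bar>\<phi> x * (1 + cos x) - q x\<bar> < e"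
        using trig_poly_approx[OF c B e] by blast
      have "integral ?I (\<lambda>x. g x * (\<phi> x * (1 + cos x)) - g x * q x) =
          integral ?I (\<lambda>x. g x * (\<phi> x * (1 + cos x))) - integral ?I (\<lambda>x. g x * q x)"
        by (intro integral_diff g_int c\<phi> trig_poly_continuous q(1))
      moreover have "norm (integral ?I (\<lambda>x. g x * (\<phi> x * (1 + cos x)) - g x * q x)) \<le> integral ?I (\<lambda>x. e * \<bar>g x\<bar>)"
      proof (rule integral_norm_bound_integral)
        show "(\<lambda>x. g x * (\<phi> x * (1 + cos x)) - g x * q x) integrable_on ?I"
          by (intro integrable_diff g_int c\<phi> trig_poly_continuous q(1))
        show "(\<lambda>x. e * \<bar>g x\<bar>) integrable_on ?I" by (rule integrable_on_mult_right[OF g_abs])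
        show "norm (g x * (\<phi> x * (1 + cos x)) - g x * q x) \<le> e * \<bar>g x\<bar>" if "x \<in> ?I" for x
          using mult_left_mono[OF less_imp_le[OF q(2)[OF that]], of "\<bar>g x\<bar>"]
          by (simp add: mult.commute flip: abs_mult right_diff_distrib)
      qed
      ultimately show ?thesis using orth[OF q(1)] by simp
    qed
    note bd = this
    show ?thesis
    proof (rule ccontr)
      define J where "J = \<bar>integral ?I (\<lambda>x. g x * (\<phi> x * (1 + cos x)))\<bar>"
      define G where "G = integral ?I (\<lambda>x. \<bar>g x\<bar>)"
      assume "integral ?I (\<lambda>x. g x * (\<phi> x * (1 + cos x))) \<noteq> 0"
      then have J: "J > 0" by (simp add: J_def)
      have G: "G \<ge> 0" unfolding G_def by (rule integral_nonneg[OF g_abs]) simp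
      have "J \<le> J / (2 * (G + 1)) * G" unfolding J_def G_def[symmetric] using bd[of "J / (2 * (G + 1))"] J G
        by (simp add: J_def G_def)
      then have "J * (2 * (G + 1)) \<le> J * G" using G by (simp add: field_simps)
      then have "J * (G + 2) \<le> 0" by (simp add: algebra_simps)
      then show False using J G by (simp add: mult_le_0_iff)
    qed
  qed
  define s where "s = (\<lambda>x. sgn (g x))"
  have gm: "g \<in> borel_measurable (lebesgue_on ?I)"
    by (rule absolutely_integrable_imp_borel_measurable[OF g]) simp
  have "s \<in> borel_measurable (lebesgue_on ?I)"
    unfolding s_def using gm by measurable
  then have "s measurable_on ?I" by (simp add: measurable_on_iff_borel_measurable)
  then obtain N \<sigma> where N: "negligible N" and \<sigma>c: "\<And>j. continuous_on UNIV (\<sigma> j)"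
    and \<sigma>: "\<And>x. x \<notin> N \<Longrightarrow> (\<lambda>j::nat. \<sigma> j x) \<longlonglongrightarrow> (if x \<in> ?I then s x else 0)"
    unfolding measurable_on_def by blast
  define \<tau> where "\<tau> = (\<lambda>j x. max (- 1) (min 1 (\<sigma> j x)))"
  have \<tau>c: "continuous_on UNIV (\<tau> j)" for j unfolding \<tau>_def by (intro continuous_intros \<sigma>c)
  have \<tau>b: "\<bar>\<tau> j x\<bar> \<le> 1" for j x by (auto simp: \<tau>_def)
  have \<tau>: "(\<lambda>j. \<tau> j x) \<longlonglongrightarrow> s x" if "x \<in> ?I" "x \<notin> N" for x
  proof -
    have "(\<lambda>j. \<tau> j x) \<longlonglongrightarrow> max (- 1) (min 1 (s x))"
      unfolding \<tau>_def using \<sigma>[OF that(2)] that(1) by (intro tendsto_max tendsto_min tendsto_const) simp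
    moreover have "max (- 1) (min 1 (s x)) = s x" by (simp add: s_def sgn_if)
    ultimately show ?thesis by simp
  qed
  \<comment> \<open>On the exceptional null set the approximations are replaced by their limit.\<close>
  define \<tau>' where "\<tau>' = (\<lambda>j x. if x \<in> N then s x else \<tau> j x)"
  have \<tau>'b: "\<bar>\<tau>' j x\<bar> \<le> 1" for j x using \<tau>b by (auto simp: \<tau>'_def s_def sgn_if)
  have 0: "((\<lambda>x. g x * (\<tau>' j x * (1 + cos x))) has_integral 0) ?I" for j
  proof (rule has_integral_spike[OF N])
    show "((\<lambda>x. g x * (\<tau> j x * (1 + cos x))) has_integral 0) ?I"
    proof -
      have "continuous_on ?I (\<lambda>x. \<tau> j x * (1 + cos x))"
        by (intro continuous_on_mult continuous_on_subset[OF \<tau>c] continuous_on_add continuous_on_const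
            continuous_on_cos continuous_on_id) simp
      from g_int[OF this] show ?thesis unfolding has_integral_iff using zero[OF \<tau>c \<tau>b] by blast
    qed
  qed (simp add: \<tau>'_def)
  have "((\<lambda>x. g x * (s x * (1 + cos x))) has_integral 0) ?I"
  proof (rule has_integral_dominated_convergence[OF 0])
    show "(\<lambda>x. 2 * \<bar>g x\<bar>) integrable_on ?I" by (rule integrable_on_mult_right[OF g_abs])
    show "\<forall>x\<in>?I. norm (g x * (\<tau>' j x * (1 + cos x))) \<le> 2 * \<bar>g x\<bar>" for j
    proof
      fix x :: real
      have "\<bar>1 + cos x\<bar> \<le> 2" using cos_le_one[of x] cos_ge_minus_one[of x] by linarith
      then have "\<bar>\<tau>' j x\<bar> * \<bar>1 + cos x\<bar> \<le> 1 * 2" by (intro mult_mono \<tau>'b) auto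
      then have "\<bar>g x\<bar> * (\<bar>\<tau>' j x\<bar> * \<bar>1 + cos x\<bar>) \<le> \<bar>g x\<bar> * 2" by (intro mult_left_mono) auto
      then show "norm (g x * (\<tau>' j x * (1 + cos x))) \<le> 2 * \<bar>g x\<bar>" by (simp add: abs_mult)
    qed
    show "\<forall>x\<in>?I. (\<lambda>j. g x * (\<tau>' j x * (1 + cos x))) \<longlonglongrightarrow> g x * (s x * (1 + cos x))"
    proof
      fix x assume x: "x \<in> ?I"
      have "(\<lambda>j. \<tau>' j x) \<longlonglongrightarrow> s x" using \<tau>[OF x] by (cases "x \<in> N") (auto simp: \<tau>'_def)
      then show "(\<lambda>j. g x * (\<tau>' j x * (1 + cos x))) \<longlonglongrightarrow> g x * (s x * (1 + cos x))"
        by (intro tendsto_intros)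
    qed
  qed simp
  moreover have "g x * (s x * (1 + cos x)) = \<bar>g x\<bar> * (1 + cos x)" for x
    by (simp add: s_def flip: mult.assoc) (simp add: abs_sgn mult.commute)
  ultimately have hi: "((\<lambda>x. \<bar>g x\<bar> * (1 + cos x)) has_integral 0) ?I" by simp
  define h where "h = (\<lambda>x. \<bar>g x\<bar> * (1 + cos x))"
  have h0: "0 \<le> h x" for x
  proof -
    have "0 \<le> 1 + cos x" using cos_ge_minus_one[of x] by linarith
    then show ?thesis by (simp add: h_def)
  qed
  have ha: "h absolutely_integrable_on ?I"
    by (rule nonnegative_absolutely_integrable_1) (use hi h0 in \<open>auto simp: h_def[symmetric]\<close>)
  have "(LINT x:?I|lebesgue. h x) = 0"
    using set_lebesgue_integral_eq_integral(2)[OF ha] integral_unique[OF hi] by (simp add: h_def)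
  then have "AE x in lebesgue. indicator ?I x *\<^sub>R h x = 0"
    unfolding set_lebesgue_integral_def
    by (subst (asm) integral_nonneg_eq_0_iff_AE) (use ha h0 in \<open>auto simp: set_integrable_def\<close>)
  moreover have "AE x in lebesgue. x \<noteq> pi \<and> x \<noteq> - pi"
    by (rule AE_I'[of "{pi, - pi}"]) (auto simp flip: negligible_iff_null_sets)
  ultimately show ?thesis
  proof eventually_elim
    case (elim x)
    show ?case
    proof
      assume x: "x \<in> ?I"
      have "cos x \<noteq> - 1"
      proof
        assume "cos x = - 1"
        then have c: "cos \<bar>x\<bar> = cos pi" by simp
        have "\<bar>x\<bar> \<le> pi" using x by auto
        then have "\<bar>x\<bar> = pi" by (rule cos_inj_pi[OF abs_ge_zero _ pi_ge_zero order_refl c])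
        then show False using elim(2) by (auto simp: abs_if split: if_splits)
      qed
      then have "1 + cos x \<noteq> 0" by linarith
      then show "g x = 0" using elim(1) x by (simp add: h_def)
    qed
  qed
qed

text \<open>Let \<open>K\<close> be a primitive of \<open>k\<close>. Testing with antiderivatives of trigonometric polynomials shows that \<open>h - K\<close> minus its
  mean is orthogonal to all trigonometric polynomials.\<close>

theorem weak_derivative_primitive:
  fixes h k :: "real \<Rightarrow> real"
  assumes h: "h absolutely_integrable_on {-pi..pi}" and k: "k absolutely_integrable_on {-pi..pi}"
    and weak: "\<And>\<psi>. smooth_circle \<psi> \<Longrightarrow>
       integral {-pi..pi} (\<lambda>x. h x * deriv \<psi> x) = - integral {-pi..pi} (\<lambda>x. k x * \<psi> x)"
  obtains H where "primitive_on (-pi) pi H k" "AE x in lebesgue. x \<in> {-pi..pi} \<longrightarrow> h x = H x"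
proof -
  let ?I = "{-pi..pi}"
  define K where "K = (\<lambda>x. integral {-pi..x} k)"
  have K: "primitive_on (-pi) pi K k" using k by (simp add: primitive_on_def K_def)
  have K_int: "K absolutely_integrable_on ?I"
    by (rule absolutely_integrable_continuous_real[OF primitive_on_continuous[OF K]])
  have one: "smooth_circle (\<lambda>_. 1)"
  proof -
    have "(deriv ^^ j) (\<lambda>_::real. 1::real) = (\<lambda>_. if j = 0 then 1 else 0)" for j
      by (induction j) auto
    then show ?thesis by (simp add: smooth_circle_def)
  qed
  have k0: "integral ?I k = 0" using weak[OF one] by simp
  have gK: "(\<lambda>x. h x - K x) absolutely_integrable_on ?I"
    by (rule set_integral_diff(1)[OF h K_int])
  define c where "c = integral ?I (\<lambda>x. h x - K x) / (2 * pi)"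
  define g where "g = (\<lambda>x. h x - K x - c)"
  have ga: "g absolutely_integrable_on ?I"
    unfolding g_def by (rule set_integral_diff(1)[OF gK]) (rule absolutely_integrable_on_const, simp)
  have "AE x in lebesgue. x \<in> ?I \<longrightarrow> g x = 0"
  proof (rule trig_poly_orthogonal_imp_zero[OF ga])
    fix q assume q: "trig_poly q"
    define m where "m = integral ?I q / (2 * pi)"
    have qi: "q integrable_on ?I" by (rule integrable_continuous_real[OF trig_poly_continuous[OF q]])
    have "integral ?I (\<lambda>x. q x - m) = 0"
      using qi by (subst integral_diff) (auto simp: m_def)
    then obtain \<psi> where \<psi>: "smooth_circle \<psi>" "\<And>x. deriv \<psi> x = q x - m"
      using trig_poly_smooth_antiderivative[OF trig_poly_diff_const[OF q]] by blast

    note D\<psi> = smooth_circle_derivative[OF \<psi>(1)]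
    have P\<psi>: "primitive_on (-pi) pi \<psi> (deriv \<psi>)"
      unfolding primitive_on_def
    proof (intro conjI ballI absolutely_integrable_continuous_real D\<psi>(2))
      fix x assume x: "x \<in> ?I"
      have "(deriv \<psi> has_integral (\<psi> x - \<psi> (- pi))) {-pi..x}"
        by (rule fundamental_theorem_of_calculus)
          (use D\<psi>(1) x in \<open>auto simp flip: has_real_derivative_iff_has_vector_derivative intro: has_field_derivative_at_within\<close>)
      then show "\<psi> x = \<psi> (- pi) + integral {-pi..x} (deriv \<psi>)" by (simp add: integral_unique)
    qed
    have parts: "((\<lambda>s. k s * \<psi> s + deriv \<psi> s * K s) has_integral 0) ?I"
      using primitive_on_mult_Icc[OF _ K P\<psi>] k0 by (simp add: K_def)

    have i1: "(\<lambda>x. k x * \<psi> x) integrable_on ?I"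
      using continuous_times_integrable[OF k D\<psi>(3)] by (rule set_lebesgue_integral_eq_integral(1))
    have i2: "(\<lambda>x. K x * deriv \<psi> x) integrable_on ?I"
      using continuous_times_integrable[OF K_int D\<psi>(2)] by (rule set_lebesgue_integral_eq_integral(1))
    have i3: "(\<lambda>x. h x * deriv \<psi> x) integrable_on ?I"
      using continuous_times_integrable[OF h D\<psi>(2)] by (rule set_lebesgue_integral_eq_integral(1))
    have "integral ?I (\<lambda>x. k x * \<psi> x) + integral ?I (\<lambda>x. K x * deriv \<psi> x) = 0"
      using integral_unique[OF parts] integral_add[OF i1 i2] by (simp add: mult.commute)
    then have "integral ?I (\<lambda>x. h x * deriv \<psi> x - K x * deriv \<psi> x) = 0"
      using weak[OF \<psi>(1)] integral_diff[OF i3 i2] by simp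
    then have 0: "integral ?I (\<lambda>x. (h x - K x) * (q x - m)) = 0"
      by (simp add: \<psi>(2) left_diff_distrib)
    have j1: "(\<lambda>x. (h x - K x) * (q x - m)) integrable_on ?I"
      using continuous_times_integrable[OF gK, of "\<lambda>x. q x - m"] trig_poly_continuous[OF trig_poly_diff_const[OF q]]
      by (blast intro: set_lebesgue_integral_eq_integral(1))
    have j2: "(\<lambda>x. m * (h x - K x)) integrable_on ?I"
      using gK by (intro integrable_on_mult_right set_lebesgue_integral_eq_integral(1))
    have j3: "(\<lambda>x. c * q x) integrable_on ?I" by (rule integrable_on_mult_right[OF qi])
    have "integral ?I (\<lambda>x. g x * q x) = integral ?I (\<lambda>x. (h x - K x) * (q x - m) + m * (h x - K x) - c * q x)"
      by (rule integral_cong) (simp add: g_def algebra_simps)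
    also have "\<dots> = 0 + m * integral ?I (\<lambda>x. h x - K x) - c * integral ?I q"
      using 0 integral_add[OF j1 j2] integral_diff[OF integrable_add[OF j1 j2] j3] by simp
    also have "\<dots> = 0" by (simp add: m_def c_def)
    finally show "integral ?I (\<lambda>x. g x * q x) = 0" .
  qed
  then have "AE x in lebesgue. x \<in> ?I \<longrightarrow> h x = K x + c" by eventually_elim (auto simp: g_def)
  moreover have "primitive_on (-pi) pi (\<lambda>x. K x + c) k" using k by (simp add: primitive_on_def K_def)
  ultimately show thesis using that by blast
qed

section \<open>Rescaling\<close>

text \<open>As \<open>x\<close> runs through one period, \<open>n x\<close> runs through \<open>n\<close> periods.\<close>

lemma periodic_scaled_integral:
  fixes g :: "real \<Rightarrow> real"
  assumes g: "g integrable_on {-pi..pi}" and per: "\<And>x. g (x + 2 * pi) = g x" and n: "n > (0::nat)"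
  shows "((\<lambda>x. g (real n * x)) has_integral integral {-pi..pi} g) {-pi..pi}"
proof -
  define c where "c = pi - real n * pi"
  define g' where "g' = (\<lambda>t. g (c + t))"
  define I where "I = integral {-pi..pi} g"
  have g': "(g' has_integral I) {-pi..pi}"
    unfolding g'_def I_def by (rule periodic_integral_shift[OF g per])
  have per': "g' (t + of_int k * (2 * pi)) = g' t" for t k
    using periodic_int[where f = g and p = "2 * pi", OF per, of "c + t" k] by (simp add: g'_def add.assoc)
  have m: "(g' has_integral real m * I) {-pi..-pi + real m * (2 * pi)}" for m
  proof (induction m)
    case 0
    show ?case by (simp add: has_integral_refl)
  next
    case (Suc m)
    have "(g' \<circ> (+) (real m * (2 * pi))) = g'"
      using per'[of _ "int m"] by (auto simp: o_def add.commute)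
    then have sh: "(g' has_integral I) {-pi + real m * (2 * pi)..pi + real m * (2 * pi)}"
      using has_integral_shift_Icc_real[of g' "real m * (2 * pi)" I "-pi" pi] g' by simp
    have "(g' has_integral (real m * I + I)) {-pi..pi + real m * (2 * pi)}"
      by (rule has_integral_combine[OF _ _ Suc sh]) auto
    moreover have "pi + real m * (2 * pi) = - pi + real (Suc m) * (2 * pi)"
      "real m * I + I = real (Suc m) * I" by (simp_all add: algebra_simps)
    ultimately show ?case by simp
  qed
  have "(g has_integral real n * I) {-real n * pi..real n * pi}"
    using has_integral_shift_Icc_real[of g c "real n * I" "-pi" "- pi + real n * (2 * pi)"] m[of n]
    by (simp add: g'_def o_def c_def algebra_simps)
  then have "((\<lambda>x. g (real n * x)) has_integral (1 / \<bar>real n\<bar>) *\<^sub>R (real n * I))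
      ((\<lambda>x. x / real n) ` {-real n * pi..real n * pi})"
    by (rule has_integral_stretch_real) (use n in simp)
  moreover have "(\<lambda>x. x / real n) ` {-real n * pi..real n * pi} = {-pi..pi}"
    using n by (subst image_divide_atLeastAtMost) auto
  ultimately show ?thesis using n by (simp add: I_def)
qed

lemma odd_L2_scaled:
  assumes F: "odd_L2 F" and n: "n > (0::nat)"
  shows "odd_L2 (\<lambda>x. F (real n * x))"
proof -
  have L: "L2_circle F" and o: "\<And>x. F (- x) = - F x" using F by (auto simp: odd_L2_def)
  have per: "F (real n * (x + 2 * pi)) = F (real n * x)" for x
    using periodic_int[where f = F and p = "2 * pi", OF L2_circle_periodic[OF L], of "real n * x" "int n"]
    by (simp add: algebra_simps)
  have "F \<in> borel_measurable lebesgue" using L by (simp add: L2_circle_def)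
  then have meas: "(\<lambda>x. F (real n * x)) \<in> borel_measurable lebesgue"
    using borel_measurable_affine[of F "real n" 0] n by simp
  have "((\<lambda>x. (F (real n * x))\<^sup>2) has_integral integral {-pi..pi} (\<lambda>x. (F x)\<^sup>2)) {-pi..pi}"
    using periodic_scaled_integral[OF L2_circle_square_integrable[OF L] _ n] L2_circle_periodic[OF L] by simp
  then have "(\<lambda>x. (F (real n * x))\<^sup>2) absolutely_integrable_on {-pi..pi}"
    by (intro nonnegative_absolutely_integrable_1) auto
  then show ?thesis using o per meas by (simp add: odd_L2_def L2_circle_def)
qed

text \<open>The second claim: since \<open>F (n x)\<close> has period \<open>2\<pi>/n\<close> and no cosine coefficients, a shift by \<open>2\<pi>/n\<close> multiplies its
  \<open>k\<close>-th sine coefficient by \<open>cos (2\<pi>k/n)\<close>, which is \<open>1\<close> only if \<open>n\<close> divides \<open>k\<close>.\<close>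

lemma sine_coeff_scaled:
  assumes F: "odd_L2 F" and n: "n > (0::nat)"
  shows "sine_coeff (\<lambda>x. F (real n * x)) (n * j) = sine_coeff F j"
    and "\<not> n dvd k \<Longrightarrow> sine_coeff (\<lambda>x. F (real n * x)) k = 0"
proof -
  have L: "L2_circle F" and o: "\<And>x. F (- x) = - F x" using F by (auto simp: odd_L2_def)

  have "((\<lambda>x. F (real n * x) * sin (real j * (real n * x))) has_integral
      integral {-pi..pi} (\<lambda>x. F x * sin (real j * x))) {-pi..pi}"
    by (rule periodic_scaled_integral[OF L2_circle_mult_sin[OF L] _ n])
      (simp add: sin_nat_periodic L2_circle_periodic[OF L])
  then show "sine_coeff (\<lambda>x. F (real n * x)) (n * j) = sine_coeff F j"
    by (simp add: sine_coeff_def integral_unique mult_ac)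
  assume k: "\<not> n dvd k"
  define G where "G = (\<lambda>x. F (real n * x))"
  have G: "odd_L2 G" unfolding G_def by (rule odd_L2_scaled[OF F n])
  then have LG: "L2_circle G" and oG: "\<And>x. G (- x) = - G x" by (auto simp: odd_L2_def)
  define c where "c = 2 * pi / real n"
  have Gc: "G (c + x) = G x" for x
    using L2_circle_periodic[OF L, of "real n * x"] n by (simp add: G_def c_def algebra_simps)
  note s = sine_coeff_has_integral[OF LG, of k]
  have cm: "(\<lambda>x. cos (real k * x)) \<in> borel_measurable lebesgue"
    by (rule continuous_measurable_lebesgue) (intro continuous_intros)
  have "(\<lambda>x. G x * cos (real k * x)) absolutely_integrable_on {-pi..pi}"
    by (rule L2_circle_mult_bounded[OF LG cm, of 1]) simp
  then have "(\<lambda>x. G x * cos (real k * x)) integrable_on {-pi..pi}" by (rule set_lebesgue_integral_eq_integral(1))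
  moreover have "integral {-pi..pi} (\<lambda>x. G x * cos (real k * x)) = 0"
    by (rule odd_integral_zero) (simp add: oG)
  ultimately have cc: "((\<lambda>x. G x * cos (real k * x)) has_integral 0) {-pi..pi}" by (simp add: has_integral_iff)
  have "((\<lambda>x. G (c + x) * sin (real k * (c + x))) has_integral integral {-pi..pi} (\<lambda>x. G x * sin (real k * x))) {-pi..pi}"
    by (rule periodic_integral_shift) (use s sin_nat_periodic L2_circle_periodic[OF LG] in auto)
  moreover have "G (c + x) * sin (real k * (c + x)) =
      G x * sin (real k * x) * cos (real k * c) + G x * cos (real k * x) * sin (real k * c)" for x
    by (simp add: Gc distrib_left sin_add algebra_simps)
  ultimately have "((\<lambda>x. G x * sin (real k * x) * cos (real k * c) + G x * cos (real k * x) * sin (real k * c))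
      has_integral (pi * sine_coeff G k)) {-pi..pi}"
    by (simp only: integral_unique[OF s])
  moreover have "((\<lambda>x. G x * sin (real k * x) * cos (real k * c) + G x * cos (real k * x) * sin (real k * c))
      has_integral (pi * sine_coeff G k * cos (real k * c) + 0 * sin (real k * c))) {-pi..pi}"
    by (intro has_integral_add has_integral_mult_left s cc)
  ultimately have "pi * sine_coeff G k = pi * sine_coeff G k * cos (real k * c) + 0 * sin (real k * c)"
    by (rule has_integral_unique)
  then have "sine_coeff G k * (1 - cos (real k * c)) = 0" by (simp add: algebra_simps)
  moreover have "cos (real k * c) \<noteq> 1"
  proof
    assume "cos (real k * c) = 1"
    then obtain z :: int where "real k * c = of_int z * 2 * pi" using cos_one_2pi_int by blast
    then have "real k = of_int z * real n" using n by (simp add: c_def field_simps)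
    then have "int k = z * int n" by (metis of_int_eq_iff of_int_mult of_int_of_nat_eq)
    then show False using k by (metis dvd_triv_right int_dvd_int_iff)
  qed
  ultimately show "sine_coeff (\<lambda>x. F (real n * x)) k = 0" by (simp add: G_def)
qed

definition S_symbol :: "nat \<Rightarrow> real" where
  "S_symbol k = (if k \<le> 2 then 0 else - (1 / real k) * (((real k)\<^sup>2 - 1) / ((real k)\<^sup>2 - 4)))"

lemma S_symbol_bound: "symbol_bound S_symbol"
  unfolding symbol_bound_def
proof
  fix k show "\<bar>S_symbol k\<bar> \<le> 2 / real k"
  proof (cases "k \<le> 2")
    case False
    then have "(real k)\<^sup>2 \<ge> 3\<^sup>2" by (intro power_mono) auto
    then have q: "(real k)\<^sup>2 \<ge> 9" by simp
    have "0 \<le> (q - 1) / (q - 4) \<and> (q - 1) / (q - 4) \<le> 2" if "q \<ge> 9" for q :: real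
      using that by (simp add: pos_divide_le_eq)
    from this[OF q] have Q: "0 \<le> ((real k)\<^sup>2 - 1) / ((real k)\<^sup>2 - 4)" "((real k)\<^sup>2 - 1) / ((real k)\<^sup>2 - 4) \<le> 2" by auto
    have nn: "0 \<le> 1 / real k * (((real k)\<^sup>2 - 1) / ((real k)\<^sup>2 - 4))"
      by (rule mult_nonneg_nonneg[OF _ Q(1)]) simp
    have "S_symbol k = - (1 / real k * (((real k)\<^sup>2 - 1) / ((real k)\<^sup>2 - 4)))"
      using False by (simp add: S_symbol_def)
    then have "\<bar>S_symbol k\<bar> = 1 / real k * (((real k)\<^sup>2 - 1) / ((real k)\<^sup>2 - 4))"
      by (simp only: abs_minus_cancel abs_of_nonneg[OF nn])
    also have "\<dots> \<le> 1 / real k * 2" by (rule mult_left_mono[OF Q(2)]) simp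
    finally show ?thesis by simp
  qed (simp add: S_symbol_def)
qed

lemma S_op_odd: "odd_L2 f \<Longrightarrow> S_op f = sine_mult S_symbol f"
  unfolding S_op_def
  by (rule fourier_multiplier_odd[OF _ S_symbol_bound]) (auto simp: S_symbol_def of_nat_nat nat_le_iff)

text \<open>At the frequencies \<open>k = n j\<close> that occur in \<open>F (n x)\<close>, the symbol of \<open>S\<close> is \<open>1/n\<close> times that of \<open>S\<^sub>n\<close> at \<open>j\<close>.\<close>

lemma S_op_scaled:
  assumes F: "odd_L2 F" and n: "n \<ge> 3"
  shows "S_op (\<lambda>x. F (real n * x)) x = - (1 / real n) * sine_mult (Sn_symbol n) F (real n * x)"
proof -
  have n0: "n > 0" using n by simp
  define t where "t = (\<lambda>k. S_symbol k * sine_coeff (\<lambda>x. F (real n * x)) k * sin (real k * x))"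
  have sym: "S_symbol (n * j) = - (1 / real n) * Sn_symbol n j" for j
  proof (cases "j = 0")
    case False
    then have "3 * 1 \<le> n * j" using n by (intro mult_le_mono) auto
    then have "\<not> n * j \<le> 2" by linarith
    then show ?thesis by (simp add: S_symbol_def Sn_symbol_def power_mult_distrib)
  qed (simp add: S_symbol_def Sn_symbol_def)
  have "strict_mono (\<lambda>j. n * j)" using n0 by (simp add: strict_mono_def)
  then have "suminf t = (\<Sum>j. t (n * j))"
  proof (rule suminf_mono_reindex[symmetric])
    fix k assume "k \<notin> range (\<lambda>j. n * j)"
    then have "\<not> n dvd k" by (auto simp: dvd_def)
    then show "t k = 0" using sine_coeff_scaled(2)[OF F n0] by (simp add: t_def)
  qed
  also have "\<dots> = (\<Sum>j. - (1 / real n) * (Sn_symbol n j * sine_coeff F j * sin (real j * (real n * x))))"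
    unfolding t_def sym sine_coeff_scaled(1)[OF F n0] by (intro suminf_cong) (simp add: mult_ac)
  also have "\<dots> = - (1 / real n) * sine_mult (Sn_symbol n) F (real n * x)"
    unfolding sine_mult_def using F n
    by (intro suminf_mult sine_mult_summable) (auto simp: odd_L2_def Sn_symbol_bound)
  finally show ?thesis
    unfolding S_op_odd[OF odd_L2_scaled[OF F n0]] by (simp add: t_def sine_mult_def)
qed

section \<open>The solution on the circle\<close>

lemma odd_ext_cmult: "odd_ext (\<lambda>y. c * w y) x = c * odd_ext w x"
  by (simp add: odd_ext_def Let_def)

lemma abs_powr_has_derivative:
  fixes s p :: real
  assumes p: "0 < p"
  shows "((\<lambda>s. \<bar>s\<bar> powr (p + 1)) has_real_derivative (p + 1) * (sgn s * \<bar>s\<bar> powr p)) (at s)"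
proof (cases s "0::real" rule: linorder_cases)
  case greater
  have "((\<lambda>s. s powr (p + 1)) has_real_derivative (p + 1) * s powr p) (at s)"
    using greater by (auto intro!: derivative_eq_intros)
  then have "((\<lambda>s. \<bar>s\<bar> powr (p + 1)) has_real_derivative (p + 1) * s powr p) (at s)"
    by (rule has_field_derivative_transform_within_open[where S = "{0<..}"]) (use greater in auto)
  then show ?thesis using greater by simp
next
  case less
  have "((\<lambda>s. (- s) powr (p + 1)) has_real_derivative - ((p + 1) * (- s) powr p)) (at s)"
    using less by (auto intro!: derivative_eq_intros)
  then have "((\<lambda>s. \<bar>s\<bar> powr (p + 1)) has_real_derivative - ((p + 1) * (- s) powr p)) (at s)"
    by (rule has_field_derivative_transform_within_open[where S = "{..<0}"]) (use less in auto)
  then show ?thesis using less by simp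
next
  case equal
  have "((\<lambda>h::real. \<bar>h\<bar> powr p) \<longlongrightarrow> \<bar>0\<bar> powr p) (at 0)"
    using p by (intro tendsto_powr2 tendsto_rabs tendsto_ident_at tendsto_const) auto
  then have lim: "((\<lambda>h::real. \<bar>h\<bar> powr p) \<longlongrightarrow> 0) (at 0)" by simp
  have "((\<lambda>h::real. (\<bar>0 + h\<bar> powr (p + 1) - \<bar>0\<bar> powr (p + 1)) / h) \<longlongrightarrow> 0) (at 0)"
  proof (rule Lim_null_comparison[OF always_eventually lim], intro allI)
    fix h :: real
    show "norm ((\<bar>0 + h\<bar> powr (p + 1) - \<bar>0\<bar> powr (p + 1)) / h) \<le> \<bar>h\<bar> powr p"
      using p by (cases "h = 0") (auto simp: powr_add)
  qed
  then show ?thesis using equal p by (simp add: DERIV_def)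
qed

lemma LINT_continuous:
  "continuous_on UNIV g \<Longrightarrow> (LINT x:{-pi..pi}|lebesgue. (g x :: real)) = integral {-pi..pi} g"
  by (rule set_lebesgue_integral_eq_integral(2)[OF absolutely_integrable_continuous_real])
    (rule continuous_on_subset, auto)

lemma periodic_integration_by_parts:
  fixes u u' :: "real \<Rightarrow> real"
  assumes u: "\<And>x. (u has_real_derivative u' x) (at x)" and c: "continuous_on UNIV u'"
    and per: "\<And>x. u (x + 2 * pi) = u x" and \<psi>: "smooth_circle \<psi>"
  shows "integral {-pi..pi} (\<lambda>x. u x * deriv \<psi> x) = - integral {-pi..pi} (\<lambda>x. u' x * \<psi> x)"
proof -
  note d\<psi> = smooth_circle_derivative[OF \<psi>]
  have cu: "continuous_on S u" for S using u by (meson DERIV_isCont continuous_at_imp_continuous_on)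
  have hi: "((\<lambda>x. u' x * \<psi> x + deriv \<psi> x * u x) has_integral (u pi * \<psi> pi - u (- pi) * \<psi> (- pi))) {-pi..pi}"
  proof (rule fundamental_theorem_of_calculus)
    fix x
    have "((\<lambda>x. u x * \<psi> x) has_real_derivative (u' x * \<psi> x + deriv \<psi> x * u x)) (at x)"
      by (rule DERIV_mult[OF u d\<psi>(1)])
    then show "((\<lambda>x. u x * \<psi> x) has_vector_derivative u' x * \<psi> x + deriv \<psi> x * u x) (at x within {-pi..pi})"
      by (simp add: has_real_derivative_iff_has_vector_derivative has_vector_derivative_at_within)
  qed simp
  have "\<psi> (- pi + 2 * pi) = \<psi> (- pi)" using \<psi> unfolding smooth_circle_def by blast
  then have ends: "u pi = u (- pi)" "\<psi> pi = \<psi> (- pi)" using per[of "-pi"] by auto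
  have i1: "(\<lambda>x. u' x * \<psi> x) integrable_on {-pi..pi}"
    by (intro integrable_continuous_real continuous_on_mult continuous_on_subset[OF c] d\<psi>(3)) auto
  have i2: "(\<lambda>x. deriv \<psi> x * u x) integrable_on {-pi..pi}"
    by (intro integrable_continuous_real continuous_on_mult d\<psi>(2) cu)
  have "integral {-pi..pi} (\<lambda>x. u' x * \<psi> x) + integral {-pi..pi} (\<lambda>x. deriv \<psi> x * u x) = 0"
    using integral_add[OF i1 i2] integral_unique[OF hi] ends by simp
  then show ?thesis by (simp add: mult.commute)
qed

text \<open>The solution on the half period is continuously differentiable: its profile \<open>v\<^sup>p\<close> inherits Hoelder
  continuity from \<open>v\<close>, and the operator gains one derivative on Hoelder functions.\<close>

lemma solution_regularity:
  assumes n: "n \<ge> 3" and \<alpha>: "\<alpha> > 1" and v: "nonneg_nonzero_solution \<alpha> n v"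
  defines "F \<equiv> odd_ext (\<lambda>y. v y powr (1 / \<alpha>))"
  defines "V \<equiv> sine_mult (Sn_symbol n) F"
  shows "odd_L2 F" "\<And>x. x \<in> {0..pi} \<Longrightarrow> V x = v x" "\<And>x. F x = sgn (V x) * \<bar>V x\<bar> powr (1 / \<alpha>)"
    and "\<exists>D L. continuous_on UNIV D \<and> (\<forall>x. (V has_real_derivative D x) (at x)) \<and>
      (\<forall>x. D (x + 2 * pi) = D x) \<and> L \<ge> 0 \<and> (\<forall>x y. \<bar>V x - V y\<bar> \<le> L * \<bar>x - y\<bar>)"
proof -
  define p where "p = 1 / \<alpha>"
  have p: "0 < p" "p < 1" using \<alpha> by (auto simp: p_def)
  show F: "odd_L2 F" and Vv: "\<And>x. x \<in> {0..pi} \<Longrightarrow> V x = v x"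
    using v unfolding nonneg_nonzero_solution_iff[OF n] F_def V_def half_op_def by auto
  have v0: "\<And>x. x \<in> {0..pi} \<Longrightarrow> v x \<ge> 0" using v unfolding nonneg_nonzero_solution_iff[OF n] by auto
  have L: "L2_circle F" using F by (simp add: odd_L2_def)
  note m = Sn_symbol_bound[OF n]
  have Vodd: "V (- x) = - V x" for x unfolding V_def by (rule sine_mult_odd[OF L m])
  have Vper: "V (x + 2 * pi) = V x" for x unfolding V_def by (rule sine_mult_periodic)
  show FV: "F x = sgn (V x) * \<bar>V x\<bar> powr (1 / \<alpha>)" for x
  proof (rule odd_periodic_eqI[where F = F and G = "\<lambda>x. sgn (V x) * \<bar>V x\<bar> powr (1 / \<alpha>)"])
    show "F x = sgn (V x) * \<bar>V x\<bar> powr (1 / \<alpha>)" if "0 < x" "x < pi" for x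
      using Vv[of x] v0[of x] that by (auto simp: F_def sgn_if)
  qed (simp_all add: F_def odd_ext_odd odd_ext_periodic Vodd Vper sgn_minus)
  obtain K where K: "K \<ge> 0" "\<And>x y. \<bar>V x - V y\<bar> \<le> K * \<bar>x - y\<bar> powr (1/4)"
    using sine_mult_holder[OF L m] unfolding V_def by blast
  have holder: "\<bar>F x - F y\<bar> \<le> 2 * K powr p * \<bar>x - y\<bar> powr (p / 4)" for x y
  proof -
    have "\<bar>F x - F y\<bar> \<le> 2 * \<bar>V x - V y\<bar> powr p"
      unfolding FV p_def[symmetric] by (rule signed_powr_holder[OF p])
    also have "\<dots> \<le> 2 * (K * \<bar>x - y\<bar> powr (1/4)) powr p"
      using K(2) p by (intro mult_left_mono powr_mono2) auto
    also have "\<dots> = 2 * K powr p * \<bar>x - y\<bar> powr (p / 4)"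
      using K(1) by (simp add: powr_mult powr_powr)
    finally show ?thesis .
  qed
  obtain D where D: "continuous_on UNIV D" "\<And>x. (V has_real_derivative D x) (at x)"
    using Sn_derivative[of F _ "p / 4", OF holder _ F n] p unfolding V_def by auto
  have Dper: "D (x + 2 * pi) = D x" for x
  proof -
    have "((\<lambda>x. V (x + 2 * pi)) has_real_derivative D (x + 2 * pi)) (at x)"
      using D(2)[of "x + 2 * pi"] by (subst (asm) DERIV_shift) simp
    then show ?thesis using D(2)[of x] DERIV_unique unfolding Vper by blast
  qed
  obtain B where B: "\<And>x. x \<in> {-pi..pi} \<Longrightarrow> \<bar>D x\<bar> \<le> B"
    using continuous_on_Icc_bounded[OF continuous_on_subset[OF D(1) subset_UNIV]] by blast
  have B': "norm (D x) \<le> B" for x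
  proof (rule circle_cases[of x])
    fix r k assume "x = r + of_int k * (2 * pi)" "- pi < r" "r \<le> pi"
    then show ?thesis using B[of r] periodic_int[where f = D and p = "2 * pi", OF Dper, of r k] by simp
  qed
  have "norm (V x - V y) \<le> B * norm (x - y)" for x y
    by (rule field_differentiable_bound[of UNIV V D]) (use D(2) B' in auto)
  then have "\<bar>V x - V y\<bar> \<le> B * \<bar>x - y\<bar>" for x y by simp
  moreover have "B \<ge> 0" using B'[of 0] by simp
  ultimately show "\<exists>D L. continuous_on UNIV D \<and> (\<forall>x. (V has_real_derivative D x) (at x)) \<and>
      (\<forall>x. D (x + 2 * pi) = D x) \<and> L \<ge> 0 \<and> (\<forall>x y. \<bar>V x - V y\<bar> \<le> L * \<bar>x - y\<bar>)"
    using D Dper by blast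
qed

lemma L2_circle_continuous:
  assumes c: "continuous_on UNIV g" and per: "\<And>x. g (x + 2 * pi) = g x"
  shows "L2_circle g"
proof -
  have "(\<lambda>x. (g x)\<^sup>2) absolutely_integrable_on {-pi..pi}"
    by (intro absolutely_integrable_continuous_real continuous_on_power continuous_on_subset[OF c]) auto
  then show ?thesis using per continuous_measurable_lebesgue[OF c] by (simp add: L2_circle_def)
qed

text \<open>Write \<open>f(x) = - F(n x)\<close> and \<open>S f(x) = V(n x) / n\<close>, where \<open>F = sgn V \<bar>V\<bar>\<^sup>p\<close>. Then \<open>f S f\<close> is a multiple of
  \<open>u = \<bar>V(n x)\<bar>\<^bsup>p + 1\<^esup>\<close> and \<open>f (S f)'\<close> is a multiple of \<open>u'\<close>, so the weak equation is integration by parts for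
  \<open>u\<close>; the constants match because \<open>(\<alpha> + 1) / (p + 1) = \<alpha>\<close>. The Fourier coefficient does not vanish because the first sine coefficient of \<open>F\<close>
  is at least that of \<open>sin\<close>.\<close>

theorem rescaled_solution:
  assumes n: "n \<ge> 3" and \<alpha>: "\<alpha> > 1" and v: "nonneg_nonzero_solution \<alpha> n v"
    and v_sin: "\<And>x. 0 \<le> x \<Longrightarrow> x \<le> pi \<Longrightarrow> sin x \<le> v x"
  defines "f \<equiv> (\<lambda>x. odd_ext (\<lambda>y. - (v y powr (1 / \<alpha>))) (real n * x))"
  shows "f (- x) = - f x" "f (x + 2 * pi / real n) = f x" "holder_circle (1 / \<alpha>) f"
    "fourier_coeff f (int n) \<noteq> 0" "weak_solution \<alpha> f"
proof -
  define p where "p = 1 / \<alpha>"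
  have p: "0 < p" "p < 1" using \<alpha> by (auto simp: p_def)
  have n0: "n > 0" using n by simp
  define F where "F = odd_ext (\<lambda>y. v y powr p)"
  define V where "V = sine_mult (Sn_symbol n) F"
  note reg = solution_regularity[OF n \<alpha> v, folded p_def, folded F_def, folded V_def]
  have F: "odd_L2 F" and Vv: "\<And>x. x \<in> {0..pi} \<Longrightarrow> V x = v x"
    and FV: "\<And>x. F x = sgn (V x) * \<bar>V x\<bar> powr p"
    using reg(1-3) by auto
  obtain D L where D: "continuous_on UNIV D" "\<And>x. (V has_real_derivative D x) (at x)"
    "\<And>x. D (x + 2 * pi) = D x" and L: "L \<ge> 0" "\<And>x y. \<bar>V x - V y\<bar> \<le> L * \<bar>x - y\<bar>"
    using reg(4) by blast
  have LF: "L2_circle F" and oF: "\<And>x. F (- x) = - F x" using F by (auto simp: odd_L2_def)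
  have perF: "F (x + 2 * pi) = F x" for x by (rule L2_circle_periodic[OF LF])
  have perV: "V (x + 2 * pi) = V x" for x unfolding V_def by (rule sine_mult_periodic)
  have neg: "odd_ext (\<lambda>y. - (v y powr p)) x = - F x" for x
    using odd_ext_cmult[of "-1" "\<lambda>y. v y powr p" x] by (simp add: F_def)
  have f: "f = (\<lambda>x. - F (real n * x))" unfolding f_def p_def[symmetric] neg ..
  have per_n: "h (real n * (x + 2 * pi)) = h (real n * x)" if "\<And>x. h (x + 2 * pi) = h x" for h :: "real \<Rightarrow> real" and x
    using periodic_int[where f = h and p = "2 * pi", OF that, of "real n * x" "int n"] by (simp add: algebra_simps)
  have F_neg: "odd_L2 (\<lambda>x. (-1) * F x + 0 * F x)" by (rule odd_L2_lincomb[OF F F])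
  then have F_neg: "odd_L2 (\<lambda>x. - F x)" by simp
  have fL: "odd_L2 f" unfolding f using odd_L2_scaled[OF F_neg n0] .
  show "f (- x) = - f x" for x by (simp add: f oF)
  show "f (x + 2 * pi / real n) = f x" for x
    using perF[of "real n * x"] n0 by (simp add: f distrib_left)
  have fper: "f (x + 2 * pi) = f x" for x unfolding f using per_n[of F, OF perF] by simp
  show "holder_circle (1 / \<alpha>) f"
    unfolding holder_circle_def p_def[symmetric]
  proof (intro conjI allI exI)
    fix x y
    have "\<bar>f x - f y\<bar> = \<bar>F (real n * x) - F (real n * y)\<bar>" by (simp add: f abs_minus_commute)
    also have "\<dots> \<le> 2 * \<bar>V (real n * x) - V (real n * y)\<bar> powr p"
      unfolding FV by (rule signed_powr_holder[OF p])
    also have "\<dots> \<le> 2 * (L * \<bar>real n * x - real n * y\<bar>) powr p"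
      using L(2) p by (intro mult_left_mono powr_mono2) auto
    also have "L * \<bar>real n * x - real n * y\<bar> = (L * real n) * \<bar>x - y\<bar>"
      by (simp add: abs_mult flip: right_diff_distrib)
    also have "2 * ((L * real n) * \<bar>x - y\<bar>) powr p = 2 * (L * real n) powr p * \<bar>x - y\<bar> powr p"
      using L(1) by (simp add: powr_mult)
    finally show "\<bar>f x - f y\<bar> \<le> 2 * (L * real n) powr p * \<bar>x - y\<bar> powr p" .
  qed (rule fper)
  have V_neg: "sine_mult (Sn_symbol n) (\<lambda>x. - F x) y = - V y" for y
    using sine_mult_linear[OF LF LF Sn_symbol_bound[OF n], of "-1" 0 y] by (simp add: V_def)
  have Sf: "S_op f x = V (real n * x) / real n" for x
    using S_op_scaled[OF F_neg n, of x] by (simp add: f V_neg)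
  show "fourier_coeff f (int n) \<noteq> 0"
  proof -
    have le: "F y * sin y - sin y * sin y \<ge> 0" if "y \<in> {-pi..pi}" for y
    proof (rule nonneg_even_half[OF _ _ _ _ that])
      fix y :: real assume y: "0 < y" "y < pi"
      have "sin y \<le> F y" using sin_le_powr[OF v_sin, of y p] y p by (simp add: F_def)
      then have "sin y * sin y \<le> F y * sin y" using y by (intro mult_right_mono) (auto simp: sin_ge_zero)
      then show "F y * sin y - sin y * sin y \<ge> 0" by simp
    qed (simp_all add: oF)
    note i = sine_coeff_has_integral[OF LF, of 1]
    have "((\<lambda>y. sin (real 1 * y) * sin (real 1 * y)) has_integral pi) {-pi..pi}"
      using sin_orthogonal[of 1 1] by simp
    then have "pi \<le> pi * sine_coeff F 1" by (rule has_integral_le[OF _ i]) (use le in auto)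
    then have F1: "sine_coeff F 1 \<ge> 1" by simp
    have "sine_coeff f (n * 1) = sine_coeff (\<lambda>x. - F x) 1" unfolding f by (rule sine_coeff_scaled(1)[OF F_neg n0])
    also have "\<dots> = - sine_coeff F 1" using sine_coeff_add[OF LF LF, of "-1" 0 1] by simp
    finally have "sine_coeff f n \<noteq> 0" using F1 by simp
    then show ?thesis unfolding fourier_coeff_odd[OF fL] using n0 by (simp add: sgn_if)
  qed
  have cV: "continuous_on UNIV V" using D(2) by (meson DERIV_isCont continuous_at_imp_continuous_on)
  have scale: "continuous_on UNIV (\<lambda>x. h (real n * x))" if "continuous_on UNIV h" for h :: "real \<Rightarrow> real"
    by (rule continuous_on_compose2[OF that]) (auto intro!: continuous_intros)
  have cF: "continuous_on UNIV F"
  proof (rule holder_continuous)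
    show "\<bar>F x - F y\<bar> \<le> 2 * L powr p * \<bar>x - y\<bar> powr p" for x y
    proof -
      have "\<bar>F x - F y\<bar> \<le> 2 * \<bar>V x - V y\<bar> powr p" unfolding FV by (rule signed_powr_holder[OF p])
      also have "\<dots> \<le> 2 * (L * \<bar>x - y\<bar>) powr p" using L(2) p by (intro mult_left_mono powr_mono2) auto
      finally show ?thesis using L(1) by (simp add: powr_mult)
    qed
  qed (rule p(1))
  have dV: "((\<lambda>x. V (real n * x)) has_real_derivative D (real n * x) * real n) (at x)" for x
    by (rule DERIV_chain2[OF D(2)]) (auto intro!: derivative_eq_intros)
  have dS: "(S_op f has_real_derivative D (real n * x)) (at x)" for x
    unfolding Sf[abs_def] using DERIV_cdivide[OF dV[of x], of "real n"] n0 by simp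
  have cS: "continuous_on UNIV (S_op f)" using dS by (meson DERIV_isCont continuous_at_imp_continuous_on)
  have cD: "continuous_on UNIV (\<lambda>x. D (real n * x))" by (rule scale[OF D(1)])
  have cFn: "continuous_on UNIV (\<lambda>x. F (real n * x))" by (rule scale[OF cF])
  have cf: "continuous_on UNIV f" unfolding f by (rule continuous_on_minus[OF cFn])
  show "weak_solution \<alpha> f"
    unfolding weak_solution_def
  proof (intro conjI exI[of _ "\<lambda>x. D (real n * x)"] allI impI)
    show "L2_circle f" using fL by (simp add: odd_L2_def)
    show "weak_deriv_circle (S_op f) (\<lambda>x. D (real n * x))"
      unfolding weak_deriv_circle_def
    proof (intro conjI allI impI)
      show "L2_circle (\<lambda>x. D (real n * x))"
        by (rule L2_circle_continuous[OF cD]) (rule per_n[where h = D, OF D(3)])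
      fix \<psi> assume \<psi>: "smooth_circle \<psi>"
      note d\<psi> = smooth_circle_derivative[OF \<psi>]
      have "integral {-pi..pi} (\<lambda>x. S_op f x * deriv \<psi> x) = - integral {-pi..pi} (\<lambda>x. D (real n * x) * \<psi> x)"
        by (rule periodic_integration_by_parts[OF dS cD _ \<psi>]) (simp add: Sf per_n[of V, OF perV])
      moreover have "continuous_on UNIV (\<lambda>x. S_op f x * deriv \<psi> x)"
        by (rule continuous_on_mult[OF cS d\<psi>(2)])
      moreover have "continuous_on UNIV (\<lambda>x. D (real n * x) * \<psi> x)"
        by (rule continuous_on_mult[OF cD d\<psi>(3)])
      ultimately show "(LINT x:{-pi..pi}|lebesgue. S_op f x * deriv \<psi> x) = - (LINT x:{-pi..pi}|lebesgue. D (real n * x) * \<psi> x)"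
        by (simp only: LINT_continuous)
    qed
    fix \<psi> assume \<psi>: "smooth_circle \<psi>"
    note d\<psi> = smooth_circle_derivative[OF \<psi>]
    define u where "u = (\<lambda>x. \<bar>V (real n * x)\<bar> powr (p + 1))"
    define u' where "u' = (\<lambda>x. (p + 1) * F (real n * x) * (D (real n * x) * real n))"
    have du: "(u has_real_derivative u' x) (at x)" for x
      unfolding u_def u'_def FV by (rule DERIV_chain2[OF abs_powr_has_derivative[OF p(1)] dV])
    have cu': "continuous_on UNIV u'"
      unfolding u'_def by (intro continuous_on_mult continuous_on_const cFn cD)
    define I where "I = integral {-pi..pi} (\<lambda>x. u' x * \<psi> x)"
    have parts: "integral {-pi..pi} (\<lambda>x. u x * deriv \<psi> x) = - I"
      unfolding I_def
      by (rule periodic_integration_by_parts[OF du cu' _ \<psi>]) (simp add: u_def per_n[of V, OF perV])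
    have eq1: "f x * S_op f x * deriv \<psi> x = - (1 / real n) * (u x * deriv \<psi> x)" for x
    proof -
      have "F y * V y = \<bar>V y\<bar> powr (p + 1)" for y
        unfolding FV by (cases "V y" "0::real" rule: linorder_cases) (auto simp: powr_add)
      from this[of "real n * x"] have "f x * S_op f x = - (1 / real n) * u x"
        unfolding Sf u_def fun_cong[OF f, of x] by simp
      then show ?thesis by simp
    qed
    have eq2: "f x * D (real n * x) * \<psi> x = - (1 / (real n * (p + 1))) * (u' x * \<psi> x)" for x
    proof -
      define e where "e = real n * (p + 1)"
      have e: "e \<noteq> 0" using n0 p by (simp add: e_def)
      have "u' x = e * (F (real n * x) * D (real n * x))" unfolding u'_def e_def by (simp only: mult_ac)
      then show ?thesis unfolding fun_cong[OF f, of x] e_def[symmetric] using e by simp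
    qed
    have c1: "continuous_on UNIV (\<lambda>x. f x * S_op f x * deriv \<psi> x)"
      by (intro continuous_on_mult cf cS d\<psi>(2))
    have c2: "continuous_on UNIV (\<lambda>x. f x * D (real n * x) * \<psi> x)"
      by (intro continuous_on_mult cf cD d\<psi>(3))
    have l1: "(LINT x:{-pi..pi}|lebesgue. f x * S_op f x * deriv \<psi> x) = 1 / real n * I"
    proof -
      have "integral {-pi..pi} (\<lambda>x. f x * S_op f x * deriv \<psi> x) =
          - (1 / real n) * integral {-pi..pi} (\<lambda>x. u x * deriv \<psi> x)"
        unfolding eq1 by (rule Henstock_Kurzweil_Integration.integral_mult_right)
      then show ?thesis using LINT_continuous[OF c1] parts by simp
    qed
    have l2: "(LINT x:{-pi..pi}|lebesgue. f x * D (real n * x) * \<psi> x) = - (1 / (real n * (p + 1))) * I"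
    proof -
      have "integral {-pi..pi} (\<lambda>x. f x * D (real n * x) * \<psi> x) = - (1 / (real n * (p + 1))) * I"
        unfolding eq2 I_def by (rule Henstock_Kurzweil_Integration.integral_mult_right)
      then show ?thesis using LINT_continuous[OF c2] by simp
    qed
    have "(\<alpha> + 1) / (p + 1) = \<alpha>"
      using \<alpha> p by (simp add: p_def field_simps)
    then have "(\<alpha> + 1) * (1 / (real n * (p + 1))) = \<alpha> * (1 / real n)"
      by (metis divide_divide_eq_left mult.commute times_divide_eq_right mult.right_neutral)
    then show "- \<alpha> * (LINT x:{-pi..pi}|lebesgue. f x * S_op f x * deriv \<psi> x) =
        (\<alpha> + 1) * (LINT x:{-pi..pi}|lebesgue. f x * D (real n * x) * \<psi> x)"
      unfolding l1 l2 by (metis mult.assoc mult_minus_left mult_minus_right)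
  qed
qed

section \<open>Classification of solutions\<close>

lemma AE_lebesgue_shift: "AE x in lebesgue. P x \<Longrightarrow> AE x::real in lebesgue. P (x + c)"
proof -
  assume "AE x in lebesgue. P x"
  then obtain N where N: "negligible N" "{x. \<not> P x} \<subseteq> N" by (auto simp: eventually_ae_filter_negligible)
  have "{x. \<not> P (x + c)} \<subseteq> (+) (- c) ` N"
  proof
    fix x assume "x \<in> {x. \<not> P (x + c)}"
    then have "x + c \<in> N" using N(2) by auto
    then show "x \<in> (+) (- c) ` N" by (intro image_eqI[of _ _ "x + c"]) auto
  qed
  then show ?thesis
    using negligible_translation[OF N(1), of "- c"] by (auto simp: eventually_ae_filter_negligible)
qed

lemma AE_lebesgue_reflect: "AE x in lebesgue. P x \<Longrightarrow> AE x::real in lebesgue. P (- x)"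
proof -
  assume "AE x in lebesgue. P x"
  then obtain N where N: "negligible N" "{x. \<not> P x} \<subseteq> N" by (auto simp: eventually_ae_filter_negligible)
  have "{x. \<not> P (- x)} \<subseteq> uminus ` N"
  proof
    fix x assume "x \<in> {x. \<not> P (- x)}"
    then have "- x \<in> N" using N(2) by auto
    then show "x \<in> uminus ` N" by (intro image_eqI[of _ _ "- x"]) auto
  qed
  moreover have "negligible (uminus ` N)"
    by (rule negligible_differentiable_image_negligible[OF _ N(1)])
      (auto simp: differentiable_on_def intro!: differentiable_minus differentiable_ident)
  ultimately show ?thesis by (auto simp: eventually_ae_filter_negligible)
qed

lemma AE_lebesgue_countable:
  assumes "countable (C :: real set)" shows "AE x in lebesgue. x \<notin> C"
  by (rule AE_not_in[OF null_sets_completionI[OF countable_imp_null_set_lborel[OF assms]]])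

text \<open>Almost every point satisfies the countably many translated and reflected relations at once and avoids the
  countably many multiples of \<open>P / 2\<close>; such a point is carried into \<open>(0, P / 2)\<close> by a translation and a reflection.\<close>

lemma odd_periodic_AE_zero:
  fixes d :: "real \<Rightarrow> real"
  assumes P: "P > 0" and odd: "AE x in lebesgue. d (- x) = - d x"
    and per: "AE x in lebesgue. d (x + P) = d x"
    and zero: "AE x in lebesgue. 0 < x \<and> x < P / 2 \<longrightarrow> d x = 0"
  shows "AE x in lebesgue. d x = 0"
proof -
  have 1: "AE x in lebesgue. \<forall>k::int. d (x + of_int k * P + P) = d (x + of_int k * P)"
    unfolding AE_all_countable using AE_lebesgue_shift[OF per] by blast
  have 2: "AE x in lebesgue. \<forall>k::int. 0 < x + of_int k * P \<and> x + of_int k * P < P / 2 \<longrightarrow> d (x + of_int k * P) = 0"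
    unfolding AE_all_countable using AE_lebesgue_shift[OF zero] by blast
  have 3: "AE x in lebesgue. \<forall>k::int. 0 < - (x + of_int k * P) \<and> - (x + of_int k * P) < P / 2 \<longrightarrow> d (- (x + of_int k * P)) = 0"
    unfolding AE_all_countable using AE_lebesgue_shift[OF AE_lebesgue_reflect[OF zero]] by blast
  have 4: "AE x in lebesgue. \<forall>k::int. d (- (x + of_int k * P)) = - d (x + of_int k * P)"
    unfolding AE_all_countable using AE_lebesgue_shift[OF odd] by blast
  have 5: "AE x in lebesgue. x \<notin> range (\<lambda>k::int. - of_int k * P) \<union> range (\<lambda>k::int. P / 2 - of_int k * P)"
    by (intro AE_lebesgue_countable countable_Un countable_image) auto
  from 1 2 3 4 5 show ?thesis
  proof eventually_elim
    case (elim x)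
    have nat: "d (x + real m * P) = d x" for m
    proof (induction m)
      case (Suc m)
      then show ?case using elim(1)[rule_format, of "int m"] by (simp add: algebra_simps)
    qed simp
    have natm: "d (x - real m * P) = d x" for m
    proof (induction m)
      case (Suc m)
      then show ?case using elim(1)[rule_format, of "- int (Suc m)"] by (simp add: algebra_simps)
    qed simp
    have int: "d (x + of_int k * P) = d x" for k
    proof (cases "k \<ge> 0")
      case True
      then show ?thesis using nat[of "nat k"] by simp
    next
      case False
      then show ?thesis using natm[of "nat (- k)"] by simp
    qed
    define k where "k = - \<lceil>x / P - 1 / 2\<rceil>"
    define y where "y = x + of_int k * P"
    have "of_int (- k) - 1 < x / P - 1 / 2" "x / P - 1 / 2 \<le> of_int (- k)"
      unfolding k_def by linarith+
    then have "(of_int (- k) - 1 / 2) * P < x" "x \<le> (of_int (- k) + 1 / 2) * P"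
      using P by (simp_all add: field_simps)
    then have y: "- (P / 2) < y" "y \<le> P / 2" by (simp_all add: y_def algebra_simps)
    have "y \<noteq> 0"
    proof
      assume "y = 0"
      then have "x = - of_int k * P" by (simp add: y_def)
      then show False using elim(5) by blast
    qed
    moreover have "y \<noteq> P / 2"
    proof
      assume "y = P / 2"
      then have "x = P / 2 - of_int k * P" by (simp add: y_def)
      then show False using elim(5) by blast
    qed
    ultimately have "0 < y \<and> y < P / 2 \<or> 0 < - y \<and> - y < P / 2" using y by linarith
    then have "d y = 0"
    proof
      assume "0 < y \<and> y < P / 2"
      then show ?thesis using elim(2)[rule_format, of k] by (simp add: y_def)
    next
      assume "0 < - y \<and> - y < P / 2"
      then have "d (- y) = 0" using elim(3)[rule_format, of k] unfolding y_def by blast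
      then show ?thesis using elim(4)[rule_format, of k] unfolding y_def by simp
    qed
    then show "d x = 0" using int[of k] by (simp add: y_def)
  qed
qed

lemma continuous_AE_zero:
  fixes g :: "real \<Rightarrow> real"
  assumes c: "continuous_on {a..b} g" and ab: "a < b" and ae: "AE x in lebesgue. x \<in> {a..b} \<longrightarrow> g x = 0"
    and x: "x \<in> {a..b}"
  shows "g x = 0"
proof -
  obtain N where N: "negligible N" "{x. \<not> (x \<in> {a..b} \<longrightarrow> g x = 0)} \<subseteq> N"
    using ae by (auto simp: eventually_ae_filter_negligible)
  have "integral {a..b} (\<lambda>x. \<bar>g x\<bar>) = integral {a..b} (\<lambda>x. 0)"
    by (rule integral_spike[OF N(1)]) (use N(2) in auto)
  then have "\<bar>g x\<bar> = 0"
    using integral_eq_0_iff[of a b "\<lambda>x. \<bar>g x\<bar>"] continuous_on_rabs[OF c] ab x by simp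
  then show ?thesis by simp
qed

lemma fourier_coeff_cong_AE:
  assumes "f \<in> borel_measurable lebesgue" "g \<in> borel_measurable lebesgue" "AE x in lebesgue. f x = g x"
  shows "fourier_coeff f k = fourier_coeff g k"
proof -
  have "continuous_on UNIV (\<lambda>x. cis (- (of_int k * x)))" by (intro continuous_intros)
  then have c: "(\<lambda>x. cis (- (of_int k * x))) \<in> borel_measurable lebesgue"
    by (simp add: borel_measurable_continuous_onI measurable_completion)
  have m: "(\<lambda>x. complex_of_real (h x) * cis (- (of_int k * x))) \<in> borel_measurable lebesgue"
    if "h \<in> borel_measurable lebesgue" for h
  proof (rule borel_measurable_times[OF _ c])
    have "complex_of_real \<in> borel_measurable borel"
      by (intro borel_measurable_continuous_onI continuous_on_of_real continuous_on_id)
    then show "(\<lambda>x. complex_of_real (h x)) \<in> borel_measurable lebesgue"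
      by (rule measurable_compose[OF that])
  qed
  have "(LINT x:{-pi..pi}|lebesgue. complex_of_real (f x) * cis (- (of_int k * x))) =
        (LINT x:{-pi..pi}|lebesgue. complex_of_real (g x) * cis (- (of_int k * x)))"
    by (rule set_lebesgue_integral_cong_AE) (use assms m in auto)
  then show ?thesis by (simp add: fourier_coeff_def)
qed

lemma S_op_cong_AE:
  assumes "f \<in> borel_measurable lebesgue" "g \<in> borel_measurable lebesgue" "AE x in lebesgue. f x = g x"
  shows "S_op f = S_op g"
  unfolding S_op_def fourier_multiplier_def fourier_coeff_cong_AE[OF assms] ..

lemma L2_circle_reflect:
  assumes "L2_circle f" shows "L2_circle (\<lambda>x. f (- x))"
proof -
  have "f (- (x + 2 * pi)) = f (- x)" for x using L2_circle_periodic[OF assms, of "- x - 2 * pi"] by simp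
  moreover have "(\<lambda>x. f (- x)) \<in> borel_measurable lebesgue"
    using borel_measurable_affine[of f "-1" 0] assms by (simp add: L2_circle_def)
  moreover have "(\<lambda>x. (f (- x))\<^sup>2) absolutely_integrable_on {-pi..pi}"
    using absolutely_integrable_reflect_real[where f = "\<lambda>x. (f x)\<^sup>2" and b = pi and a = "-pi"] assms
    by (simp add: L2_circle_def)
  ultimately show ?thesis by (simp add: L2_circle_def)
qed

text \<open>The odd part of \<open>f\<close>.\<close>

lemma odd_representative:
  assumes f: "L2_circle f" and odd: "AE x in lebesgue. f (- x) = - f x"
  obtains g where "odd_L2 g" "AE x in lebesgue. f x = g x"
proof
  have "L2_circle (\<lambda>x. 1/2 * f x + (-1/2) * f (- x))"
    by (rule L2_circle_lincomb[OF f L2_circle_reflect[OF f]])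
  then show "odd_L2 (\<lambda>x. 1/2 * f x + (-1/2) * f (- x))" by (simp add: odd_L2_def)
  show "AE x in lebesgue. f x = 1/2 * f x + (-1/2) * f (- x)" using odd by eventually_elim simp
qed

lemma L2_circle_product_integrable:
  assumes "L2_circle f" "L2_circle g"
  shows "(\<lambda>x. f x * g x) absolutely_integrable_on {-pi..pi}"
proof (rule measurable_bounded_by_integrable_imp_absolutely_integrable[where g = "\<lambda>x. (f x)\<^sup>2 + (g x)\<^sup>2"])
  show "(\<lambda>x. f x * g x) \<in> borel_measurable (lebesgue_on {-pi..pi})"
    using assms by (intro measurable_lebesgue_on borel_measurable_times) (auto simp: L2_circle_def)
  show "(\<lambda>x. (f x)\<^sup>2 + (g x)\<^sup>2) integrable_on {-pi..pi}"
    by (intro integrable_add L2_circle_square_integrable assms)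
  show "norm (f x * g x) \<le> (f x)\<^sup>2 + (g x)\<^sup>2" for x
  proof -
    have "2 * (\<bar>f x\<bar> * \<bar>g x\<bar>) \<le> (f x)\<^sup>2 + (g x)\<^sup>2" using sum_squares_bound[of "\<bar>f x\<bar>" "\<bar>g x\<bar>"] by simp
    moreover have "0 \<le> \<bar>f x\<bar> * \<bar>g x\<bar>" by simp
    ultimately show ?thesis unfolding real_norm_def abs_mult by linarith
  qed
qed simp

text \<open>On an interval where \<open>S f\<close> does not vanish, the weak equation is the linear equation
  \<open>H' = (1 + 1/\<alpha>) H V' / V\<close> for \<open>H = f V\<close>, \<open>V = S f\<close>. Hence \<open>f\<close> is there a multiple of the power
  \<open>1/\<alpha>\<close> of \<open>\<bar>V\<bar>\<close>.\<close>

lemma weak_solution_power: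
  assumes \<alpha>: "\<alpha> > 1" and weak: "weak_solution \<alpha> f" and odd: "AE x in lebesgue. f (- x) = - f x"
    and ab: "- pi \<le> a" "a < b" "b \<le> pi" and nz: "\<And>x. a < x \<Longrightarrow> x < b \<Longrightarrow> S_op f x \<noteq> 0"
  obtains \<sigma> c where "\<sigma> = 1 \<or> \<sigma> = (- 1 :: real)" "continuous_on UNIV (S_op f)"
    "\<forall>x\<in>{a<..<b}. S_op f x = \<sigma> * \<bar>S_op f x\<bar>"
    "AE x in lebesgue. a < x \<and> x < b \<longrightarrow> f x = c * \<bar>S_op f x\<bar> powr (1 / \<alpha>)"
proof -
  let ?I = "{-pi..pi}"
  define q where "q = (\<alpha> + 1) / \<alpha>"
  have q: "q = 1 + 1 / \<alpha>" using \<alpha> by (simp add: q_def field_simps)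
  have f: "L2_circle f" using weak by (simp add: weak_solution_def)
  define V where "V = S_op f"
  obtain g where g: "odd_L2 g" "AE x in lebesgue. f x = g x" using odd_representative[OF f odd] .
  have Lg: "L2_circle g" using g(1) by (simp add: odd_L2_def)
  have "V = S_op g" unfolding V_def using f Lg g(2) by (intro S_op_cong_AE) (auto simp: L2_circle_def)
  then have V: "V = sine_mult S_symbol g" by (simp add: S_op_odd[OF g(1)])
  have cV: "continuous_on S V" for S
    unfolding V by (rule continuous_on_subset[OF sine_mult_continuous[OF Lg S_symbol_bound]]) simp
  obtain D where wD: "weak_deriv_circle V D" and eqD: "\<And>\<psi>. smooth_circle \<psi> \<Longrightarrow>
      - \<alpha> * (LINT x:?I|lebesgue. f x * V x * deriv \<psi> x) = (\<alpha> + 1) * (LINT x:?I|lebesgue. f x * D x * \<psi> x)"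
    using weak unfolding weak_solution_def V_def by blast
  have LD: "L2_circle D" using wD by (simp add: weak_deriv_circle_def)
  note aD = L2_circle_integrable[OF LD]
  have aV: "V absolutely_integrable_on ?I" by (rule absolutely_integrable_continuous_real[OF cV])
  have LINT: "(LINT x:?I|lebesgue. u x * w x) = integral ?I (\<lambda>x. u x * w x)"
    if "u absolutely_integrable_on ?I" "continuous_on ?I w" for u w :: "real \<Rightarrow> real"
    by (rule set_lebesgue_integral_eq_integral(2)[OF continuous_times_integrable[OF that]])
  obtain V1 where V1: "primitive_on (-pi) pi V1 D" "AE x in lebesgue. x \<in> ?I \<longrightarrow> V x = V1 x"
  proof (rule weak_derivative_primitive[OF aV aD])
    fix \<psi> assume \<psi>: "smooth_circle \<psi>"
    note d\<psi> = smooth_circle_derivative[OF \<psi>]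
    show "integral ?I (\<lambda>x. V x * deriv \<psi> x) = - integral ?I (\<lambda>x. D x * \<psi> x)"
      using wD \<psi> LINT[OF aV d\<psi>(2)] LINT[OF aD d\<psi>(3)] unfolding weak_deriv_circle_def by simp
  qed
  have VV1: "V x - V1 x = 0" if "x \<in> ?I" for x
  proof (rule continuous_AE_zero[OF _ _ _ that])
    show "continuous_on ?I (\<lambda>x. V x - V1 x)" by (intro continuous_on_diff cV primitive_on_continuous[OF V1(1)])
    show "AE x in lebesgue. x \<in> ?I \<longrightarrow> V x - V1 x = 0" using V1(2) by eventually_elim auto
  qed simp
  have primV: "primitive_on (-pi) pi V D"
    unfolding primitive_on_def
  proof (intro conjI aD ballI)
    fix x assume x: "x \<in> ?I"
    then show "V x = V (-pi) + integral {-pi..x} D"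
      using VV1[OF x] VV1[of "-pi"] primitive_on_eq[OF V1(1) x] by simp
  qed
  have aFV: "(\<lambda>x. f x * V x) absolutely_integrable_on ?I"
    by (rule continuous_times_integrable[OF L2_circle_integrable[OF f] cV])
  have aFD: "(\<lambda>x. f x * D x) absolutely_integrable_on ?I" by (rule L2_circle_product_integrable[OF f LD])
  have aqFD: "(\<lambda>x. q * (f x * D x)) absolutely_integrable_on ?I"
    using aFD by (rule set_integrable_mult_right)
  obtain H where H: "primitive_on (-pi) pi H (\<lambda>x. q * (f x * D x))" "AE x in lebesgue. x \<in> ?I \<longrightarrow> f x * V x = H x"
  proof (rule weak_derivative_primitive[OF aFV aqFD])
    fix \<psi> assume \<psi>: "smooth_circle \<psi>"
    note d\<psi> = smooth_circle_derivative[OF \<psi>]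
    have "- \<alpha> * integral ?I (\<lambda>x. f x * V x * deriv \<psi> x) = (\<alpha> + 1) * integral ?I (\<lambda>x. f x * D x * \<psi> x)"
      using eqD[OF \<psi>] LINT[OF aFV d\<psi>(2)] LINT[OF aFD d\<psi>(3)] by simp
    then have "integral ?I (\<lambda>x. f x * V x * deriv \<psi> x) = - (q * integral ?I (\<lambda>x. f x * D x * \<psi> x))"
      using \<alpha> by (simp add: q_def field_simps)
    then show "integral ?I (\<lambda>x. f x * V x * deriv \<psi> x) = - integral ?I (\<lambda>x. q * (f x * D x) * \<psi> x)"
      by (simp add: mult.assoc)
  qed
  obtain N where N: "negligible N" "\<And>x. x \<in> ?I \<Longrightarrow> x \<notin> N \<Longrightarrow> f x * V x = H x"
    using H(2) by (auto simp: eventually_ae_filter_negligible)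
  define m where "m = (a + b) / 2"
  have m: "a < m" "m < b" using ab by (auto simp: m_def)
  define \<sigma> where "\<sigma> = sgn (V m)"
  have \<sigma>: "\<sigma> = 1 \<or> \<sigma> = - 1" using nz[OF m] by (auto simp: \<sigma>_def V_def sgn_if)
  have sgnV: "sgn (V x) = \<sigma>" if x: "a < x" "x < b" for x
  proof (rule ccontr)
    assume ne: "sgn (V x) \<noteq> \<sigma>"
    have "V x \<noteq> 0" "V m \<noteq> 0" using nz x m by (auto simp: V_def)
    then have "0 \<in> closed_segment (V x) (V m)"
      using ne by (auto simp: \<sigma>_def closed_segment_eq_real_ivl sgn_if split: if_splits)
    moreover have "connected (V ` {a<..<b})" by (rule connected_continuous_image[OF cV]) simp
    then have "closed_segment (V x) (V m) \<subseteq> V ` {a<..<b}"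
      using x m by (intro closed_segment_subset) (auto simp: connected_convex_1)
    ultimately show False using nz by (auto simp: V_def)
  qed
  define W where "W = (\<lambda>x. \<sigma> * V x)"
  have W: "W x = \<bar>V x\<bar>" "V x = \<sigma> * \<bar>V x\<bar>" "W x > 0" if x: "a < x" "x < b" for x
    using sgnV[OF x] nz[OF x] \<sigma> by (auto simp: W_def V_def sgn_if split: if_splits)
  have scale: "primitive_on (-pi) pi (\<lambda>x. \<sigma> * U x) (\<lambda>x. \<sigma> * u x)" if U: "primitive_on (-pi) pi U u" for U u
    unfolding primitive_on_def
  proof (intro conjI ballI)
    show "(\<lambda>x. \<sigma> * u x) absolutely_integrable_on ?I"
      using primitive_on_abs[OF U] by (rule set_integrable_mult_right)
    fix x assume "x \<in> ?I"
    then show "\<sigma> * U x = \<sigma> * U (-pi) + integral {-pi..x} (\<lambda>x. \<sigma> * u x)"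
      using primitive_on_eq[OF U, of x] by (simp add: distrib_left)
  qed
  define c0 where "c0 = \<sigma> * H m * W m powr (- q)"
  have const: "\<sigma> * H x * W x powr (- q) = c0" if x: "a < x" "x < b" for x
  proof -
    define l u where "l = min x m" and "u = max x m"
    have lu: "a < l" "l \<le> u" "u < b" "x \<in> {l..u}" "m \<in> {l..u}" using x m by (auto simp: l_def u_def)
    have "\<sigma> * H y * W y powr (- q) = \<sigma> * H l * W l powr (- q)" if y: "y \<in> {l..u}" for y
    proof (rule primitive_ode[OF _ _ _ N(1) _ y])
      show "primitive_on l u (\<lambda>x. \<sigma> * H x) (\<lambda>x. \<sigma> * (q * (f x * D x)))"
        by (rule primitive_on_subinterval[OF scale[OF H(1)]]) (use lu ab in auto)
      show "primitive_on l u W (\<lambda>x. \<sigma> * D x)"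
        unfolding W_def by (rule primitive_on_subinterval[OF scale[OF primV]]) (use lu ab in auto)
      show "W x > 0" if "x \<in> {l..u}" for x using W(3)[of x] that lu by auto
      show "\<sigma> * (q * (f x * D x)) * W x = q * (\<sigma> * H x) * (\<sigma> * D x)" if "x \<in> {l..u}" "x \<notin> N" for x
        using N(2)[of x] that lu ab by (simp add: W_def mult_ac)
    qed
    note at = this
    show ?thesis unfolding c0_def by (rule trans[OF at[OF lu(4)] at[OF lu(5), symmetric]])
  qed
  have fx: "f x = c0 * \<bar>V x\<bar> powr (1 / \<alpha>)" if x: "a < x" "x < b" "x \<notin> N" for x
  proof -
    have Wx: "W x > 0" using W(3) x by auto
    have "f x * V x = H x" using N(2)[of x] x ab by auto
    then have "f x * W x = \<sigma> * H x" by (simp add: W_def)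
    then have "f x * W x * W x powr (- q) = c0" using const[of x] x by simp
    then have "f x * (W x * W x powr (- q)) = c0" by (simp add: mult.assoc)
    moreover have "W x * W x powr (- q) = W x powr (- (1 / \<alpha>))"
      using Wx powr_add[of "W x" 1 "- q"] by (simp add: q)
    ultimately have "f x * W x powr (- (1 / \<alpha>)) * W x powr (1 / \<alpha>) = c0 * W x powr (1 / \<alpha>)" by simp
    then have "f x = c0 * W x powr (1 / \<alpha>)" using Wx by (simp add: mult.assoc flip: powr_add)
    then show ?thesis using W(1) x by simp
  qed
  show thesis
  proof
    show "\<sigma> = 1 \<or> \<sigma> = - 1" by (rule \<sigma>)
    show "continuous_on UNIV (S_op f)" using cV unfolding V_def .
    show "\<forall>x\<in>{a<..<b}. S_op f x = \<sigma> * \<bar>S_op f x\<bar>"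
    proof
      fix x assume "x \<in> {a<..<b}"
      then have "a < x" "x < b" by auto
      then show "S_op f x = \<sigma> * \<bar>S_op f x\<bar>" unfolding V_def[symmetric] by (rule W(2))
    qed
    show "AE x in lebesgue. a < x \<and> x < b \<longrightarrow> f x = c0 * \<bar>S_op f x\<bar> powr (1 / \<alpha>)"
      unfolding eventually_ae_filter_negligible using N(1) fx unfolding V_def by (intro exI[of _ N]) blast
  qed
qed

text \<open>With \<open>\<omega>\<close> the modulus of \<open>S f\<close> transported to the half period, \<open>f\<close> is \<open>c\<close> times the odd periodic extension of
  \<open>\<omega>\<^sup>p\<close>, first on \<open>(0, \<pi>/n)\<close> and then almost everywhere. Inserting this in \<open>S f\<close> gives \<open>\<omega> = \<kappa> T (\<omega>\<^sup>p)\<close>, where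
  \<open>T = - S\<^sub>n\<close>, and \<open>\<kappa> > 0\<close> because \<open>T\<close> is positive. Since the equation is not homogeneous of degree one, a
  suitable multiple \<open>\<theta> \<omega>\<close> solves \<open>v = T (v\<^sup>p)\<close>.\<close>

theorem classification:
  assumes n: "n \<ge> 3" and \<alpha>: "\<alpha> > 1"
    and unique: "\<And>w. nonneg_nonzero_solution \<alpha> n w \<Longrightarrow> \<forall>x\<in>{0..pi}. w x = v x"
    and f: "L2_circle f" and odd: "AE x in lebesgue. f (- x) = - f x"
    and per: "AE x in lebesgue. f (x + 2 * pi / real n) = f x"
    and weak: "weak_solution \<alpha> f"
    and nz: "\<And>x. 0 < x \<Longrightarrow> x < pi / real n \<Longrightarrow> S_op f x \<noteq> 0"
  shows "\<exists>c. AE x in lebesgue. f x = c * odd_ext (\<lambda>y. - (v y powr (1 / \<alpha>))) (real n * x)"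
proof -
  define p where "p = 1 / \<alpha>"
  have p: "0 < p" "p < 1" using \<alpha> by (auto simp: p_def)
  have n0: "real n > 0" "n > 0" using n by auto
  have pn: "0 < pi / real n" "pi / real n \<le> pi" using n0 by (auto simp: divide_le_eq)
  have pn': "- pi \<le> 0" by simp
  obtain \<sigma> c where \<sigma>: "\<sigma> = 1 \<or> \<sigma> = (- 1 :: real)" and cS: "continuous_on UNIV (S_op f)"
    and S\<sigma>: "\<forall>x\<in>{0<..<pi / real n}. S_op f x = \<sigma> * \<bar>S_op f x\<bar>"
    and fc: "AE x in lebesgue. 0 < x \<and> x < pi / real n \<longrightarrow> f x = c * \<bar>S_op f x\<bar> powr (1 / \<alpha>)"
    by (rule weak_solution_power[OF \<alpha> weak odd pn' pn nz])
  note fc = fc[folded p_def]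
  define \<omega> where "\<omega> = (\<lambda>y. \<bar>S_op f (y / real n)\<bar>)"
  have c\<omega>: "continuous_on S \<omega>" for S
  proof -
    have "continuous_on S (\<lambda>y. y / real n)"
      by (rule continuous_on_divide[OF continuous_on_id continuous_on_const]) (use n0 in simp)
    then have "continuous_on S (\<lambda>y. S_op f (y / real n))" by (rule continuous_on_compose2[OF cS]) simp
    then show ?thesis unfolding \<omega>_def by (rule continuous_on_rabs)
  qed
  have \<omega>0: "\<omega> y \<ge> 0" for y by (simp add: \<omega>_def)
  define G where "G = odd_ext (\<lambda>y. \<omega> y powr p)"
  have cpow: "continuous_on {0..pi} (\<lambda>y. \<omega> y powr p)"
    using p \<omega>0 by (intro continuous_on_powr' c\<omega> continuous_on_const) auto
  have G: "odd_L2 G" unfolding G_def by (rule odd_L2_odd_ext_continuous[OF cpow])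
  define F where "F = (\<lambda>x. c * G x + 0 * G x)"
  have F: "odd_L2 F" unfolding F_def by (rule odd_L2_lincomb[OF G G])
  have LG: "L2_circle G" using G by (simp add: odd_L2_def)
  have Fn: "odd_L2 (\<lambda>x. F (real n * x))" by (rule odd_L2_scaled[OF F n0(2)])
  have Fc: "F x = c * G x" for x by (simp add: F_def)
  have ae: "AE x in lebesgue. f x = F (real n * x)"
  proof -
    have "AE x in lebesgue. f x - F (real n * x) = 0"
    proof (rule odd_periodic_AE_zero[where P = "2 * pi / real n"])
      show "2 * pi / real n > 0" using n0 by simp
      show "AE x in lebesgue. f (- x) - F (real n * - x) = - (f x - F (real n * x))"
        using odd by eventually_elim (use F in \<open>simp add: odd_L2_def\<close>)
      have Fper: "F (real n * (x + 2 * pi / real n)) = F (real n * x)" for x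
        using L2_circle_periodic[of F "real n * x"] F n0 by (simp add: odd_L2_def distrib_left)
      show "AE x in lebesgue. f (x + 2 * pi / real n) - F (real n * (x + 2 * pi / real n)) = f x - F (real n * x)"
        using per by eventually_elim (simp only: Fper)
      show "AE x in lebesgue. 0 < x \<and> x < 2 * pi / real n / 2 \<longrightarrow> f x - F (real n * x) = 0"
        using fc
      proof eventually_elim
        case (elim x)
        show ?case
        proof
          assume x: "0 < x \<and> x < 2 * pi / real n / 2"
          then have "0 < real n * x" "real n * x < pi" using n0 by (auto simp: field_simps)
          then have "F (real n * x) = c * \<bar>S_op f x\<bar> powr p" using n0 by (simp add: Fc G_def \<omega>_def)
          then show "f x - F (real n * x) = 0" using elim x by simp
        qed
      qed
    qed
    then show ?thesis by eventually_elim simp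
  qed
  have "S_op f = S_op (\<lambda>x. F (real n * x))"
    using f Fn ae by (intro S_op_cong_AE) (auto simp: L2_circle_def odd_L2_def)
  moreover have "sine_mult (Sn_symbol n) F y = c * sine_mult (Sn_symbol n) G y" for y
    using sine_mult_linear[OF LG LG Sn_symbol_bound[OF n], of c 0 y] unfolding F_def by simp
  ultimately have Sf: "S_op f (y / real n) = - (c / real n) * sine_mult (Sn_symbol n) G y" for y
    using S_op_scaled[OF F n, of "y / real n"] n0 by simp
  define \<kappa> where "\<kappa> = - (\<sigma> * c / real n)"
  have \<omega>\<kappa>: "\<omega> y = \<kappa> * half_op n (\<lambda>y. \<omega> y powr p) y" if y: "y \<in> {0..pi}" for y
  proof (cases "y = 0 \<or> y = pi")
    case True
    then have zero: "sine_mult (Sn_symbol n) G y = 0" by auto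
    then have "\<omega> y = 0" using Sf[of y] by (simp add: \<omega>_def)
    then show ?thesis unfolding half_op_def G_def[symmetric] zero by simp
  next
    case False
    then have "0 < y / real n" "y / real n < pi / real n" using y n0 by (auto simp: divide_strict_right_mono)
    then have "S_op f (y / real n) = \<sigma> * \<omega> y" unfolding \<omega>_def by (intro bspec[OF S\<sigma>]) simp
    then have "\<sigma> * \<omega> y = - (c / real n) * sine_mult (Sn_symbol n) G y" using Sf[of y] by simp
    then have "\<sigma> * (\<sigma> * \<omega> y) = \<sigma> * (- (c / real n) * sine_mult (Sn_symbol n) G y)" by (rule arg_cong)
    also have "\<dots> = \<kappa> * sine_mult (Sn_symbol n) G y" by (simp add: \<kappa>_def)
    finally have "\<sigma> * (\<sigma> * \<omega> y) = \<kappa> * sine_mult (Sn_symbol n) G y" .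
    moreover have "\<sigma> * (\<sigma> * \<omega> y) = \<omega> y" using \<sigma> by auto
    ultimately show ?thesis by (simp add: half_op_def G_def)
  qed
  have half: "\<omega> (pi / 2) > 0"
  proof -
    have "0 < pi / 2 / real n" using n0 by simp
    moreover have "pi / 2 / real n < pi / real n" by (rule divide_strict_right_mono[OF _ n0(1)]) simp
    ultimately show ?thesis using nz[of "pi / 2 / real n"] by (simp add: \<omega>_def)
  qed
  have "half_op n (\<lambda>y. \<omega> y powr p) (pi / 2) \<ge> 0"
    unfolding half_op_def G_def[symmetric] by (rule Sn_positive[OF G _ n]) (auto simp: G_def)
  then have \<kappa>: "\<kappa> > 0" using \<omega>\<kappa>[of "pi / 2"] half by (auto simp: zero_less_mult_iff)
  \<comment> \<open>The factor for which \<open>\<theta> \<omega> = \<theta> \<kappa> T (\<omega>\<^sup>p)\<close> becomes \<open>T ((\<theta> \<omega>)\<^sup>p)\<close>.\<close>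
  define \<theta> where "\<theta> = \<kappa> powr (- 1 / (1 - p))"
  have \<theta>: "\<theta> > 0" using \<kappa> by (simp add: \<theta>_def)
  have \<theta>\<kappa>: "\<theta> * \<kappa> = \<theta> powr p"
  proof -
    have "- 1 / (1 - p) * (1 - p) = - 1" using p by simp
    then have "\<theta> powr (1 - p) = inverse \<kappa>"
      unfolding \<theta>_def powr_powr using \<kappa> by (simp only: powr_minus powr_one)
    then have "\<theta> powr p * \<theta> powr (1 - p) * \<kappa> = \<theta> powr p" using \<kappa> by simp
    then show ?thesis using powr_split[OF \<theta>, of p] by simp
  qed
  define u where "u = (\<lambda>y. \<theta> * \<omega> y)"
  have up: "u y powr p = \<theta> powr p * \<omega> y powr p" for y using \<theta> \<omega>0 by (simp add: u_def powr_mult)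
  have ext_u: "odd_ext (\<lambda>y. u y powr p) = (\<lambda>x. \<theta> powr p * G x + 0 * G x)"
    by (simp add: up odd_ext_cmult G_def fun_eq_iff)
  have "nonneg_nonzero_solution \<alpha> n u"
    unfolding nonneg_nonzero_solution_iff[OF n] p_def[symmetric]
  proof (intro conjI ballI)
    show "odd_L2 (odd_ext (\<lambda>y. u y powr p))" unfolding ext_u by (rule odd_L2_lincomb[OF G G])
    show "u x \<ge> 0" for x using \<theta> \<omega>0 by (simp add: u_def)
    show "\<exists>x\<in>{0..pi}. u x \<noteq> 0"
      using half \<theta> by (intro bexI[of _ "pi / 2"]) (auto simp: u_def)
    fix x assume x: "x \<in> {0..pi}"
    have "half_op n (\<lambda>y. u y powr p) x = \<theta> powr p * half_op n (\<lambda>y. \<omega> y powr p) x"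
      unfolding half_op_def ext_u G_def[symmetric]
      using sine_mult_linear[OF LG LG Sn_symbol_bound[OF n], of "\<theta> powr p" 0 x] by simp
    also have "\<dots> = \<theta> * (\<kappa> * half_op n (\<lambda>y. \<omega> y powr p) x)" by (simp add: \<theta>\<kappa>[symmetric])
    also have "\<dots> = u x" using \<omega>\<kappa>[OF x] by (simp add: u_def)
    finally show "u x = half_op n (\<lambda>y. u y powr p) x" by simp
  qed
  then have uv: "u x = v x" if "x \<in> {0..pi}" for x using unique that by blast
  have eq: "odd_ext (\<lambda>y. - (v y powr p)) x = - (\<theta> powr p) * G x" for x
  proof -
    have "odd_ext (\<lambda>y. - (v y powr p)) x = odd_ext (\<lambda>y. - (\<theta> powr p) * \<omega> y powr p) x"
    proof (rule odd_periodic_eqI[where F = "odd_ext (\<lambda>y. - (v y powr p))"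
          and G = "odd_ext (\<lambda>y. - (\<theta> powr p) * \<omega> y powr p)"])
      fix y :: real assume "0 < y" "y < pi"
      then show "odd_ext (\<lambda>y. - (v y powr p)) y = odd_ext (\<lambda>y. - (\<theta> powr p) * \<omega> y powr p) y"
        using uv[of y] up[of y] by simp
    qed (rule odd_ext_odd odd_ext_periodic)+
    then show ?thesis by (simp only: odd_ext_cmult G_def)
  qed
  have "F x = (- c / \<theta> powr p) * odd_ext (\<lambda>y. - (v y powr p)) x" for x
    unfolding eq Fc using \<theta> by simp
  then have "AE x in lebesgue. f x = (- c / \<theta> powr p) * odd_ext (\<lambda>y. - (v y powr p)) (real n * x)"
    using ae by simp
  then show ?thesis unfolding p_def by blast
qed

theorem theorem3p1:
  fixes \<alpha> :: real and n :: nat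
  assumes "\<alpha> > 1" and "n \<ge> 3"
  shows "\<exists>v f\<^sub>\<alpha> :: real \<Rightarrow> real.
    continuous_on {0..pi} v \<and>
    nonneg_nonzero_solution \<alpha> n v \<and>
    (\<forall>w. nonneg_nonzero_solution \<alpha> n w \<longrightarrow> (\<forall>x\<in>{0..pi}. w x = v x)) \<and>
    f\<^sub>\<alpha> = (\<lambda>x. odd_ext (\<lambda>y. - (v y powr (1 / \<alpha>))) (real n * x)) \<and>
    (\<forall>x. f\<^sub>\<alpha> (- x) = - f\<^sub>\<alpha> x) \<and>
    (\<forall>x. f\<^sub>\<alpha> (x + 2 * pi / real n) = f\<^sub>\<alpha> x) \<and>
    holder_circle (1 / \<alpha>) f\<^sub>\<alpha> \<and>
    fourier_coeff f\<^sub>\<alpha> (int n) \<noteq> 0 \<and>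
    weak_solution \<alpha> f\<^sub>\<alpha> \<and>
    (\<forall>f. L2_circle f \<and>
         (AE x in lebesgue. f (- x) = - f x) \<and>
         (AE x in lebesgue. f (x + 2 * pi / real n) = f x) \<and>
         weak_solution \<alpha> f \<and>
         (\<forall>x. 0 < x \<and> x < pi / real n \<longrightarrow> S_op f x \<noteq> 0) \<longrightarrow>
         (\<exists>c. AE x in lebesgue. f x = c * f\<^sub>\<alpha> x))"
proof -
  obtain v where v: "continuous_on {0..pi} v" "nonneg_nonzero_solution \<alpha> n v"
    "\<And>x. 0 \<le> x \<Longrightarrow> x \<le> pi \<Longrightarrow> sin x \<le> v x"
    "\<And>w x. nonneg_nonzero_solution \<alpha> n w \<Longrightarrow> 0 \<le> x \<Longrightarrow> x \<le> pi \<Longrightarrow> w x \<le> v x"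
    using greatest_solution[OF assms(2,1)] by blast
  have pos: "v x > 0" if "0 < x" "x < pi" for x
    using v(3)[of x] sin_gt_zero[OF that] that by simp
  have unique: "\<forall>x\<in>{0..pi}. w x = v x" if w: "nonneg_nonzero_solution \<alpha> n w" for w
  proof
    fix x assume x: "x \<in> {0..pi}"
    show "w x = v x"
      by (rule solution_unique_below[OF assms(2,1) v(2) pos w v(4)[OF w]]) (use x in auto)
  qed
  define f\<^sub>\<alpha> where "f\<^sub>\<alpha> = (\<lambda>x. odd_ext (\<lambda>y. - (v y powr (1 / \<alpha>))) (real n * x))"
  note sol = rescaled_solution[OF assms(2,1) v(2,3), folded f\<^sub>\<alpha>_def]
  have "\<exists>c. AE x in lebesgue. f x = c * f\<^sub>\<alpha> x"
    if "L2_circle f" "AE x in lebesgue. f (- x) = - f x"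
      "AE x in lebesgue. f (x + 2 * pi / real n) = f x" "weak_solution \<alpha> f"
      "\<And>x. 0 < x \<Longrightarrow> x < pi / real n \<Longrightarrow> S_op f x \<noteq> 0" for f
    unfolding f\<^sub>\<alpha>_def by (rule classification[OF assms(2,1) unique that])
  then show ?thesis
    using v(1,2) unique sol f\<^sub>\<alpha>_def
    by (intro exI[of _ v] exI[of _ f\<^sub>\<alpha>]) (intro conjI allI impI; (elim conjE)?; blast)
qed

end
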